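(* Let $(M_i,\mathcal{F}_i,g_i)$, $i=1,2$, be compact connected foliated Riemannian manifolds with boundary such that $\mathcal{F}_i$ is tangent to the boundary. Let $S_i\subset\partial M_i$ be a nonempty union of boundary components ($i=1,2$) and let $h:S_1\to S_2$ be an isometry mapping leaves onto leaves. Let $M=M_1\cup_h M_2$ be the quotient of $M_1\amalg M_2$ by $x\equiv h(x)$ ($x\in S_1$), with the foliation $\mathcal{F}=\mathcal{F}_1\cup_h\mathcal{F}_2$ defined by the leaves of $\mathcal{F}_1$ and $\mathcal{F}_2$, and assume that there is a smooth Riemannian structure $g$ on $M$ with $g|_{M_i}=g_i$ ($i=1,2$). Let $\pi_i:M_i\to\mathrm{HLS}(\mathcal{F}_i)$ be the natural projections, and let $(X,d_X)$ be the quotient metric space of $\mathrm{HLS}(\mathcal{F}_1)\amalg\mathrm{HLS}(\mathcal{F}_2)$ by the smallest equivalence relation such that $\pi_1(x)\sim\pi_2(h(x))$ for all $x\in S_1$. Then $\mathrm{HLS}(\mathcal{F})$ (computed with respect to $g$) is isometric to $(X,d_X)$.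
   Context: Hausdorff leaf space: for a compact connected foliated Riemannian manifold $(M,\mathcal{F},g)$ with Riemannian distance $d$ and set of leaves $\mathcal{L}$, put $\mathrm{dist}(L,L')=\inf\{d(x,y):x\in L,\,y\in L'\}$ and $$\rho(L,L')=\inf\Big\{\sum_{i=1}^{n-1}\mathrm{dist}(L_i,L_{i+1})\Big\},$$ the infimum being over all finite sequences of leaves $L_1,\dots,L_n$ with $L_1=L$, $L_n=L'$. Put $L\sim L'$ iff $\rho(L,L')=0$, $\tilde{\mathcal{L}}=\mathcal{L}/_\sim$ and $\tilde\rho([L],[L'])=\rho(L,L')$. The metric space $(\tilde{\mathcal{L}},\tilde\rho)$ is the Hausdorff leaf space $\mathrm{HLS}(\mathcal{F})$; the natural projection $M\to\mathrm{HLS}(\mathcal{F})$ sends $x$ to the class of the leaf through $x$. A foliation is tangent to the boundary if the boundary is a union of leaves. Disjoint union metric: on $Y_1\amalg Y_2$ the distance is that of $Y_j$ for two points of $Y_j$ and $\infty$ for points of different components. Quotient metric space: for a (possibly infinite-valued) metric space $(Y,d)$ with an equivalence relation $R$, put $d_R(x,y)=\inf\sum_{i=1}^k d(p_i,q_i)$ over all $k$ and all $p_1,q_1,\dots,p_k,q_k\in Y$ with $p_1=x$, $q_k=y$ and $(p_{i+1},q_i)\in R$ for $1\le i<k$; the quotient metric space is obtained by identifying points at $d_R$-distance $0$. *)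

theory Defs
  imports "HOL-Analysis.Analysis"
begin

section \<open>Smooth maps between subsets of Euclidean spaces\<close>

fun Ck_on_open :: "nat \<Rightarrow> 'a::euclidean_space set \<Rightarrow> ('a \<Rightarrow> 'b::euclidean_space) \<Rightarrow> bool" where
  "Ck_on_open 0 W f \<longleftrightarrow> continuous_on W f"
| "Ck_on_open (Suc k) W f \<longleftrightarrow> (\<forall>x\<in>W. f differentiable (at x)) \<and>
     (\<forall>v. Ck_on_open k W (\<lambda>x. frechet_derivative f (at x) v))"

text \<open>On a set that need not be open (a relatively open part of a half-space, say), smooth means:
  locally the restriction of a \<open>C\<^sup>\<infinity>\<close> map defined on an open set.\<close>

definition smooth_on :: "'a::euclidean_space set \<Rightarrow> ('a \<Rightarrow> 'b::euclidean_space) \<Rightarrow> bool" where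
  "smooth_on A f \<longleftrightarrow> (\<forall>x\<in>A. \<exists>W G. open W \<and> x \<in> W \<and> (\<forall>k. Ck_on_open k W G) \<and>
     (\<forall>y\<in>W \<inter> A. G y = f y))"


section \<open>Smooth manifolds with boundary\<close>

text \<open>The model space is a half-space of \<open>'e\<close>; the choice of the inner normal among the basis
  vectors is immaterial.\<close>

definition inner_normal :: "'e::euclidean_space" where
  "inner_normal = (SOME b. b \<in> Basis)"

definition half_space :: "'e::euclidean_space set" where
  "half_space = {z. 0 \<le> z \<bullet> inner_normal}"

definition boundary_plane :: "'e::euclidean_space set" where
  "boundary_plane = {z. z \<bullet> inner_normal = 0}"

text \<open>A chart is its domain together with a coordinate map, whose values off the domain are
  irrelevant.\<close>

type_synonym ('a, 'e) chart = "'a set \<times> ('a \<Rightarrow> 'e)"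

definition is_chart :: "'a topology \<Rightarrow> ('a, 'e::euclidean_space) chart \<Rightarrow> bool" where
  "is_chart T c \<longleftrightarrow> openin T (fst c) \<and>
     openin (top_of_set half_space) (snd c ` fst c) \<and>
     homeomorphic_map (subtopology T (fst c)) (top_of_set (snd c ` fst c)) (snd c)"

text \<open>The coordinate representation of a map \<open>f\<close>, considered on the set \<open>D\<close>, and its domain.
  For \<open>f = id\<close> these are the transition maps.\<close>

definition local_dom ::
  "('a, 'e::euclidean_space) chart \<Rightarrow> ('b, 'e) chart \<Rightarrow> 'a set \<Rightarrow> ('a \<Rightarrow> 'b) \<Rightarrow> 'e set" where
  "local_dom c c' D f = snd c ` {x \<in> fst c \<inter> D. f x \<in> fst c'}"

definition local_rep ::
  "('a, 'e::euclidean_space) chart \<Rightarrow> ('b, 'e) chart \<Rightarrow> ('a \<Rightarrow> 'b) \<Rightarrow> 'e \<Rightarrow> 'e" where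
  "local_rep c c' f = snd c' \<circ> f \<circ> inv_into (fst c) (snd c)"

text \<open>Continuity of \<open>f\<close> is not part of this notion and has to be required separately.\<close>

definition smooth_in_charts ::
  "('a, 'e::euclidean_space) chart set \<Rightarrow> ('b, 'e) chart set \<Rightarrow> 'a set \<Rightarrow> ('a \<Rightarrow> 'b) \<Rightarrow> bool" where
  "smooth_in_charts A A' D f \<longleftrightarrow>
     (\<forall>c\<in>A. \<forall>c'\<in>A'. smooth_on (local_dom c c' D f) (local_rep c c' f))"

definition smooth_manifold :: "'a topology \<Rightarrow> ('a, 'e::euclidean_space) chart set \<Rightarrow> bool" where
  "smooth_manifold T A \<longleftrightarrow> Hausdorff_space T \<and> second_countable T \<and>
     (\<forall>c\<in>A. is_chart T c) \<and> (\<Union>c\<in>A. fst c) = topspace T \<and>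
     smooth_in_charts A A (topspace T) id"

definition manifold_boundary :: "('a, 'e::euclidean_space) chart set \<Rightarrow> 'a set" where
  "manifold_boundary A = {x. \<exists>c\<in>A. x \<in> fst c \<and> snd c x \<in> boundary_plane}"


section \<open>Riemannian metrics and the Riemannian distance\<close>

text \<open>A Riemannian metric is the family of its coordinate expressions: \<open>g c z u v\<close> is the product
  of the vectors with coordinates \<open>u\<close>, \<open>v\<close> with respect to the chart \<open>c\<close>, at the point with
  coordinates \<open>z\<close>.\<close>

type_synonym ('a, 'e) metric_tensor = "('a, 'e) chart \<Rightarrow> 'e \<Rightarrow> 'e \<Rightarrow> 'e \<Rightarrow> real"

text \<open>\<open>g'(Df u, Df v) = g(u, v)\<close> for all \<open>u\<close>, \<open>v\<close> whose coordinates lie in \<open>K\<close>, at all points of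
  \<open>D\<close>. Here \<open>K = UNIV\<close> if \<open>D\<close> is open in the manifold, and \<open>K = boundary_plane\<close> if \<open>D\<close> is open
  in the boundary; in either case the derivative within the local domain is unique on \<open>K\<close>.\<close>

definition preserves_metric ::
  "('a, 'e::euclidean_space) chart set \<Rightarrow> ('a, 'e) metric_tensor \<Rightarrow>
   ('b, 'e) chart set \<Rightarrow> ('b, 'e) metric_tensor \<Rightarrow> 'a set \<Rightarrow> 'e set \<Rightarrow> ('a \<Rightarrow> 'b) \<Rightarrow> bool" where
  "preserves_metric A g A' g' D K f \<longleftrightarrow>
     (\<forall>c\<in>A. \<forall>c'\<in>A'. \<forall>x \<in> fst c \<inter> D. f x \<in> fst c' \<longrightarrow>
       (let df = frechet_derivative (local_rep c c' f) (at (snd c x) within local_dom c c' D f)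
        in \<forall>u\<in>K. \<forall>v\<in>K. g' c' (snd c' (f x)) (df u) (df v) = g c (snd c x) u v))"

definition riemannian_manifold ::
  "'a topology \<Rightarrow> ('a, 'e::euclidean_space) chart set \<Rightarrow> ('a, 'e) metric_tensor \<Rightarrow> bool" where
  "riemannian_manifold T A g \<longleftrightarrow> smooth_manifold T A \<and>
     (\<forall>c\<in>A. \<forall>z \<in> snd c ` fst c. bilinear (g c z) \<and>
        (\<forall>u v. g c z u v = g c z v u) \<and> (\<forall>u. u \<noteq> 0 \<longrightarrow> 0 < g c z u u)) \<and>
     (\<forall>c\<in>A. \<forall>u v. smooth_on (snd c ` fst c) (\<lambda>z. g c z u v)) \<and>
     preserves_metric A g A g (topspace T) UNIV id"

text \<open>\<open>C\<^sup>1\<close> up to the end points of the interval, with one-sided derivatives there.\<close>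

definition C1_curve_on ::
  "('a, 'e::euclidean_space) chart set \<Rightarrow> real \<Rightarrow> real \<Rightarrow> (real \<Rightarrow> 'a) \<Rightarrow> bool" where
  "C1_curve_on A a b \<gamma> \<longleftrightarrow> (\<forall>c\<in>A. \<exists>\<gamma>'.
     (\<forall>t\<in>{a..b}. \<gamma> t \<in> fst c \<longrightarrow>
        ((snd c \<circ> \<gamma>) has_vector_derivative \<gamma>' t) (at t within {a..b})) \<and>
     continuous_on {t \<in> {a..b}. \<gamma> t \<in> fst c} \<gamma>')"

definition piecewise_C1_curve ::
  "'a topology \<Rightarrow> ('a, 'e::euclidean_space) chart set \<Rightarrow> (real \<Rightarrow> 'a) \<Rightarrow> bool" where
  "piecewise_C1_curve T A \<gamma> \<longleftrightarrow> pathin T \<gamma> \<and>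
     (\<exists>P. finite P \<and> (\<forall>a b. 0 \<le> a \<and> a < b \<and> b \<le> 1 \<and> {a<..<b} \<inter> P = {} \<longrightarrow> C1_curve_on A a b \<gamma>))"

text \<open>The speed does not depend on the chart chosen, and the finitely many break points do not
  contribute to the length.\<close>

definition speed ::
  "('a, 'e::euclidean_space) chart set \<Rightarrow> ('a, 'e) metric_tensor \<Rightarrow> (real \<Rightarrow> 'a) \<Rightarrow> real \<Rightarrow> real" where
  "speed A g \<gamma> t =
     (let c = (SOME c. c \<in> A \<and> \<gamma> t \<in> fst c); v = vector_derivative (snd c \<circ> \<gamma>) (at t)
      in sqrt (g c (snd c (\<gamma> t)) v v))"

definition curve_length ::
  "('a, 'e::euclidean_space) chart set \<Rightarrow> ('a, 'e) metric_tensor \<Rightarrow> (real \<Rightarrow> 'a) \<Rightarrow> real" where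
  "curve_length A g \<gamma> = integral {0..1} (speed A g \<gamma>)"

definition riemannian_distance ::
  "'a topology \<Rightarrow> ('a, 'e::euclidean_space) chart set \<Rightarrow> ('a, 'e) metric_tensor \<Rightarrow>
   'a \<Rightarrow> 'a \<Rightarrow> ennreal" where
  "riemannian_distance T A g x y =
     (INF \<gamma> \<in> {\<gamma>. piecewise_C1_curve T A \<gamma> \<and> \<gamma> 0 = x \<and> \<gamma> 1 = y}. ennreal (curve_length A g \<gamma>))"


section \<open>Foliations\<close>

text \<open>A foliated chart is a chart together with a linear subspace \<open>V\<close>; the plaques are the connected
  components of the slices parallel to \<open>V\<close>. Both foliations by points (\<open>V = 0\<close>) and
  one-leaf foliations (\<open>V = UNIV\<close>) are allowed; near the boundary, the foliation is tangent or
  transverse to it according to whether \<open>V\<close> is contained in the boundary plane or not.\<close>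

type_synonym ('a, 'e) foliated_chart = "('a, 'e) chart \<times> 'e set"

text \<open>The last condition says that transition maps locally have the form
  \<open>(x, y) \<mapsto> (\<alpha>(x, y), \<beta>(y))\<close>, where \<open>x\<close> and \<open>y\<close> are the coordinates along and across the slices.\<close>

definition foliation ::
  "'a topology \<Rightarrow> ('a, 'e::euclidean_space) chart set \<Rightarrow> ('a, 'e) foliated_chart set \<Rightarrow> bool" where
  "foliation T A F \<longleftrightarrow>
     (\<forall>(c, V)\<in>F. is_chart T c) \<and>
     smooth_in_charts (fst ` F) A (topspace T) id \<and>
     smooth_in_charts A (fst ` F) (topspace T) id \<and>
     (\<Union>(c, V)\<in>F. fst c) = topspace T \<and>
     (\<exists>p. \<forall>(c, V)\<in>F. subspace V \<and> dim V = p) \<and>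
     (\<forall>(c, V)\<in>F. \<forall>(c', V')\<in>F. \<forall>x \<in> fst c \<inter> fst c'. \<exists>W. openin T W \<and> x \<in> W \<and> W \<subseteq> fst c \<inter> fst c' \<and>
        (\<forall>y\<in>W. \<forall>y'\<in>W. snd c y - snd c y' \<in> V \<longleftrightarrow> snd c' y - snd c' y' \<in> V'))"

definition same_plaque :: "('a, 'e::euclidean_space) foliated_chart set \<Rightarrow> ('a \<times> 'a) set" where
  "same_plaque F = {(x, y). \<exists>(c, V)\<in>F. x \<in> fst c \<and> y \<in> fst c \<and>
     connected_component (snd c ` fst c \<inter> {z. z - snd c x \<in> V}) (snd c x) (snd c y)}"

text \<open>Two points are on the same leaf iff they are joined by a finite chain of plaques.\<close>

definition leaves :: "'a topology \<Rightarrow> ('a, 'e::euclidean_space) foliated_chart set \<Rightarrow> 'a set set" where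
  "leaves T F = topspace T // (same_plaque F)\<^sup>+"

definition tangent_to_boundary ::
  "'a topology \<Rightarrow> ('a, 'e::euclidean_space) chart set \<Rightarrow> ('a, 'e) foliated_chart set \<Rightarrow> bool" where
  "tangent_to_boundary T A F \<longleftrightarrow> (\<exists>B. B \<subseteq> leaves T F \<and> manifold_boundary A = \<Union>B)"

definition compact_connected_foliated_riemannian_manifold ::
  "'a topology \<Rightarrow> ('a, 'e::euclidean_space) chart set \<Rightarrow> ('a, 'e) metric_tensor \<Rightarrow>
   ('a, 'e) foliated_chart set \<Rightarrow> bool" where
  "compact_connected_foliated_riemannian_manifold T A g F \<longleftrightarrow>
     compact_space T \<and> connected_space T \<and> riemannian_manifold T A g \<and> foliation T A F"


section \<open>Metric identifications, isometries and quotient metric spaces\<close>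

text \<open>A (pseudo-)metric space with possibly infinite distances is a carrier \<open>Y\<close> with a distance
  function into \<open>ennreal\<close>. Identifying the points at distance \<open>0\<close>:\<close>

definition zero_class :: "'y set \<Rightarrow> ('y \<Rightarrow> 'y \<Rightarrow> ennreal) \<Rightarrow> 'y \<Rightarrow> 'y set" where
  "zero_class Y D y = {y' \<in> Y. D y y' = 0}"

definition identification :: "'y set \<Rightarrow> ('y \<Rightarrow> 'y \<Rightarrow> ennreal) \<Rightarrow> 'y set set" where
  "identification Y D = zero_class Y D ` Y"

definition identification_dist :: "('y \<Rightarrow> 'y \<Rightarrow> ennreal) \<Rightarrow> 'y set \<Rightarrow> 'y set \<Rightarrow> ennreal" where
  "identification_dist D P Q = D (SOME y. y \<in> P) (SOME y. y \<in> Q)"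

definition isometric_spaces ::
  "'y set \<Rightarrow> ('y \<Rightarrow> 'y \<Rightarrow> ennreal) \<Rightarrow> 'z set \<Rightarrow> ('z \<Rightarrow> 'z \<Rightarrow> ennreal) \<Rightarrow> bool" where
  "isometric_spaces Y dY Z dZ \<longleftrightarrow>
     (\<exists>f. bij_betw f Y Z \<and> (\<forall>x\<in>Y. \<forall>y\<in>Y. dZ (f x) (f y) = dY x y))"

fun disjoint_union_dist ::
  "('y \<Rightarrow> 'y \<Rightarrow> ennreal) \<Rightarrow> ('z \<Rightarrow> 'z \<Rightarrow> ennreal) \<Rightarrow> 'y + 'z \<Rightarrow> 'y + 'z \<Rightarrow> ennreal" where
  "disjoint_union_dist d1 d2 (Inl x) (Inl y) = d1 x y"
| "disjoint_union_dist d1 d2 (Inr x) (Inr y) = d2 x y"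
| "disjoint_union_dist d1 d2 (Inl x) (Inr y) = \<infinity>"
| "disjoint_union_dist d1 d2 (Inr x) (Inl y) = \<infinity>"

text \<open>To be used only for \<open>G \<subseteq> Y \<times> Y\<close>; otherwise the intersection is empty-indexed.\<close>

definition generated_equiv :: "'y set \<Rightarrow> ('y \<times> 'y) set \<Rightarrow> ('y \<times> 'y) set" where
  "generated_equiv Y G = \<Inter>{R. equiv Y R \<and> G \<subseteq> R}"

definition quotient_chains ::
  "'y set \<Rightarrow> ('y \<times> 'y) set \<Rightarrow> 'y \<Rightarrow> 'y \<Rightarrow> ('y \<times> 'y) list set" where
  "quotient_chains Y R x y = {ps. ps \<noteq> [] \<and> set ps \<subseteq> Y \<times> Y \<and> fst (hd ps) = x \<and> snd (last ps) = y \<and>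
     (\<forall>i. Suc i < length ps \<longrightarrow> (fst (ps ! Suc i), snd (ps ! i)) \<in> R)}"

definition quotient_pseudodist ::
  "'y set \<Rightarrow> ('y \<Rightarrow> 'y \<Rightarrow> ennreal) \<Rightarrow> ('y \<times> 'y) set \<Rightarrow> 'y \<Rightarrow> 'y \<Rightarrow> ennreal" where
  "quotient_pseudodist Y d R x y = (INF ps \<in> quotient_chains Y R x y. \<Sum>(p, q)\<leftarrow>ps. d p q)"


section \<open>The Hausdorff leaf space\<close>

text \<open>It depends only on the distance function \<open>d\<close> and on the set \<open>\<L>\<close> of leaves.\<close>

definition leaf_dist :: "('a \<Rightarrow> 'a \<Rightarrow> ennreal) \<Rightarrow> 'a set \<Rightarrow> 'a set \<Rightarrow> ennreal" where
  "leaf_dist d L L' = (INF x\<in>L. INF y\<in>L'. d x y)"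

definition leaf_rho :: "('a \<Rightarrow> 'a \<Rightarrow> ennreal) \<Rightarrow> 'a set set \<Rightarrow> 'a set \<Rightarrow> 'a set \<Rightarrow> ennreal" where
  "leaf_rho d \<L> L L' =
     (INF Ls \<in> {Ls. Ls \<noteq> [] \<and> set Ls \<subseteq> \<L> \<and> hd Ls = L \<and> last Ls = L'}.
        \<Sum>i<length Ls - 1. leaf_dist d (Ls ! i) (Ls ! Suc i))"

definition HLS :: "('a \<Rightarrow> 'a \<Rightarrow> ennreal) \<Rightarrow> 'a set set \<Rightarrow> 'a set set set" where
  "HLS d \<L> = identification \<L> (leaf_rho d \<L>)"

definition HLS_dist ::
  "('a \<Rightarrow> 'a \<Rightarrow> ennreal) \<Rightarrow> 'a set set \<Rightarrow> 'a set set \<Rightarrow> 'a set set \<Rightarrow> ennreal" where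
  "HLS_dist d \<L> = identification_dist (leaf_rho d \<L>)"

definition HLS_proj :: "('a \<Rightarrow> 'a \<Rightarrow> ennreal) \<Rightarrow> 'a set set \<Rightarrow> 'a \<Rightarrow> 'a set set" where
  "HLS_proj d \<L> x = zero_class \<L> (leaf_rho d \<L>) (THE L. L \<in> \<L> \<and> x \<in> L)"


section \<open>Gluing along boundary components\<close>

definition union_of_boundary_components ::
  "'a topology \<Rightarrow> ('a, 'e::euclidean_space) chart set \<Rightarrow> 'a set \<Rightarrow> bool" where
  "union_of_boundary_components T A S \<longleftrightarrow>
     (\<exists>C. C \<subseteq> connected_components_of (subtopology T (manifold_boundary A)) \<and> S = \<Union>C)"

text \<open>Isometry between open subsets of boundaries, with the induced Riemannian metrics.\<close>

definition boundary_isometry ::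
  "'a topology \<Rightarrow> ('a, 'e::euclidean_space) chart set \<Rightarrow> ('a, 'e) metric_tensor \<Rightarrow> 'a set \<Rightarrow>
   'b topology \<Rightarrow> ('b, 'e) chart set \<Rightarrow> ('b, 'e) metric_tensor \<Rightarrow> 'b set \<Rightarrow> ('a \<Rightarrow> 'b) \<Rightarrow> bool" where
  "boundary_isometry T1 A1 g1 S1 T2 A2 g2 S2 h \<longleftrightarrow>
     homeomorphic_map (subtopology T1 S1) (subtopology T2 S2) h \<and>
     smooth_in_charts A1 A2 S1 h \<and> smooth_in_charts A2 A1 S2 (inv_into S1 h) \<and>
     preserves_metric A1 g1 A2 g2 S1 boundary_plane h"

definition glue_rel ::
  "'a topology \<Rightarrow> 'b topology \<Rightarrow> 'a set \<Rightarrow> ('a \<Rightarrow> 'b) \<Rightarrow> (('a + 'b) \<times> ('a + 'b)) set" where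
  "glue_rel T1 T2 S h =
     generated_equiv (topspace T1 <+> topspace T2) ((\<lambda>x. (Inl x, Inr (h x))) ` S)"

definition glue_inl ::
  "'a topology \<Rightarrow> 'b topology \<Rightarrow> 'a set \<Rightarrow> ('a \<Rightarrow> 'b) \<Rightarrow> 'a \<Rightarrow> ('a + 'b) set" where
  "glue_inl T1 T2 S h x = glue_rel T1 T2 S h `` {Inl x}"

definition glue_inr ::
  "'a topology \<Rightarrow> 'b topology \<Rightarrow> 'a set \<Rightarrow> ('a \<Rightarrow> 'b) \<Rightarrow> 'b \<Rightarrow> ('a + 'b) set" where
  "glue_inr T1 T2 S h y = glue_rel T1 T2 S h `` {Inr y}"

text \<open>Openness in the quotient is tested on the two summands.\<close>

definition glue_topology ::
  "'a topology \<Rightarrow> 'b topology \<Rightarrow> 'a set \<Rightarrow> ('a \<Rightarrow> 'b) \<Rightarrow> ('a + 'b) set topology" where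
  "glue_topology T1 T2 S h = topology (\<lambda>W.
     W \<subseteq> (topspace T1 <+> topspace T2) // glue_rel T1 T2 S h \<and>
     openin T1 {x \<in> topspace T1. glue_inl T1 T2 S h x \<in> W} \<and>
     openin T2 {y \<in> topspace T2. glue_inr T1 T2 S h y \<in> W})"

lemma openin_glue_topology:
  "openin (glue_topology T1 T2 S h) W \<longleftrightarrow>
     W \<subseteq> (topspace T1 <+> topspace T2) // glue_rel T1 T2 S h \<and>
     openin T1 {x \<in> topspace T1. glue_inl T1 T2 S h x \<in> W} \<and>
     openin T2 {y \<in> topspace T2. glue_inr T1 T2 S h y \<in> W}"
proof -
  have Int: "{x \<in> topspace T. f x \<in> V \<inter> W} = {x \<in> topspace T. f x \<in> V} \<inter> {x \<in> topspace T. f x \<in> W}"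
    and Un: "{x \<in> topspace T. f x \<in> \<Union>K} = (\<Union>W\<in>K. {x \<in> topspace T. f x \<in> W})"
    for T :: "'c topology" and f :: "'c \<Rightarrow> ('a + 'b) set" and V W K
    by auto
  show ?thesis
    unfolding glue_topology_def
    by (subst topology_inverse') (auto simp: istopology_def Int Un simp del: Int_iff Union_iff)
qed

text \<open>A leaf in \<open>S\<close> and its image under \<open>h\<close> become the same leaf of the glued manifold.\<close>

definition glue_leaves ::
  "'a topology \<Rightarrow> 'b topology \<Rightarrow> 'a set \<Rightarrow> ('a \<Rightarrow> 'b) \<Rightarrow> 'a set set \<Rightarrow> 'b set set \<Rightarrow>
   ('a + 'b) set set set" where
  "glue_leaves T1 T2 S h \<L>1 \<L>2 =
     image (glue_inl T1 T2 S h) ` \<L>1 \<union> image (glue_inr T1 T2 S h) ` \<L>2"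

text \<open>\<open>g\<close> restricts to \<open>g\<^sub>1\<close> under the inclusion \<open>j\<close>. Preserving the metric makes the smooth
  map \<open>j\<close> an immersion.\<close>

definition restricts_to ::
  "('m, 'e::euclidean_space) chart set \<Rightarrow> ('m, 'e) metric_tensor \<Rightarrow> ('a \<Rightarrow> 'm) \<Rightarrow>
   'a topology \<Rightarrow> ('a, 'e) chart set \<Rightarrow> ('a, 'e) metric_tensor \<Rightarrow> bool" where
  "restricts_to A g j T1 A1 g1 \<longleftrightarrow>
     smooth_in_charts A1 A (topspace T1) j \<and> preserves_metric A1 g1 A g (topspace T1) UNIV j"

definition HLS_glue_rel ::
  "('a \<Rightarrow> 'a \<Rightarrow> ennreal) \<Rightarrow> 'a set set \<Rightarrow> ('b \<Rightarrow> 'b \<Rightarrow> ennreal) \<Rightarrow> 'b set set \<Rightarrow>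
   'a set \<Rightarrow> ('a \<Rightarrow> 'b) \<Rightarrow> (('a set set + 'b set set) \<times> ('a set set + 'b set set)) set" where
  "HLS_glue_rel d1 \<L>1 d2 \<L>2 S h = generated_equiv (HLS d1 \<L>1 <+> HLS d2 \<L>2)
     ((\<lambda>x. (Inl (HLS_proj d1 \<L>1 x), Inr (HLS_proj d2 \<L>2 (h x)))) ` S)"

definition HLS_glue_pseudodist ::
  "('a \<Rightarrow> 'a \<Rightarrow> ennreal) \<Rightarrow> 'a set set \<Rightarrow> ('b \<Rightarrow> 'b \<Rightarrow> ennreal) \<Rightarrow> 'b set set \<Rightarrow>
   'a set \<Rightarrow> ('a \<Rightarrow> 'b) \<Rightarrow> 'a set set + 'b set set \<Rightarrow> 'a set set + 'b set set \<Rightarrow> ennreal" where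
  "HLS_glue_pseudodist d1 \<L>1 d2 \<L>2 S h =
     quotient_pseudodist (HLS d1 \<L>1 <+> HLS d2 \<L>2)
       (disjoint_union_dist (HLS_dist d1 \<L>1) (HLS_dist d2 \<L>2))
       (HLS_glue_rel d1 \<L>1 d2 \<L>2 S h)"

end

theory Submission
  imports Defs
begin

text \<open>
  The chain infima \<open>leaf_rho\<close> and \<open>quotient_pseudodist\<close> are the largest pseudometrics below the
  distance of two leaves, respectively below the given distance and vanishing on the given
  relation. So the two spaces are isometric as soon as each of the two pseudometrics, pulled back to
  the disjoint union of the leaf sets, satisfies the defining bounds of the other one. For one
  direction, the inclusions \<open>j\<^sub>i\<close> of \<open>M\<^sub>i\<close> into \<open>M\<close> preserve the length of curves. For the other one, the
  pseudometric \<open>E\<close> of \<open>X\<close>, pulled back to \<open>M\<close>, must satisfy \<open>E(x, y) \<le> d(x, y)\<close>. A curve in \<open>M\<close> may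
  cross the gluing locus infinitely often, so it cannot be cut into finitely many pieces, each in
  one \<open>M\<^sub>i\<close>. Instead, \<open>E(\<gamma>(s), \<gamma>(t))\<close> is compared with the length of \<open>\<gamma>\<close> infinitesimally: if \<open>\<gamma>(t)\<close> and
  \<open>\<gamma>(s)\<close> both lie in \<open>M\<^sub>i\<close>, a straight segment in a chart of \<open>M\<^sub>i\<close> (half-spaces are convex) bounds
  \<open>d\<^sub>i\<close> by the norm of the coordinate difference up to a factor close to \<open>1\<close>, and \<open>j\<^sub>i\<close> preserves these
  norms up to such a factor. A compactness argument on \<open>[0, 1]\<close> sums up these estimates. That \<open>j\<^sub>i\<close>
  is a closed embedding follows from the compactness of \<open>M\<^sub>i\<close> and the Hausdorff property of \<open>M\<close>.
\<close>

section \<open>Pseudometrics and their quotients\<close>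

text \<open>Neither space is mapped to the other directly. Both are identifications of one set
  \<open>Z\<close>, the disjoint union of the two sets of leaves, in which a leaf in S1 and its
  image under h are still different elements; the isometry is forced once the two pulled back
  pseudometrics on \<open>Z\<close> agree. Questions of well-definedness thereby become statements
  that some distance is 0. In the analytic half, a point of the gluing locus has a preimage on
  either side, and the side containing \<gamma>(s) may change infinitely often as s tends to t.
  Every estimate is therefore centred at \<gamma>(t) and uses the one inner product there:
  first-order expansions of the inclusions within each side suffice, and no chart of M adapted to
  the gluing locus has to be built. Changing sides at \<gamma>(t) is free because the pseudometric
  of X vanishes on glued pairs. Errors are kept in the form of a factor 1 + e and a term e times the
  length of the parameter interval, since both survive subdivision, unlike a fixed error per
  piece.\<close>

lemma le_INF_add_INF:
  fixes f :: "'i \<Rightarrow> ennreal" and g :: "'j \<Rightarrow> ennreal"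
  assumes "\<And>i j. i \<in> I \<Longrightarrow> j \<in> J \<Longrightarrow> c \<le> f i + g j"
  shows "c \<le> (INF i\<in>I. f i) + (INF j\<in>J. g j)"
proof (cases "(INF i\<in>I. f i) = \<infinity> \<or> (INF j\<in>J. g j) = \<infinity>")
  case True
  then show ?thesis by (auto simp: top_unique)
next
  \<comment> \<open>For finite infima, adding e/2 is a strict increase, so near-minimisers exist; at
    infinity this argument fails, but the bound is trivial.\<close>
  case False
  show ?thesis
  proof (rule ennreal_le_epsilon)
    fix e :: real assume "0 < e"
    then have e: "0 < ennreal (e/2)" by simp
    from False have lt: "(INF i\<in>I. f i) < (INF i\<in>I. f i) + ennreal (e/2)"
      "(INF j\<in>J. g j) < (INF j\<in>J. g j) + ennreal (e/2)"
      using e by (auto simp: ennreal_add_left_cancel_less top_unique)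
    from lt obtain i where i: "i \<in> I" "f i < (INF i\<in>I. f i) + ennreal (e/2)"
      by (auto simp: INF_less_iff)
    from lt obtain j where j: "j \<in> J" "g j < (INF j\<in>J. g j) + ennreal (e/2)"
      by (auto simp: INF_less_iff)
    have "c \<le> f i + g j" using assms i j by blast
    also have "\<dots> \<le> ((INF i\<in>I. f i) + ennreal (e/2)) + ((INF j\<in>J. g j) + ennreal (e/2))"
      using i j by (intro add_mono) auto
    also have "\<dots> = (INF i\<in>I. f i) + (INF j\<in>J. g j) + (ennreal (e/2) + ennreal (e/2))"
      by (simp add: ac_simps)
    also have "ennreal (e/2) + ennreal (e/2) = ennreal e"
      using \<open>0 < e\<close> by (subst ennreal_plus[symmetric]) auto
    finally show "c \<le> (INF i\<in>I. f i) + (INF j\<in>J. g j) + ennreal e" .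
  qed
qed

definition pseudometric_on :: "'y set \<Rightarrow> ('y \<Rightarrow> 'y \<Rightarrow> ennreal) \<Rightarrow> bool" where
  "pseudometric_on Y D \<longleftrightarrow> (\<forall>x\<in>Y. D x x = 0) \<and> (\<forall>x\<in>Y. \<forall>y\<in>Y. D x y = D y x) \<and>
     (\<forall>x\<in>Y. \<forall>y\<in>Y. \<forall>z\<in>Y. D x z \<le> D x y + D y z)"

lemma pseudometric_onD:
  assumes "pseudometric_on Y D"
  shows "x \<in> Y \<Longrightarrow> D x x = 0"
    and "x \<in> Y \<Longrightarrow> y \<in> Y \<Longrightarrow> D x y = D y x"
    and "x \<in> Y \<Longrightarrow> y \<in> Y \<Longrightarrow> z \<in> Y \<Longrightarrow> D x z \<le> D x y + D y z"
  using assms unfolding pseudometric_on_def by blast+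

lemma pseudometric_zero_cong_left:
  assumes D: "pseudometric_on Y D" and Y: "x \<in> Y" "x' \<in> Y" "y \<in> Y" and "D x x' = 0"
  shows "D x y = D x' y"
  using pseudometric_onD(3)[OF D, of x x' y] pseudometric_onD(3)[OF D, of x' x y]
    pseudometric_onD(2)[OF D, of x x'] assms by simp

lemma pseudometric_zero_cong:
  assumes D: "pseudometric_on Y D" and Y: "x \<in> Y" "x' \<in> Y" "y \<in> Y" "y' \<in> Y"
    and "D x x' = 0" "D y y' = 0"
  shows "D x y = D x' y'"
  using pseudometric_zero_cong_left[OF D, of x x' y] pseudometric_zero_cong_left[OF D, of y y' x']
    pseudometric_onD(2)[OF D] assms by metis

text \<open>Minimality of \<open>generated_equiv\<close> is exploited through this relation: a
  pulled back pseudometric vanishes on the whole generated equivalence as soon as it vanishes on the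
  generating pairs.\<close>

lemma equiv_zero_dist:
  assumes "pseudometric_on Y D" and "q ` Z \<subseteq> Y"
  shows "equiv Z {(x, y). x \<in> Z \<and> y \<in> Z \<and> D (q x) (q y) = 0}"
proof (rule equivI)
  show "refl_on Z {(x, y). x \<in> Z \<and> y \<in> Z \<and> D (q x) (q y) = 0}"
    using assms pseudometric_onD(1)[OF assms(1)] by (auto intro!: refl_onI)
  show "sym {(x, y). x \<in> Z \<and> y \<in> Z \<and> D (q x) (q y) = 0}"
  proof (rule symI, clarify)
    fix x y assume "x \<in> Z" "y \<in> Z" "D (q x) (q y) = 0"
    then show "D (q y) (q x) = 0"
      using pseudometric_onD(2)[OF assms(1), of "q x" "q y"] assms(2) by auto
  qed
  show "trans {(x, y). x \<in> Z \<and> y \<in> Z \<and> D (q x) (q y) = 0}"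
  proof (rule transI, clarify)
    fix x y z assume "x \<in> Z" "y \<in> Z" "z \<in> Z" "D (q x) (q y) = 0" "D (q y) (q z) = 0"
    moreover from this have "q x \<in> Y" "q y \<in> Y" "q z \<in> Y" using assms(2) by auto
    ultimately show "D (q x) (q z) = 0"
      using pseudometric_zero_cong_left[OF assms(1), of "q x" "q y" "q z"] by simp
  qed
qed auto

lemma zero_class_eq_iff:
  assumes D: "pseudometric_on Y D" and "x \<in> Y" "y \<in> Y"
  shows "zero_class Y D x = zero_class Y D y \<longleftrightarrow> D x y = 0"
proof
  assume "zero_class Y D x = zero_class Y D y"
  moreover have "y \<in> zero_class Y D y"
    using assms pseudometric_onD(1)[OF D] by (auto simp: zero_class_def)
  ultimately show "D x y = 0" by (auto simp: zero_class_def)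
next
  assume "D x y = 0"
  then show "zero_class Y D x = zero_class Y D y"
    using pseudometric_zero_cong_left[OF D, of x y] assms by (auto simp: zero_class_def)
qed

text \<open>Points of one zero class have the same distances, so the representatives picked by
  \<open>SOME\<close> may be exchanged for x and y.\<close>

lemma identification_dist_zero_class:
  assumes D: "pseudometric_on Y D" and "x \<in> Y" "y \<in> Y"
  shows "identification_dist D (zero_class Y D x) (zero_class Y D y) = D x y"
proof -
  have *: "(SOME y. y \<in> zero_class Y D x) \<in> zero_class Y D x" if "x \<in> Y" for x
    using that pseudometric_onD(1)[OF D] by (intro someI[where P = "\<lambda>z. z \<in> zero_class Y D x"]) (auto simp: zero_class_def)
  show ?thesis
    unfolding identification_dist_def
    using pseudometric_zero_cong[OF D, of x "SOME z. z \<in> zero_class Y D x" y "SOME z. z \<in> zero_class Y D y"]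
      *[of x] *[of y] assms by (auto simp: zero_class_def)
qed

lemma pseudometric_on_identification_dist:
  assumes D: "pseudometric_on Y D"
  shows "pseudometric_on (identification Y D) (identification_dist D)"
  using pseudometric_onD[OF D]
  by (auto simp: pseudometric_on_def identification_def identification_dist_zero_class[OF D])

text \<open>The isometry takes the class of \<open>q a\<close> to the class of \<open>q' a\<close>.
  By \<open>eq\<close>, distance zero in \<open>Y\<close> and in \<open>Y'\<close> pull back to the
  same relation on \<open>Z\<close>, which gives well-definedness and injectivity at once; q and q'
  may be far from injective.\<close>

lemma isometric_identifications:
  assumes D: "pseudometric_on Y D" and D': "pseudometric_on Y' D'"
    and q: "q ` Z = Y" and q': "q' ` Z = Y'"
    and eq: "\<And>a b. a \<in> Z \<Longrightarrow> b \<in> Z \<Longrightarrow> D (q a) (q b) = D' (q' a) (q' b)"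
  shows "isometric_spaces (identification Y D) (identification_dist D)
     (identification Y' D') (identification_dist D')"
proof -
  define f where "f C = zero_class Y' D' (q' (SOME a. a \<in> Z \<and> zero_class Y D (q a) = C))" for C
  have f: "f (zero_class Y D (q a)) = zero_class Y' D' (q' a)" if "a \<in> Z" for a
  proof -
    let ?b = "SOME b. b \<in> Z \<and> zero_class Y D (q b) = zero_class Y D (q a)"
    have "?b \<in> Z \<and> zero_class Y D (q ?b) = zero_class Y D (q a)"
      by (rule someI[of _ a]) (use that in auto)
    moreover from this have "D (q ?b) (q a) = 0"
      using zero_class_eq_iff[OF D, of "q ?b" "q a"] q that by blast
    ultimately have "D' (q' ?b) (q' a) = 0" "?b \<in> Z" using eq that by auto
    then show ?thesis
      unfolding f_def using zero_class_eq_iff[OF D', of "q' ?b" "q' a"] q' that by blast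
  qed
  have id: "identification Y D = (\<lambda>a. zero_class Y D (q a)) ` Z"
    "identification Y' D' = (\<lambda>a. zero_class Y' D' (q' a)) ` Z"
    using q q' by (auto simp: identification_def)
  have "inj_on f (identification Y D)"
  proof (rule inj_onI)
    fix C C' assume "C \<in> identification Y D" "C' \<in> identification Y D" "f C = f C'"
    then obtain a b where ab: "a \<in> Z" "b \<in> Z" "C = zero_class Y D (q a)" "C' = zero_class Y D (q b)"
      unfolding id by blast
    then have "D' (q' a) (q' b) = 0"
      using \<open>f C = f C'\<close> f zero_class_eq_iff[OF D', of "q' a" "q' b"] q' by auto
    then show "C = C'" using ab eq zero_class_eq_iff[OF D, of "q a" "q b"] q by auto
  qed
  moreover have "f ` identification Y D = identification Y' D'"
    unfolding id by (auto simp: f image_image)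
  moreover have "identification_dist D' (f C) (f C') = identification_dist D C C'"
    if C: "C \<in> identification Y D" "C' \<in> identification Y D" for C C'
  proof -
    obtain a b where ab: "a \<in> Z" "b \<in> Z" "C = zero_class Y D (q a)" "C' = zero_class Y D (q b)"
      using C unfolding id by blast
    moreover have "q a \<in> Y" "q b \<in> Y" "q' a \<in> Y'" "q' b \<in> Y'" using ab q q' by auto
    ultimately show ?thesis
      using eq by (simp add: f identification_dist_zero_class[OF D] identification_dist_zero_class[OF D'])
  qed
  ultimately show ?thesis
    unfolding isometric_spaces_def bij_betw_def by blast
qed

lemma pseudometric_on_disjoint_union:
  assumes "pseudometric_on Y1 D1" "pseudometric_on Y2 D2"
  shows "pseudometric_on (Y1 <+> Y2) (disjoint_union_dist D1 D2)"
  unfolding pseudometric_on_def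
  by (intro conjI ballI; elim PlusE; hypsubst)
    (simp_all add: pseudometric_onD[OF assms(1)] pseudometric_onD[OF assms(2)])

lemma generated_equiv_subset:
  assumes "equiv Y R" "G \<subseteq> R"
  shows "generated_equiv Y G \<subseteq> R"
  using assms unfolding generated_equiv_def by blast

text \<open>The hypothesis puts \<open>Y \<times> Y\<close> among the relations intersected, which
  keeps the intersection inside \<open>Y \<times> Y\<close>; the other properties of an equivalence
  pass to any intersection.\<close>

lemma equiv_generated_equiv:
  assumes "G \<subseteq> Y \<times> Y"
  shows "equiv Y (generated_equiv Y G)"
proof (rule equivI)
  have "equiv Y (Y \<times> Y)" by (auto intro!: equivI refl_onI symI transI)
  then show "generated_equiv Y G \<subseteq> Y \<times> Y" using assms by (intro generated_equiv_subset)
  show "refl_on Y (generated_equiv Y G)"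
    unfolding generated_equiv_def equiv_def refl_on_def by blast
  show "sym (generated_equiv Y G)"
    unfolding generated_equiv_def equiv_def sym_def by blast
  show "trans (generated_equiv Y G)"
    unfolding generated_equiv_def equiv_def trans_def by blast
qed

lemma generated_equiv_superset: "G \<subseteq> generated_equiv Y G"
  unfolding generated_equiv_def by blast

text \<open>Chains are concatenated for the triangle inequality, and reversed, with the entries of
  each pair swapped, for symmetry.\<close>

lemma pseudometric_on_quotient_pseudodist:
  assumes d: "pseudometric_on Y d" and R: "equiv Y R"
  shows "pseudometric_on Y (quotient_pseudodist Y d R)"
proof -
  note eR = equivE[OF R]
  have zero: "quotient_pseudodist Y d R x x = 0" if "x \<in> Y" for x
  proof -
    have "[(x, x)] \<in> quotient_chains Y R x x" using that by (simp add: quotient_chains_def)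
    then have "quotient_pseudodist Y d R x x \<le> d x x"
      unfolding quotient_pseudodist_def by (rule INF_lower2) simp
    then show ?thesis using pseudometric_onD(1)[OF d] that by simp
  qed
  have tri: "quotient_pseudodist Y d R x z \<le> quotient_pseudodist Y d R x y + quotient_pseudodist Y d R y z"
    if "y \<in> Y" for x y z
    unfolding quotient_pseudodist_def
  proof (rule le_INF_add_INF)
    fix ps qs assume ps: "ps \<in> quotient_chains Y R x y" and qs: "qs \<in> quotient_chains Y R y z"
    \<comment> \<open>The first chain ends in y and the second one starts in y, so this is the link
      at the junction.\<close>
    have yy: "(y, y) \<in> R" using R that by (auto elim: equivE dest: refl_onD)
    have "(fst ((ps @ qs) ! Suc i), snd ((ps @ qs) ! i)) \<in> R" if "Suc i < length (ps @ qs)" for i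
    proof -
      consider "Suc i < length ps" | "Suc i = length ps" | "i \<ge> length ps" by linarith
      then show ?thesis
      proof cases
        case 1
        then show ?thesis using ps by (auto simp: nth_append quotient_chains_def)
      next
        case 2
        then have "(ps @ qs) ! Suc i = hd qs" "(ps @ qs) ! i = last ps"
          using ps qs by (auto simp: nth_append quotient_chains_def hd_conv_nth last_conv_nth
            simp flip: 2)
        then show ?thesis using yy ps qs by (auto simp: quotient_chains_def)
      next
        case 3
        then show ?thesis using qs that by (auto simp: nth_append quotient_chains_def Suc_diff_le)
      qed
    qed
    then have "ps @ qs \<in> quotient_chains Y R x z"
      using ps qs by (auto simp: quotient_chains_def)
    then show "(INF ps\<in>quotient_chains Y R x z. \<Sum>(p, q)\<leftarrow>ps. d p q)
        \<le> (\<Sum>(p, q)\<leftarrow>ps. d p q) + (\<Sum>(p, q)\<leftarrow>qs. d p q)"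
      by (rule INF_lower2) simp
  qed
  have sym_le: "quotient_pseudodist Y d R y x \<le> quotient_pseudodist Y d R x y" for x y
    unfolding quotient_pseudodist_def
  proof (rule INF_greatest)
    fix ps assume ps: "ps \<in> quotient_chains Y R x y"
    let ?qs = "rev (map prod.swap ps)"
    have "(fst (?qs ! Suc i), snd (?qs ! i)) \<in> R" if "Suc i < length ?qs" for i
    proof -
      \<comment> \<open>Link i of the reversed chain is link k of the original one read backwards,
        whence the appeal to the symmetry of \<open>R\<close>.\<close>
      define k where "k = length ps - Suc (Suc i)"
      have k: "Suc k < length ps" "length ps - Suc i = Suc k" using that by (auto simp: k_def)
      then have "(fst (ps ! Suc k), snd (ps ! k)) \<in> R" using ps by (auto simp: quotient_chains_def)
      then have "(snd (ps ! k), fst (ps ! Suc k)) \<in> R" using R by (auto elim: equivE dest: symD)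
      then show ?thesis using that k by (auto simp: rev_nth k_def[symmetric])
    qed
    then have "?qs \<in> quotient_chains Y R y x"
      using ps by (auto simp: quotient_chains_def hd_rev last_rev last_map hd_map)
    moreover have "(\<Sum>(p, q)\<leftarrow>?qs. d p q) = (\<Sum>(p, q)\<leftarrow>ps. d p q)"
    proof -
      have "(\<Sum>(p, q)\<leftarrow>?qs. d p q) = (\<Sum>(p, q)\<leftarrow>map prod.swap ps. d p q)"
        unfolding rev_map[symmetric] sum_list_rev by simp
      also have "\<dots> = (\<Sum>(p, q)\<leftarrow>ps. d p q)"
        using ps pseudometric_onD(2)[OF d]
        by (auto simp: quotient_chains_def comp_def intro!: arg_cong[where f = sum_list] map_cong)
      finally show ?thesis .
    qed
    ultimately show "(INF ps\<in>quotient_chains Y R y x. \<Sum>(p, q)\<leftarrow>ps. d p q) \<le> (\<Sum>(p, q)\<leftarrow>ps. d p q)"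
      by (intro INF_lower2[of ?qs]) auto
  qed
  show ?thesis
    unfolding pseudometric_on_def using zero tri antisym[OF sym_le sym_le] by blast
qed

lemma quotient_pseudodist_le:
  assumes "x \<in> Y" "y \<in> Y"
  shows "quotient_pseudodist Y d R x y \<le> d x y"
  unfolding quotient_pseudodist_def
  by (rule INF_lower2[of "[(x, y)]"]) (use assms in \<open>auto simp: quotient_chains_def\<close>)

lemma quotient_pseudodist_eq_0:
  assumes d: "pseudometric_on Y d" and R: "equiv Y R" and xy: "(x, y) \<in> R"
  shows "quotient_pseudodist Y d R x y = 0"
proof -
  have "x \<in> Y" "y \<in> Y" "(y, x) \<in> R"
    using R xy unfolding equiv_def sym_def by auto
  \<comment> \<open>Two pairs of length zero. A link lists the start of the later pair before the
    end of the earlier one, so it is \<open>(y, x)\<close> that has to lie in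
    \<open>R\<close>.\<close>
  then have "[(x, x), (y, y)] \<in> quotient_chains Y R x y"
    by (auto simp: quotient_chains_def less_Suc_eq)
  then have "quotient_pseudodist Y d R x y \<le> d x x + d y y"
    unfolding quotient_pseudodist_def by (rule INF_lower2) simp
  then show ?thesis using pseudometric_onD(1)[OF d] \<open>x \<in> Y\<close> \<open>y \<in> Y\<close> by simp
qed

text \<open>Along a chain, \<open>E\<close> pays at most \<open>d\<close> for each pair and nothing
  for a jump within \<open>R\<close>. If x or y is outside \<open>Y\<close>, there is no chain and
  the infimum is infinite.\<close>

lemma quotient_pseudodist_greatest:
  assumes E: "pseudometric_on Y E" and le: "\<And>x y. x \<in> Y \<Longrightarrow> y \<in> Y \<Longrightarrow> E x y \<le> d x y"
    and zero: "\<And>x y. (x, y) \<in> R \<Longrightarrow> E x y = 0"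
  shows "E x y \<le> quotient_pseudodist Y d R x y"
  unfolding quotient_pseudodist_def
proof (rule INF_greatest)
  fix ps assume "ps \<in> quotient_chains Y R x y"
  then show "E x y \<le> (\<Sum>(p, q)\<leftarrow>ps. d p q)"
  proof (induction ps arbitrary: x)
    case (Cons pq ps)
    obtain p q where pq: "pq = (p, q)" by force
    have Y: "p \<in> Y" "q \<in> Y" "x = p" using Cons.prems by (auto simp: quotient_chains_def pq)
    show ?case
    proof (cases ps)
      case Nil
      then show ?thesis using Cons.prems le Y by (auto simp: quotient_chains_def pq)
    next
      case (Cons pq' ps')
      \<comment> \<open>The remaining chain starts at \<open>p'\<close>, which has
        \<open>E\<close>-distance 0 from the end q of the first pair; the induction hypothesis is
        used at this new starting point.\<close>
      define p' where "p' = fst (hd ps)"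
      have step: "(fst ((pq # ps) ! Suc i), snd ((pq # ps) ! i)) \<in> R" if "i < length ps" for i
        using that Cons.prems by (auto simp: quotient_chains_def)
      have ps: "ps \<in> quotient_chains Y R p' y"
        using Cons.prems step[of "Suc _"] Cons by (auto simp: quotient_chains_def p'_def)
      have "last ps \<in> set ps" using Cons by simp
      then have "last ps \<in> Y \<times> Y" using ps by (auto simp: quotient_chains_def)
      then have "y \<in> Y" using ps by (auto simp: quotient_chains_def)
      have "E x y \<le> E p q + E q y"
        unfolding Y using \<open>p \<in> Y\<close> \<open>q \<in> Y\<close> \<open>y \<in> Y\<close> by (rule pseudometric_onD(3)[OF E])
      also have "E q y = E p' y"
      proof (rule pseudometric_zero_cong_left[OF E])
        show "E q p' = 0"
          using step[of 0] Cons zero[of p' q] pseudometric_onD(2)[OF E, of p' q] Cons.prems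
          by (auto simp: p'_def pq quotient_chains_def)
      qed (use Cons.prems Cons Y \<open>y \<in> Y\<close> in \<open>auto simp: p'_def quotient_chains_def\<close>)
      also have "E p q + E p' y \<le> d p q + (\<Sum>(p, q)\<leftarrow>ps. d p q)"
        using Cons.IH[OF ps] le Y by (intro add_mono) auto
      finally show ?thesis by (simp add: pq)
    qed
  qed (simp add: quotient_chains_def)
qed

section \<open>Chains of leaves\<close>

definition chain_sum :: "('y \<Rightarrow> 'y \<Rightarrow> ennreal) \<Rightarrow> 'y list \<Rightarrow> ennreal" where
  "chain_sum f xs = (\<Sum>i<length xs - 1. f (xs ! i) (xs ! Suc i))"

lemma chain_sum_simps [simp]:
  "chain_sum f [x] = 0"
  "chain_sum f (x # y # xs) = f x y + chain_sum f (y # xs)"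
  by (simp_all add: chain_sum_def sum.lessThan_Suc_shift del: sum.lessThan_Suc)

text \<open>The element y is kept in both parts, because consecutive pairs, not entries, are being
  summed.\<close>

lemma chain_sum_append: "chain_sum f (xs @ y # ys) = chain_sum f (xs @ [y]) + chain_sum f (y # ys)"
proof (induction xs)
  case (Cons x xs)
  then show ?case by (cases xs) (auto simp: ac_simps)
qed simp

lemma chain_sum_rev:
  assumes "\<And>x y. x \<in> set xs \<Longrightarrow> y \<in> set xs \<Longrightarrow> f x y = f y x"
  shows "chain_sum f (rev xs) = chain_sum f xs"
  using assms
proof (induction xs)
  case (Cons x xs)
  then show ?case
    by (cases xs) (auto simp: chain_sum_append[of f _ _ "[x]"] ac_simps)
qed (simp add: chain_sum_def)

text \<open>Symmetry is inherited from \<open>d\<close>; the chains provide the rest. A one-leaf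
  chain has an empty sum, and chains joined at a common leaf give the triangle inequality.\<close>

lemma pseudometric_on_leaf_rho:
  assumes d: "\<And>L L' x y. L \<in> \<L> \<Longrightarrow> L' \<in> \<L> \<Longrightarrow> x \<in> L \<Longrightarrow> y \<in> L' \<Longrightarrow> d x y = d y x"
  shows "pseudometric_on \<L> (leaf_rho d \<L>)"
proof -
  let ?C = "\<lambda>L L'. {Ls. Ls \<noteq> [] \<and> set Ls \<subseteq> \<L> \<and> hd Ls = L \<and> last Ls = L'}"
  have rho: "leaf_rho d \<L> L L' = (INF Ls \<in> ?C L L'. chain_sum (leaf_dist d) Ls)" for L L'
    by (simp add: leaf_rho_def chain_sum_def)
  have zero: "leaf_rho d \<L> L L = 0" if "L \<in> \<L>" for L
  proof -
    have "leaf_rho d \<L> L L \<le> chain_sum (leaf_dist d) [L]"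
      unfolding rho by (rule INF_lower) (use that in auto)
    then show ?thesis by simp
  qed
  have sym: "leaf_dist d L L' = leaf_dist d L' L" if "L \<in> \<L>" "L' \<in> \<L>" for L L'
    unfolding leaf_dist_def by (subst INF_commute) (intro INF_cong refl d[OF that])
  have le: "leaf_rho d \<L> L' L \<le> leaf_rho d \<L> L L'" for L L'
    unfolding rho
  proof (rule INF_greatest)
    fix Ls assume "Ls \<in> ?C L L'"
    moreover from this have "chain_sum (leaf_dist d) (rev Ls) = chain_sum (leaf_dist d) Ls"
      by (intro chain_sum_rev sym) auto
    ultimately show "(INF Ls \<in> ?C L' L. chain_sum (leaf_dist d) Ls) \<le> chain_sum (leaf_dist d) Ls"
      by (intro INF_lower2[of "rev Ls"]) (auto simp: hd_rev last_rev)
  qed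
  have tri: "leaf_rho d \<L> L L'' \<le> leaf_rho d \<L> L L' + leaf_rho d \<L> L' L''" for L L' L''
    unfolding rho
  proof (rule le_INF_add_INF)
    fix Ls Ms assume Ls: "Ls \<in> ?C L L'" and Ms: "Ms \<in> ?C L' L''"
    \<comment> \<open>The leaf \<open>L'\<close> ends the first chain and starts the second one, but
      occurs only once in the joined chain.\<close>
    define xs ys where "xs = butlast Ls" and "ys = tl Ms"
    have eq: "Ls = xs @ [L']" "Ms = L' # ys"
      using Ls Ms append_butlast_last_id[of Ls] list.collapse[of Ms] by (simp_all add: xs_def ys_def)
    have "xs @ L' # ys \<in> ?C L L''" using Ls Ms unfolding eq by (cases xs) auto
    then show "(INF Ls \<in> ?C L L''. chain_sum (leaf_dist d) Ls)
        \<le> chain_sum (leaf_dist d) Ls + chain_sum (leaf_dist d) Ms"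
      by (rule INF_lower2) (simp add: eq chain_sum_append[of _ xs L' ys])
  qed
  show ?thesis
    unfolding pseudometric_on_def using zero tri antisym[OF le le] by blast
qed

lemma leaf_rho_le:
  assumes "L \<in> \<L>" "L' \<in> \<L>" "x \<in> L" "y \<in> L'"
  shows "leaf_rho d \<L> L L' \<le> d x y"
proof -
  have "leaf_rho d \<L> L L' \<le> leaf_dist d L L'"
    unfolding leaf_rho_def by (rule INF_lower2[of "[L, L']"]) (use assms in auto)
  also have "\<dots> \<le> d x y"
    unfolding leaf_dist_def by (intro INF_lower2[OF assms(3)] INF_lower2[OF assms(4)]) simp
  finally show ?thesis .
qed

text \<open>Each step of a chain is bounded separately: \<open>E K K'\<close> lies below
  \<open>d\<close> at all pairs of points of the two leaves, hence below their
  \<open>leaf_dist\<close>. Outside \<open>\<L>\<close> the infimum is over the empty set.\<close>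

lemma leaf_rho_greatest:
  assumes E: "pseudometric_on \<L> E"
    and le: "\<And>L L' x y. L \<in> \<L> \<Longrightarrow> L' \<in> \<L> \<Longrightarrow> x \<in> L \<Longrightarrow> y \<in> L' \<Longrightarrow> E L L' \<le> d x y"
  shows "E L L' \<le> leaf_rho d \<L> L L'"
  unfolding leaf_rho_def chain_sum_def[symmetric]
proof (rule INF_greatest)
  fix Ls assume "Ls \<in> {Ls. Ls \<noteq> [] \<and> set Ls \<subseteq> \<L> \<and> hd Ls = L \<and> last Ls = L'}"
  then show "E L L' \<le> chain_sum (leaf_dist d) Ls"
  proof (induction Ls arbitrary: L)
    case (Cons K Ls)
    show ?case
    proof (cases Ls)
      case Nil
      then show ?thesis using Cons.prems pseudometric_onD(1)[OF E] by auto
    next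
      case (Cons K' Ls')
      have "E L L' \<le> E K K' + E K' L'"
        using Cons.prems Cons pseudometric_onD(3)[OF E, of K K' L'] last_in_set[of Ls] by auto
      also have "E K K' \<le> leaf_dist d K K'"
        unfolding leaf_dist_def using Cons.prems Cons by (intro INF_greatest le) auto
      also have "E K' L' \<le> chain_sum (leaf_dist d) Ls"
        using Cons.prems Cons by (intro Cons.IH) auto
      finally show ?thesis by (simp add: Cons add_mono)
    qed
  qed simp
qed

section \<open>Metric tensors in charts\<close>

text \<open>Keeps the first-order content of smoothness. At a boundary point it is the extension
  \<open>G\<close> that has a derivative on a full neighbourhood, continuous in each fixed
  direction.\<close>

lemma smooth_on_extension:
  assumes "smooth_on A f" "x \<in> A"
  obtains W G where "open W" "x \<in> W" "\<forall>y\<in>W \<inter> A. G y = f y"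
    "\<forall>y\<in>W. (G has_derivative frechet_derivative G (at y)) (at y)"
    "\<forall>v. continuous_on W (\<lambda>y. frechet_derivative G (at y) v)"
proof -
  obtain W G where W: "open W" "x \<in> W" "\<forall>k. Ck_on_open k W G" "\<forall>y\<in>W \<inter> A. G y = f y"
    using assms unfolding smooth_on_def by blast
  have "Ck_on_open (Suc 0) W G" using W by blast
  then have "\<And>y. y \<in> W \<Longrightarrow> G differentiable (at y)"
    "\<And>v. continuous_on W (\<lambda>y. frechet_derivative G (at y) v)"
    by auto
  then show ?thesis using W by (intro that[of W G]) (auto simp: frechet_derivative_works)
qed

lemma smooth_on_differentiable:
  assumes "smooth_on A f" "x \<in> A"
  shows "f differentiable (at x within A)"
proof -
  obtain W G where W: "open W" "x \<in> W" "\<forall>y\<in>W \<inter> A. G y = f y"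
    "(G has_derivative frechet_derivative G (at x)) (at x)"
    by (rule smooth_on_extension[OF assms]) blast
  obtain e where e: "e > 0" "ball x e \<subseteq> W" using W(1,2) openE by blast
  have "(f has_derivative frechet_derivative G (at x)) (at x within A)"
    by (rule has_derivative_transform_within[OF has_derivative_at_withinI[OF W(4)] e(1) assms(2)])
      (use W(3) e(2) in \<open>auto simp: dist_commute subset_iff\<close>)
  then show ?thesis unfolding differentiable_def by blast
qed

lemma smooth_on_imp_continuous_on: "smooth_on A f \<Longrightarrow> continuous_on A f"
  unfolding continuous_on_eq_continuous_within
  by (blast intro: differentiable_imp_continuous_within smooth_on_differentiable)

lemma has_vector_derivative_norm_bound:
  assumes "(f has_vector_derivative v) (at t within S)" "0 < e"
  obtains r where "0 < r"
    "\<And>s. s \<in> S \<Longrightarrow> \<bar>s - t\<bar> < r \<Longrightarrow> norm (f s - f t - (s - t) *\<^sub>R v) \<le> e * \<bar>s - t\<bar>"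
  using assms unfolding has_vector_derivative_def has_derivative_within_alt by auto

text \<open>The metric tensor at a fixed point, in coordinates. It differs in general from the inner
  product of the type \<open>'e\<close>, so the square root of \<open>B u u\<close> has to be shown
  to be a norm, and to be equivalent to the Euclidean one.\<close>

locale inner_form =
  fixes B :: "'e::euclidean_space \<Rightarrow> 'e \<Rightarrow> real"
  assumes bilinear: "bilinear B" and sym: "B u v = B v u" and pos: "u \<noteq> 0 \<Longrightarrow> 0 < B u u"
begin

lemma nonneg: "0 \<le> B u u"
  using pos[of u] bilinear_lzero[OF bilinear, of u] by (cases "u = 0") auto

lemma sqrt_scale: "sqrt (B (r *\<^sub>R u) (r *\<^sub>R u)) = \<bar>r\<bar> * sqrt (B u u)"
  using bilinear_lmul[OF bilinear] bilinear_rmul[OF bilinear]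
  by (simp add: real_sqrt_mult)

lemma sqrt_uminus: "sqrt (B (- u) (- u)) = sqrt (B u u)"
  using sqrt_scale[of "-1" u] by simp

text \<open>With a and b the lengths of u and v, the non-negative square length of b u - a v expands
  to 2 a b (a b - \<open>B u v\<close>).\<close>

lemma Cauchy_Schwarz: "B u v \<le> sqrt (B u u) * sqrt (B v v)"
proof (cases "u = 0 \<or> v = 0")
  case True
  then show ?thesis
    using bilinear_lzero[OF bilinear] bilinear_rzero[OF bilinear] by auto
next
  case False
  define a b where "a = sqrt (B u u)" and "b = sqrt (B v v)"
  have ab: "0 < a" "0 < b" "a * a = B u u" "b * b = B v v"
    using pos False nonneg by (auto simp: a_def b_def)
  have "0 \<le> B (b *\<^sub>R u - a *\<^sub>R v) (b *\<^sub>R u - a *\<^sub>R v)" by (rule nonneg)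
  also have "\<dots> = b * b * B u u + a * a * B v v - 2 * (a * b) * B u v"
    by (simp add: algebra_simps sym[of v u] bilinear_lsub[OF bilinear] bilinear_rsub[OF bilinear]
        bilinear_lmul[OF bilinear] bilinear_rmul[OF bilinear])
  also have "\<dots> = 2 * (a * b) * (a * b - B u v)"
    unfolding ab(3,4)[symmetric] by (simp add: algebra_simps)
  finally show ?thesis
    using mult_pos_pos[OF ab(1,2)] unfolding a_def[symmetric] b_def[symmetric]
    by (auto simp: zero_le_mult_iff)
qed

lemma sqrt_triangle: "sqrt (B (u + v) (u + v)) \<le> sqrt (B u u) + sqrt (B v v)"
proof (rule real_le_lsqrt)
  have "B (u + v) (u + v) = B u u + B v v + 2 * B u v"
    using sym[of v u] bilinear_ladd[OF bilinear] bilinear_radd[OF bilinear] by simp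
  also have "\<dots> \<le> B u u + B v v + 2 * (sqrt (B u u) * sqrt (B v v))"
    using Cauchy_Schwarz[of u v] by simp
  also have "\<dots> = (sqrt (B u u) + sqrt (B v v))\<^sup>2"
    using nonneg by (simp add: power2_sum)
  finally show "B (u + v) (u + v) \<le> (sqrt (B u u) + sqrt (B v v))\<^sup>2" .
qed (auto simp: nonneg)

lemma upper_bound: obtains M where "0 < M" "\<And>u. sqrt (B u u) \<le> M * norm u"
proof -
  obtain M where M: "M > 0" "\<And>x y. norm (B x y) \<le> M * norm x * norm y"
    using bilinear_bounded_pos[OF bilinear] by blast
  have "sqrt (B u u) \<le> sqrt M * norm u" for u
    using M(2)[of u u] real_sqrt_le_mono[of "B u u" "M * (norm u * norm u)"]
    by (simp add: real_sqrt_mult[of M] mult.assoc)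
  then show ?thesis using M(1) by (intro that[of "sqrt M"]) auto
qed

text \<open>The minimum over the compact unit sphere is positive, and homogeneity spreads it to all
  vectors.\<close>

lemma lower_bound: obtains m where "0 < m" "\<And>u. m * norm u \<le> sqrt (B u u)"
proof -
  have "continuous_on (sphere 0 1) (\<lambda>u. sqrt (B u u))"
    using bilinear bilinear_conv_bounded_bilinear bounded_bilinear.continuous_on
    by (intro continuous_intros) (blast intro: continuous_intros)
  moreover have "sphere 0 1 \<noteq> ({} :: 'e set)" by simp
  ultimately obtain w where w: "w \<in> sphere 0 1" "\<And>u. u \<in> sphere 0 1 \<Longrightarrow> sqrt (B w w) \<le> sqrt (B u u)"
    using continuous_attains_inf[of "sphere 0 1" "\<lambda>u. sqrt (B u u)"] by auto
  show ?thesis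
  proof
    show "0 < sqrt (B w w)" using w pos[of w] norm_zero by fastforce
    show "sqrt (B w w) * norm u \<le> sqrt (B u u)" for u
    proof (cases "u = 0")
      case False
      then have "sqrt (B w w) \<le> sqrt (B ((1 / norm u) *\<^sub>R u) ((1 / norm u) *\<^sub>R u))"
        by (intro w) auto
      also have "\<dots> = sqrt (B u u) / norm u" by (subst sqrt_scale) simp
      finally show ?thesis using False by (simp add: field_simps)
    qed (use nonneg in auto)
  qed
qed

end

lemma bilinear_Basis_expansion:
  fixes B :: "'e::euclidean_space \<Rightarrow> 'e \<Rightarrow> real"
  assumes "bilinear B"
  shows "B u v = (\<Sum>(i, j)\<in>Basis \<times> Basis. (u \<bullet> i) * (v \<bullet> j) * B i j)"
proof -
  have "B (\<Sum>i\<in>Basis. (u \<bullet> i) *\<^sub>R i) (\<Sum>j\<in>Basis. (v \<bullet> j) *\<^sub>R j)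
      = (\<Sum>(i, j)\<in>Basis \<times> Basis. (u \<bullet> i) * (v \<bullet> j) * B i j)"
    by (subst bilinear_sum[OF assms], rule sum.cong)
      (auto simp: bilinear_lmul[OF assms] bilinear_rmul[OF assms])
  then show ?thesis by (simp add: euclidean_representation)
qed

definition tensor_norm :: "('a, 'e::euclidean_space) metric_tensor \<Rightarrow> ('a, 'e) chart \<Rightarrow> 'e \<Rightarrow> 'e \<Rightarrow> real" where
  "tensor_norm g c z v = sqrt (g c z v v)"

lemma inner_form_tensor:
  assumes "riemannian_manifold T A g" "c \<in> A" "z \<in> snd c ` fst c"
  shows "inner_form (g c z)"
  using assms unfolding riemannian_manifold_def by unfold_locales auto

text \<open>Smoothness of the tensor is given for fixed vectors only; the expansion in the basis
  yields continuity when the point and the vector vary together.\<close>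

lemma continuous_on_tensor:
  fixes T :: "'a topology" and A :: "('a, 'e::euclidean_space) chart set"
  assumes R: "riemannian_manifold T A g" and c: "c \<in> A"
    and z: "continuous_on D z" "z ` D \<subseteq> snd c ` fst c" and v: "continuous_on D v"
  shows "continuous_on D (\<lambda>t. g c (z t) (v t) (v t))"
proof -
  have "continuous_on (snd c ` fst c) (\<lambda>z. g c z i j)" for i j
    using R c unfolding riemannian_manifold_def by (auto intro: smooth_on_imp_continuous_on)
  then have "continuous_on D (\<lambda>t. g c (z t) i j)" for i j
    by (rule continuous_on_compose2[OF _ z])
  then have "continuous_on D (\<lambda>t. \<Sum>(i, j)\<in>Basis \<times> Basis. (v t \<bullet> i) * (v t \<bullet> j) * g c (z t) i j)"
    unfolding case_prod_beta by (intro continuous_intros v)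
  moreover have "g c (z t) (v t) (v t) = (\<Sum>(i, j)\<in>Basis \<times> Basis. (v t \<bullet> i) * (v t \<bullet> j) * g c (z t) i j)"
    if "t \<in> D" for t
    using inner_form.bilinear[OF inner_form_tensor[OF R c]] z(2) that
    by (intro bilinear_Basis_expansion) auto
  ultimately show ?thesis by (simp cong: continuous_on_cong)
qed

text \<open>The radius has to be uniform in v. Differences of coefficients give an additive error of
  the order of norm v squared, and the lower bound m at \<open>z0\<close> absorbs it into a
  factor.\<close>

lemma tensor_norm_nearby:
  fixes T :: "'a topology" and A :: "('a, 'e::euclidean_space) chart set"
  assumes R: "riemannian_manifold T A g" and c: "c \<in> A" and z0: "z0 \<in> snd c ` fst c" and e: "0 < e"
  obtains r where "0 < r"
    "\<And>z v. z \<in> snd c ` fst c \<Longrightarrow> dist z z0 < r \<Longrightarrow> tensor_norm g c z v \<le> (1 + e) * tensor_norm g c z0 v"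
proof -
  interpret B0: inner_form "g c z0" by (rule inner_form_tensor[OF R c z0])
  obtain m where m: "0 < m" "\<And>u. m * norm u \<le> sqrt (g c z0 u u)" using B0.lower_bound by blast
  define S where "S z = (\<Sum>(i, j)\<in>Basis \<times> Basis. \<bar>g c z i j - g c z0 i j\<bar>)" for z
  have "continuous_on (snd c ` fst c) (\<lambda>z. g c z i j)" for i j
    using R c unfolding riemannian_manifold_def by (auto intro: smooth_on_imp_continuous_on)
  then have "continuous_on (snd c ` fst c) S"
    unfolding S_def case_prod_beta by (intro continuous_intros)
  \<comment> \<open>The threshold is dictated by the inequality between (m norm v)^2 and
    \<open>g c z0 v v\<close>.\<close>
  then obtain r where r: "r > 0"
    "\<And>z. z \<in> snd c ` fst c \<Longrightarrow> dist z z0 < r \<Longrightarrow> dist (S z) (S z0) < e * m\<^sup>2"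
    unfolding continuous_on_iff using z0 e m(1) by (metis mult_pos_pos zero_less_power)
  have "tensor_norm g c z v \<le> (1 + e) * tensor_norm g c z0 v"
    if z: "z \<in> snd c ` fst c" "dist z z0 < r" for z v
  proof -
    have "S z0 = 0" by (simp add: S_def)
    then have Sz: "S z \<le> e * m\<^sup>2" using r(2)[OF z] by (auto simp: dist_real_def)
    have "g c z v v - g c z0 v v
        = (\<Sum>(i, j)\<in>Basis \<times> Basis. (v \<bullet> i) * (v \<bullet> j) * (g c z i j - g c z0 i j))"
      unfolding bilinear_Basis_expansion[OF B0.bilinear, of v v]
        bilinear_Basis_expansion[OF inner_form.bilinear[OF inner_form_tensor[OF R c z(1)]], of v v]
      by (simp add: case_prod_beta algebra_simps flip: sum_subtractf)
    also have "\<dots> \<le> (\<Sum>(i, j)\<in>Basis \<times> Basis. norm v * norm v * \<bar>g c z i j - g c z0 i j\<bar>)"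
    proof (rule sum_mono, clarify)
      fix i j :: 'e assume "i \<in> Basis" "j \<in> Basis"
      then have "\<bar>v \<bullet> i\<bar> * \<bar>v \<bullet> j\<bar> \<le> norm v * norm v"
        by (intro mult_mono Basis_le_norm) auto
      then have "\<bar>v \<bullet> i\<bar> * \<bar>v \<bullet> j\<bar> * \<bar>g c z i j - g c z0 i j\<bar> \<le> norm v * norm v * \<bar>g c z i j - g c z0 i j\<bar>"
        by (rule mult_right_mono) auto
      moreover have "(v \<bullet> i) * (v \<bullet> j) * (g c z i j - g c z0 i j) \<le> \<bar>(v \<bullet> i) * (v \<bullet> j) * (g c z i j - g c z0 i j)\<bar>"
        by (rule abs_ge_self)
      ultimately show "(v \<bullet> i) * (v \<bullet> j) * (g c z i j - g c z0 i j) \<le> norm v * norm v * \<bar>g c z i j - g c z0 i j\<bar>"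
        unfolding abs_mult by linarith
    qed
    also have "\<dots> = (norm v)\<^sup>2 * S z"
      unfolding S_def by (simp add: sum_distrib_left case_prod_beta power2_eq_square)
    also have "\<dots> \<le> (norm v)\<^sup>2 * (e * m\<^sup>2)" using Sz by (intro mult_left_mono) auto
    also have "\<dots> = e * (m * norm v)\<^sup>2" by (simp add: power_mult_distrib)
    also have "\<dots> \<le> e * g c z0 v v"
    proof (rule mult_left_mono)
      show "(m * norm v)\<^sup>2 \<le> g c z0 v v"
        using power_mono[OF m(2)[of v], of 2] m(1) B0.nonneg by simp
    qed (use e in auto)
    finally have "g c z v v \<le> (1 + e) * g c z0 v v" by (simp add: algebra_simps)
    \<comment> \<open>Weakening 1 + e to its square makes the factor after taking the square root
      equal to 1 + e.\<close>
    also have "\<dots> \<le> (1 + e) * (1 + e) * g c z0 v v"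
      using e B0.nonneg[of v] by (intro mult_right_mono) auto
    finally have "sqrt (g c z v v) \<le> sqrt ((1 + e) * (1 + e) * g c z0 v v)" by simp
    then show ?thesis using e by (simp add: tensor_norm_def real_sqrt_mult)
  qed
  then show ?thesis using that r(1) by blast
qed

section \<open>Charts as homeomorphisms\<close>

lemma is_chartD:
  assumes "is_chart T c"
  shows is_chart_openin: "openin T (fst c)"
    and is_chart_inj: "inj_on (snd c) (fst c)"
    and is_chart_range: "openin (top_of_set half_space) (snd c ` fst c)"
proof -
  show o: "openin T (fst c)" "openin (top_of_set half_space) (snd c ` fst c)"
    using assms by (auto simp: is_chart_def)
  have "topspace (subtopology T (fst c)) = fst c"
    using openin_subset[OF o(1)] by auto
  then show "inj_on (snd c) (fst c)"
    using assms homeomorphic_imp_injective_map unfolding is_chart_def by metis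
qed

lemma openin_chart_preimage:
  assumes "is_chart T c" "open W"
  shows "openin T {q \<in> fst c. snd c q \<in> W}"
proof -
  have o: "openin T (fst c)" by (rule is_chart_openin[OF assms(1)])
  have "continuous_map (subtopology T (fst c)) (top_of_set (snd c ` fst c)) (snd c)"
    using assms(1) homeomorphic_imp_continuous_map unfolding is_chart_def by blast
  moreover have "openin (top_of_set (snd c ` fst c)) (snd c ` fst c \<inter> W)"
    using assms(2) by (auto simp: openin_open)
  ultimately have "openin (subtopology T (fst c)) {q \<in> topspace (subtopology T (fst c)). snd c q \<in> snd c ` fst c \<inter> W}"
    by (rule openin_continuous_map_preimage)
  moreover have "{q \<in> topspace (subtopology T (fst c)). snd c q \<in> snd c ` fst c \<inter> W} = {q \<in> fst c. snd c q \<in> W}"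
    using openin_subset[OF o] by auto
  ultimately show ?thesis using o openin_trans_full by metis
qed

lemma continuous_map_chart_inverse:
  assumes "is_chart T c"
  shows "continuous_map (top_of_set (snd c ` fst c)) T (inv_into (fst c) (snd c))"
proof -
  have o: "openin T (fst c)" by (rule is_chart_openin[OF assms])
  have ts: "topspace (subtopology T (fst c)) = fst c" using openin_subset[OF o] by auto
  have "homeomorphic_map (subtopology T (fst c)) (top_of_set (snd c ` fst c)) (snd c)"
    using assms unfolding is_chart_def by blast
  then obtain k where k: "homeomorphic_maps (subtopology T (fst c)) (top_of_set (snd c ` fst c)) (snd c) k"
    unfolding homeomorphic_map_maps by blast
  then have "continuous_map (top_of_set (snd c ` fst c)) T k"
    unfolding homeomorphic_maps_def continuous_map_in_subtopology by blast
  moreover have "k z = inv_into (fst c) (snd c) z" if z: "z \<in> snd c ` fst c" for z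
  proof -
    obtain q where "q \<in> fst c" "z = snd c q" using z by blast
    then show ?thesis
      using k ts inv_into_f_f[OF is_chart_inj[OF assms]] unfolding homeomorphic_maps_def by auto
  qed
  ultimately show ?thesis by (rule continuous_map_eq) auto
qed

lemma local_rep_chart:
  assumes "is_chart T c" "q \<in> fst c"
  shows "local_rep c c' f (snd c q) = snd c' (f q)"
  using inv_into_f_f[OF is_chart_inj[OF assms(1)] assms(2)] by (simp add: local_rep_def)

section \<open>Curves and isometric maps\<close>

text \<open>The preimage is only relatively open in [0, 1]. An open set of reals representing it
  allows filters \<open>at t within I\<close> to be localised and balls around t to be
  taken.\<close>

lemma pathin_open_preimage:
  assumes "pathin T \<gamma>" "openin T U"
  obtains O' where "open O'" "\<forall>s\<in>{0..1}. s \<in> O' \<longleftrightarrow> \<gamma> s \<in> U"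
proof -
  have "openin (top_of_set {0..1}) {s \<in> {0..1::real}. \<gamma> s \<in> U}"
    using openin_continuous_map_preimage[OF assms(1)[unfolded pathin_def] assms(2)] by simp
  then obtain O' where "open O'" "{s \<in> {0..1::real}. \<gamma> s \<in> U} = {0..1} \<inter> O'"
    by (auto simp: openin_open)
  then show ?thesis using that by blast
qed

lemma pathin_imp_topspace: "pathin T \<gamma> \<Longrightarrow> s \<in> {0..1} \<Longrightarrow> \<gamma> s \<in> topspace T"
  unfolding pathin_def continuous_map_def by auto

lemma riemannian_chart:
  assumes "riemannian_manifold T A g"
  shows "c \<in> A \<Longrightarrow> is_chart T c"
    and "x \<in> topspace T \<Longrightarrow> \<exists>c\<in>A. x \<in> fst c"
  using assms unfolding riemannian_manifold_def smooth_manifold_def by blast+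

lemma restricts_to_id:
  assumes "riemannian_manifold T A g"
  shows "restricts_to A g id T A g"
  using assms unfolding restricts_to_def riemannian_manifold_def smooth_manifold_def by blast

text \<open>\<open>preserves_metric\<close> speaks of the value of
  \<open>frechet_derivative\<close>; smoothness makes this value an actual derivative within the
  local domain, so that the chain rule applies to it.\<close>

lemma restricts_to_derivative:
  fixes A1 :: "('a, 'e::euclidean_space) chart set" and A :: "('b, 'e) chart set"
  assumes j: "restricts_to A g j T1 A1 g1" and c1: "c1 \<in> A1" "is_chart T1 c1" and c: "c \<in> A"
    and p: "p \<in> fst c1" "j p \<in> fst c"
  obtains df where
    "(local_rep c1 c j has_derivative df) (at (snd c1 p) within local_dom c1 c (topspace T1) j)"
    "\<And>v. tensor_norm g c (snd c (j p)) (df v) = tensor_norm g1 c1 (snd c1 p) v"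
proof -
  have pT: "p \<in> topspace T1" using is_chart_openin[OF c1(2)] openin_subset p(1) by blast
  let ?df = "frechet_derivative (local_rep c1 c j) (at (snd c1 p) within local_dom c1 c (topspace T1) j)"
  have "snd c1 p \<in> local_dom c1 c (topspace T1) j" using p pT by (auto simp: local_dom_def)
  then have "local_rep c1 c j differentiable (at (snd c1 p) within local_dom c1 c (topspace T1) j)"
    using j c1 c unfolding restricts_to_def smooth_in_charts_def by (blast intro: smooth_on_differentiable)
  then have "(local_rep c1 c j has_derivative ?df) (at (snd c1 p) within local_dom c1 c (topspace T1) j)"
    by (simp add: frechet_derivative_works)
  moreover have "g c (snd c (j p)) (?df v) (?df v) = g1 c1 (snd c1 p) v v" for v
    using j c1(1) c p pT unfolding restricts_to_def preserves_metric_def Let_def by blast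
  ultimately show ?thesis using that[of ?df] by (simp add: tensor_norm_def)
qed

text \<open>A chain rule whose outer map is differentiable only within its local domain, which is no
  neighbourhood at a boundary point. It applies because near t the coordinates of the path stay in
  that domain.\<close>

lemma has_vector_derivative_local_rep:
  assumes c1: "is_chart T1 c1" and \<gamma>: "pathin T1 \<gamma>" and j: "continuous_map T1 T j" and c: "is_chart T c"
    and I: "I \<subseteq> {0..1}" "t \<in> I" and t: "\<gamma> t \<in> fst c1" "j (\<gamma> t) \<in> fst c"
    and df: "(local_rep c1 c j has_derivative df) (at (snd c1 (\<gamma> t)) within local_dom c1 c (topspace T1) j)"
    and v: "((snd c1 \<circ> \<gamma>) has_vector_derivative v) (at t within I)"
  shows "((snd c \<circ> (j \<circ> \<gamma>)) has_vector_derivative df v) (at t within I)"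
proof -
  have "openin T1 (fst c1 \<inter> {q \<in> topspace T1. j q \<in> fst c})"
    using is_chart_openin[OF c1] openin_continuous_map_preimage[OF j is_chart_openin[OF c]] by blast
  then obtain O' where O': "open O'" "\<forall>s\<in>{0..1}. s \<in> O' \<longleftrightarrow> \<gamma> s \<in> fst c1 \<inter> {q \<in> topspace T1. j q \<in> fst c}"
    by (rule pathin_open_preimage[OF \<gamma>]) (rule that)
  let ?S = "I \<inter> O'"
  have tS: "t \<in> ?S" using bspec[OF O'(2), of t] I t pathin_imp_topspace[OF \<gamma>] by auto
  have at: "at t within I = at t within ?S"
    by (rule at_within_nhd[of _ O']) (use tS O'(1) in auto)
  have S: "\<gamma> s \<in> fst c1" "j (\<gamma> s) \<in> fst c" "\<gamma> s \<in> topspace T1" if "s \<in> ?S" for s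
    using bspec[OF O'(2), of s] I that by auto
  have "((snd c1 \<circ> \<gamma>) has_derivative (\<lambda>h. h *\<^sub>R v)) (at t within ?S)"
    using v unfolding at has_vector_derivative_def .
  moreover have "(local_rep c1 c j has_derivative df) (at ((snd c1 \<circ> \<gamma>) t) within (snd c1 \<circ> \<gamma>) ` ?S)"
    by (rule has_derivative_subset) (use df S in \<open>auto simp: local_dom_def\<close>)
  ultimately have "((\<lambda>s. local_rep c1 c j ((snd c1 \<circ> \<gamma>) s)) has_derivative (\<lambda>h. df (h *\<^sub>R v))) (at t within ?S)"
    by (rule has_derivative_in_compose)
  then have "((\<lambda>s. local_rep c1 c j ((snd c1 \<circ> \<gamma>) s)) has_vector_derivative df v) (at t within ?S)"
    unfolding has_vector_derivative_def linear_scale[OF has_derivative_linear[OF df]] .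
  then show ?thesis
    unfolding at by (rule has_vector_derivative_transform[OF tS, rotated])
      (simp add: local_rep_chart[OF c1 S(1)])
qed

text \<open>\<open>speed\<close> picks some chart around \<open>j (\<gamma> t)\<close>, and the
  derivative of j into that chart carries v to a vector of the same length. The parameter is
  interior because \<open>speed\<close> uses the two-sided derivative.\<close>

lemma speed_map:
  fixes A1 :: "('a, 'e::euclidean_space) chart set" and A :: "('b, 'e) chart set"
  assumes R1: "riemannian_manifold T1 A1 g1" and R: "riemannian_manifold T A g"
    and j: "continuous_map T1 T j" "restricts_to A g j T1 A1 g1" and \<gamma>: "pathin T1 \<gamma>"
    and t: "t \<in> {0<..<1}" and c1: "c1 \<in> A1" "\<gamma> t \<in> fst c1"
    and v: "((snd c1 \<circ> \<gamma>) has_vector_derivative v) (at t)"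
  shows "speed A g (j \<circ> \<gamma>) t = tensor_norm g1 c1 (snd c1 (\<gamma> t)) v"
proof -
  define c where "c = (SOME c. c \<in> A \<and> (j \<circ> \<gamma>) t \<in> fst c)"
  have "j (\<gamma> t) \<in> topspace T"
    using j(1) pathin_imp_topspace[OF \<gamma>, of t] t unfolding continuous_map_def by auto
  then have "\<exists>c. c \<in> A \<and> (j \<circ> \<gamma>) t \<in> fst c" using riemannian_chart(2)[OF R] by fastforce
  then have c: "c \<in> A" "j (\<gamma> t) \<in> fst c"
    unfolding c_def using someI_ex[of "\<lambda>c. c \<in> A \<and> (j \<circ> \<gamma>) t \<in> fst c"] by auto
  obtain df where df: "(local_rep c1 c j has_derivative df) (at (snd c1 (\<gamma> t)) within local_dom c1 c (topspace T1) j)"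
    "\<And>v. tensor_norm g c (snd c (j (\<gamma> t))) (df v) = tensor_norm g1 c1 (snd c1 (\<gamma> t)) v"
    using restricts_to_derivative[OF j(2) c1(1) riemannian_chart(1)[OF R1 c1(1)] c(1) c1(2) c(2)] by blast
  have at: "at t = at t within {0<..<1}" using t by (simp add: at_within_open[of t "{0<..<1}"])
  have "((snd c \<circ> (j \<circ> \<gamma>)) has_vector_derivative df v) (at t)"
    by (subst at, rule has_vector_derivative_local_rep[OF riemannian_chart(1)[OF R1 c1(1)] \<gamma> j(1)
        riemannian_chart(1)[OF R c(1)] _ t c1(2) c(2) df(1)]) (use v at in auto)
  then show ?thesis
    unfolding speed_def Let_def c_def[symmetric]
    by (simp add: vector_derivative_at flip: df(2)) (simp add: tensor_norm_def)
qed

text \<open>The case j = id of \<open>speed_map\<close>: the chart picked by \<open>speed\<close>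
  may differ from c, but the transition map preserves the metric.\<close>

lemma speed_chart:
  fixes A :: "('a, 'e::euclidean_space) chart set"
  assumes R: "riemannian_manifold T A g" and "pathin T \<gamma>" "t \<in> {0<..<1}" "c \<in> A" "\<gamma> t \<in> fst c"
    "((snd c \<circ> \<gamma>) has_vector_derivative v) (at t)"
  shows "speed A g \<gamma> t = tensor_norm g c (snd c (\<gamma> t)) v"
  using speed_map[OF R R continuous_map_id restricts_to_id[OF R] assms(2-)] by (simp add: comp_def)

text \<open>At break points and at the ends \<open>vector_derivative\<close> may be an arbitrary
  vector; its length is non-negative all the same.\<close>

lemma speed_nonneg:
  fixes A :: "('a, 'e::euclidean_space) chart set"
  assumes R: "riemannian_manifold T A g" and \<gamma>: "pathin T \<gamma>" and t: "t \<in> {0..1}"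
  shows "0 \<le> speed A g \<gamma> t"
proof -
  define c where "c = (SOME c. c \<in> A \<and> \<gamma> t \<in> fst c)"
  have "\<exists>c. c \<in> A \<and> \<gamma> t \<in> fst c"
    using riemannian_chart(2)[OF R pathin_imp_topspace[OF \<gamma> t]] by blast
  then have c: "c \<in> A" "\<gamma> t \<in> fst c"
    unfolding c_def using someI_ex[of "\<lambda>c. c \<in> A \<and> \<gamma> t \<in> fst c"] by auto
  then show ?thesis
    unfolding speed_def Let_def c_def[symmetric]
    using inner_form.nonneg[OF inner_form_tensor[OF R c(1)]] by auto
qed

text \<open>Near t the new coordinate curve is the old one followed by a C1 extension of the local
  representative. One chart around each point is enough for \<gamma>, while the conclusion covers
  all charts of \<open>A\<close>; with j = id this passes from a single chart to the whole
  atlas.\<close>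

lemma C1_curve_on_map:
  fixes A1 :: "('a, 'e::euclidean_space) chart set" and A :: "('b, 'e) chart set"
  assumes charts1: "\<And>c. c \<in> A1 \<Longrightarrow> is_chart T1 c" and charts: "\<And>c. c \<in> A \<Longrightarrow> is_chart T c"
    and j: "continuous_map T1 T j" "smooth_in_charts A1 A (topspace T1) j" and \<gamma>: "pathin T1 \<gamma>"
    and ab: "0 \<le> a" "a < b" "b \<le> 1"
    and C1: "\<And>t. t \<in> {a..b} \<Longrightarrow> \<exists>c\<in>A1. \<gamma> t \<in> fst c \<and> (\<exists>\<gamma>'.
      (\<forall>s\<in>{a..b}. \<gamma> s \<in> fst c \<longrightarrow> ((snd c \<circ> \<gamma>) has_vector_derivative \<gamma>' s) (at s within {a..b})) \<and>
      continuous_on {s \<in> {a..b}. \<gamma> s \<in> fst c} \<gamma>')"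
  shows "C1_curve_on A a b (j \<circ> \<gamma>)"
  unfolding C1_curve_on_def
proof
  fix c assume cA: "c \<in> A"
  \<comment> \<open>Derivatives within a nondegenerate interval are unique, so this one function
    agrees with the formulas found locally in the various charts \<open>c1\<close>.\<close>
  define \<gamma>' where "\<gamma>' s = vector_derivative (snd c \<circ> (j \<circ> \<gamma>)) (at s within {a..b})" for s
  let ?D = "{t \<in> {a..b}. (j \<circ> \<gamma>) t \<in> fst c}"
  have loc: "((snd c \<circ> (j \<circ> \<gamma>)) has_vector_derivative \<gamma>' t) (at t within {a..b})
      \<and> continuous (at t within ?D) \<gamma>'" if t: "t \<in> {a..b}" and tc: "j (\<gamma> t) \<in> fst c" for t
  proof -
    obtain c1 \<gamma>1 where c1: "c1 \<in> A1" "\<gamma> t \<in> fst c1"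
      and der: "\<And>s. s \<in> {a..b} \<Longrightarrow> \<gamma> s \<in> fst c1 \<Longrightarrow> ((snd c1 \<circ> \<gamma>) has_vector_derivative \<gamma>1 s) (at s within {a..b})"
      and cont: "continuous_on {s \<in> {a..b}. \<gamma> s \<in> fst c1} \<gamma>1"
      using C1[OF t] by blast
    note chart1 = charts1[OF c1(1)]
    have tT: "\<gamma> t \<in> topspace T1" using pathin_imp_topspace[OF \<gamma>, of t] t ab by auto
    have "smooth_on (local_dom c1 c (topspace T1) j) (local_rep c1 c j)"
      using j(2) c1(1) cA unfolding smooth_in_charts_def by blast
    moreover have "snd c1 (\<gamma> t) \<in> local_dom c1 c (topspace T1) j"
      using c1 tc tT by (auto simp: local_dom_def)
    ultimately obtain W G where W: "open W" "snd c1 (\<gamma> t) \<in> W"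
      and G: "\<forall>y\<in>W \<inter> local_dom c1 c (topspace T1) j. G y = local_rep c1 c j y"
      and "\<forall>y\<in>W. (G has_derivative frechet_derivative G (at y)) (at y)"
      and "\<forall>v. continuous_on W (\<lambda>y. frechet_derivative G (at y) v)"
      by (rule smooth_on_extension) (rule that)
    then have dG: "\<And>y. y \<in> W \<Longrightarrow> (G has_derivative frechet_derivative G (at y)) (at y)"
      and cG: "\<And>v. continuous_on W (\<lambda>y. frechet_derivative G (at y) v)"
      by blast+
    have "openin T1 ({q \<in> fst c1. snd c1 q \<in> W} \<inter> {q \<in> topspace T1. j q \<in> fst c})"
      using openin_chart_preimage[OF chart1 W(1)]
        openin_continuous_map_preimage[OF j(1) is_chart_openin[OF charts[OF cA]]] by blast
    then obtain O' where O': "open O'"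
      "\<forall>s\<in>{0..1}. s \<in> O' \<longleftrightarrow> \<gamma> s \<in> {q \<in> fst c1. snd c1 q \<in> W} \<inter> {q \<in> topspace T1. j q \<in> fst c}"
      by (rule pathin_open_preimage[OF \<gamma>]) (rule that)
    let ?S = "{a..b} \<inter> O'"
    have S: "\<gamma> s \<in> fst c1" "snd c1 (\<gamma> s) \<in> W" "j (\<gamma> s) \<in> fst c" "\<gamma> s \<in> topspace T1" if "s \<in> ?S" for s
      using bspec[OF O'(2), of s] that ab by auto
    have tS: "t \<in> ?S" using bspec[OF O'(2), of t] t ab c1 W(2) tc tT by auto
    define \<phi> where "\<phi> s = frechet_derivative G (at (snd c1 (\<gamma> s))) (\<gamma>1 s)" for s
    have at: "at s within {a..b} = at s within ?S" if "s \<in> ?S" for s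
      by (rule at_within_nhd[of _ O']) (use that O'(1) in auto)
    have deriv: "((snd c \<circ> (j \<circ> \<gamma>)) has_vector_derivative \<phi> s) (at s within {a..b})" if s: "s \<in> ?S" for s
    proof -
      have "((snd c1 \<circ> \<gamma>) has_derivative (\<lambda>h. h *\<^sub>R \<gamma>1 s)) (at s within ?S)"
        using der[of s] s S(1)[OF s] unfolding at[OF s] has_vector_derivative_def by auto
      moreover have "(G has_derivative frechet_derivative G (at (snd c1 (\<gamma> s)))) (at ((snd c1 \<circ> \<gamma>) s) within (snd c1 \<circ> \<gamma>) ` ?S)"
        using dG[OF S(2)[OF s]] by (simp add: has_derivative_at_withinI)
      ultimately have "((\<lambda>r. G ((snd c1 \<circ> \<gamma>) r)) has_derivative (\<lambda>h. frechet_derivative G (at (snd c1 (\<gamma> s))) (h *\<^sub>R \<gamma>1 s))) (at s within ?S)"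
        by (rule has_derivative_in_compose)
      then have "((\<lambda>r. G ((snd c1 \<circ> \<gamma>) r)) has_vector_derivative \<phi> s) (at s within ?S)"
        unfolding has_vector_derivative_def \<phi>_def
        using linear_scale[OF has_derivative_linear[OF dG[OF S(2)[OF s]]]] by simp
      moreover have "(snd c \<circ> (j \<circ> \<gamma>)) r = G ((snd c1 \<circ> \<gamma>) r)" if r: "r \<in> ?S" for r
        using S[OF r] bspec[OF G, of "snd c1 (\<gamma> r)"] local_rep_chart[OF chart1 S(1)[OF r], of c j]
        by (auto simp: local_dom_def)
      ultimately show ?thesis
        unfolding at[OF s] by (rule has_vector_derivative_transform[OF s, rotated])
    qed
    have \<gamma>'_eq: "\<gamma>' s = \<phi> s" if s: "s \<in> ?S" for s
      unfolding \<gamma>'_def by (rule vector_derivative_within_closed_interval) (use s ab deriv in auto)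
    have "continuous_on ?S (snd c1 \<circ> \<gamma>)"
      unfolding continuous_on_eq_continuous_within
    proof
      fix s assume s: "s \<in> ?S"
      have "((snd c1 \<circ> \<gamma>) has_vector_derivative \<gamma>1 s) (at s within ?S)"
        using der[of s] s S(1)[OF s] unfolding at[OF s] by auto
      then show "continuous (at s within ?S) (snd c1 \<circ> \<gamma>)" by (rule has_vector_derivative_continuous)
    qed
    then have "continuous_on ?S (\<lambda>s. frechet_derivative G (at ((snd c1 \<circ> \<gamma>) s)) i)" for i
      by (rule continuous_on_compose2[OF cG]) (use S in auto)
    moreover have "continuous_on ?S \<gamma>1"
      by (rule continuous_on_subset[OF cont]) (use S in auto)
    \<comment> \<open>The derivative of \<open>G\<close> is known to be continuous in fixed
      directions, hence the expansion of \<open>\<gamma>1 s\<close> in the basis.\<close>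
    ultimately have "continuous_on ?S (\<lambda>s. \<Sum>i\<in>Basis. (\<gamma>1 s \<bullet> i) *\<^sub>R frechet_derivative G (at (snd c1 (\<gamma> s))) i)"
      by (intro continuous_intros) (simp_all add: comp_def)
    moreover have "(\<Sum>i\<in>Basis. (\<gamma>1 s \<bullet> i) *\<^sub>R frechet_derivative G (at (snd c1 (\<gamma> s))) i) = \<gamma>' s"
      if s: "s \<in> ?S" for s
    proof -
      note lin = has_derivative_linear[OF dG[OF S(2)[OF s]]]
      have "frechet_derivative G (at (snd c1 (\<gamma> s))) (\<Sum>i\<in>Basis. (\<gamma>1 s \<bullet> i) *\<^sub>R i)
          = (\<Sum>i\<in>Basis. (\<gamma>1 s \<bullet> i) *\<^sub>R frechet_derivative G (at (snd c1 (\<gamma> s))) i)"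
        by (simp add: linear_sum[OF lin] linear_scale[OF lin])
      then show ?thesis unfolding \<gamma>'_eq[OF s] \<phi>_def by (simp add: euclidean_representation)
    qed
    ultimately have "continuous_on ?S \<gamma>'" by (rule continuous_on_eq)
    then have "continuous (at t within ?S) \<gamma>'" using tS continuous_on_eq_continuous_within by blast
    moreover have "at t within ?D = at t within ?S"
      by (rule at_within_nhd[of _ O']) (use tS O'(1) S in auto)
    ultimately show ?thesis using deriv[OF tS] \<gamma>'_eq[OF tS] by simp
  qed
  show "\<exists>\<gamma>'. (\<forall>t\<in>{a..b}. (j \<circ> \<gamma>) t \<in> fst c \<longrightarrow>
        ((snd c \<circ> (j \<circ> \<gamma>)) has_vector_derivative \<gamma>' t) (at t within {a..b})) \<and>
     continuous_on {t \<in> {a..b}. (j \<circ> \<gamma>) t \<in> fst c} \<gamma>'"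
    using loc by (intro exI[of _ \<gamma>']) (auto simp: continuous_on_eq_continuous_within)
qed

lemma finite_avoids_punctured_interval:
  fixes t :: real
  assumes "finite P"
  obtains r where "0 < r" "{t<..<t + r} \<inter> P = {}" "{t - r<..<t} \<inter> P = {}"
proof -
  obtain r where r: "r > 0" "\<forall>x\<in>P. x \<noteq> t \<longrightarrow> r \<le> dist t x"
    using finite_set_avoid[OF assms] by blast
  then show ?thesis by (intro that[of r]) (auto simp: dist_real_def)
qed

text \<open>Two-sided derivatives are wanted, so 0 and 1 join the break points in
  \<open>Q\<close>.\<close>

lemma piecewise_C1_curve_differentiable:
  fixes A :: "('a, 'e::euclidean_space) chart set"
  assumes R: "riemannian_manifold T A g" and \<gamma>: "piecewise_C1_curve T A \<gamma>"
  obtains Q where "finite Q" "\<forall>t\<in>{0..1} - Q. t \<in> {0<..<1} \<and>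
    (\<exists>c\<in>A. \<gamma> t \<in> fst c \<and> (\<exists>v. ((snd c \<circ> \<gamma>) has_vector_derivative v) (at t)))"
proof -
  obtain P where P: "finite P"
    "\<And>a b. 0 \<le> a \<Longrightarrow> a < b \<Longrightarrow> b \<le> 1 \<Longrightarrow> {a<..<b} \<inter> P = {} \<Longrightarrow> C1_curve_on A a b \<gamma>"
    and p: "pathin T \<gamma>"
    using \<gamma> unfolding piecewise_C1_curve_def by blast
  have *: "\<exists>c\<in>A. \<gamma> t \<in> fst c \<and> (\<exists>v. ((snd c \<circ> \<gamma>) has_vector_derivative v) (at t))"
    if t: "t \<in> {0..1} - (P \<union> {0, 1})" for t
  proof -
    obtain r where r: "0 < r" "{t<..<t + r} \<inter> P = {}" "{t - r<..<t} \<inter> P = {}"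
      by (rule finite_avoids_punctured_interval[OF P(1)]) (rule that)
    define s where "s = min r (min t (1 - t))"
    have s: "0 < s" "s \<le> r" "s \<le> t" "s \<le> 1 - t" using r t by (auto simp: s_def)
    have "x \<notin> P" if x: "x \<in> {t - s<..<t + s}" for x
    proof -
      consider "x \<in> {t<..<t + r}" | "x \<in> {t - r<..<t}" | "x = t" using x s(2) by fastforce
      then show ?thesis using r(2,3) t by cases auto
    qed
    then have C1: "C1_curve_on A (t - s) (t + s) \<gamma>" using s by (intro P(2)) auto
    obtain c where c: "c \<in> A" "\<gamma> t \<in> fst c"
      using riemannian_chart(2)[OF R pathin_imp_topspace[OF p]] t by blast
    then obtain v where "((snd c \<circ> \<gamma>) has_vector_derivative v) (at t within {t - s..t + s})"
      using C1 s(1) unfolding C1_curve_on_def by force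
    moreover have "at t within {t - s..t + s} = at t"
      using s(1) by (intro at_within_interior) auto
    ultimately show ?thesis using c by auto
  qed
  show ?thesis
  proof (rule that[of "P \<union> {0, 1}"], use P(1) in simp, intro ballI conjI)
    fix t assume t: "t \<in> {0..1} - (P \<union> {0, 1})"
    then show "t \<in> {0<..<1}" by auto
    show "\<exists>c\<in>A. \<gamma> t \<in> fst c \<and> (\<exists>v. ((snd c \<circ> \<gamma>) has_vector_derivative v) (at t))"
      by (rule *[OF t])
  qed
qed

text \<open>The speeds agree off a finite set, which the integral ignores.\<close>

lemma piecewise_C1_curve_map:
  fixes A1 :: "('a, 'e::euclidean_space) chart set" and A :: "('b, 'e) chart set"
  assumes R1: "riemannian_manifold T1 A1 g1" and R: "riemannian_manifold T A g"
    and j: "continuous_map T1 T j" "restricts_to A g j T1 A1 g1" and \<gamma>: "piecewise_C1_curve T1 A1 \<gamma>"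
  shows "piecewise_C1_curve T A (j \<circ> \<gamma>)" and "curve_length A g (j \<circ> \<gamma>) = curve_length A1 g1 \<gamma>"
proof -
  obtain P where P: "finite P"
    "\<And>a b. 0 \<le> a \<Longrightarrow> a < b \<Longrightarrow> b \<le> 1 \<Longrightarrow> {a<..<b} \<inter> P = {} \<Longrightarrow> C1_curve_on A1 a b \<gamma>"
    and p: "pathin T1 \<gamma>"
    using \<gamma> unfolding piecewise_C1_curve_def by blast
  have smooth: "smooth_in_charts A1 A (topspace T1) j" using j(2) unfolding restricts_to_def by blast
  have "C1_curve_on A a b (j \<circ> \<gamma>)" if ab: "0 \<le> a" "a < b" "b \<le> 1" "{a<..<b} \<inter> P = {}" for a b
  proof (rule C1_curve_on_map[OF riemannian_chart(1)[OF R1] riemannian_chart(1)[OF R] j(1) smooth p ab(1-3)])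
    fix t assume t: "t \<in> {a..b}"
    then have "t \<in> {0..1}" using ab by auto
    then obtain c where "c \<in> A1" "\<gamma> t \<in> fst c"
      using riemannian_chart(2)[OF R1 pathin_imp_topspace[OF p]] by blast
    then show "\<exists>c\<in>A1. \<gamma> t \<in> fst c \<and> (\<exists>\<gamma>'.
      (\<forall>s\<in>{a..b}. \<gamma> s \<in> fst c \<longrightarrow> ((snd c \<circ> \<gamma>) has_vector_derivative \<gamma>' s) (at s within {a..b})) \<and>
      continuous_on {s \<in> {a..b}. \<gamma> s \<in> fst c} \<gamma>')"
      using P(2)[OF ab] unfolding C1_curve_on_def by blast
  qed
  then show "piecewise_C1_curve T A (j \<circ> \<gamma>)"
    unfolding piecewise_C1_curve_def using pathin_compose[OF p j(1)] P(1) by blast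
  obtain Q where Q: "finite Q" "\<forall>t\<in>{0..1} - Q. t \<in> {0<..<1} \<and>
      (\<exists>c\<in>A1. \<gamma> t \<in> fst c \<and> (\<exists>v. ((snd c \<circ> \<gamma>) has_vector_derivative v) (at t)))"
    by (rule piecewise_C1_curve_differentiable[OF R1 \<gamma>]) (rule that)
  have "speed A g (j \<circ> \<gamma>) t = speed A1 g1 \<gamma> t" if tQ: "t \<in> {0..1} - Q" for t
  proof -
    obtain c v where t: "t \<in> {0<..<1}" and c: "c \<in> A1" "\<gamma> t \<in> fst c"
      and v: "((snd c \<circ> \<gamma>) has_vector_derivative v) (at t)"
      using bspec[OF Q(2) tQ] by blast
    show ?thesis
      unfolding speed_map[OF R1 R j p t c v] speed_chart[OF R1 p t c v] ..
  qed
  then show "curve_length A g (j \<circ> \<gamma>) = curve_length A1 g1 \<gamma>"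
    unfolding curve_length_def
    by (intro integral_spike[of Q, symmetric] negligible_finite Q(1)) auto
qed

lemma riemannian_distance_map:
  fixes A1 :: "('a, 'e::euclidean_space) chart set" and A :: "('b, 'e) chart set"
  assumes R1: "riemannian_manifold T1 A1 g1" and R: "riemannian_manifold T A g"
    and j: "continuous_map T1 T j" "restricts_to A g j T1 A1 g1"
  shows "riemannian_distance T A g (j x) (j y) \<le> riemannian_distance T1 A1 g1 x y"
  unfolding riemannian_distance_def
proof (rule INF_greatest)
  fix \<gamma> assume "\<gamma> \<in> {\<gamma>. piecewise_C1_curve T1 A1 \<gamma> \<and> \<gamma> 0 = x \<and> \<gamma> 1 = y}"
  then show "(INF \<gamma> \<in> {\<gamma>. piecewise_C1_curve T A \<gamma> \<and> \<gamma> 0 = j x \<and> \<gamma> 1 = j y}. ennreal (curve_length A g \<gamma>))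
      \<le> ennreal (curve_length A1 g1 \<gamma>)"
    using piecewise_C1_curve_map[OF R1 R j, of \<gamma>] by (intro INF_lower2[of "j \<circ> \<gamma>"]) auto
qed

section \<open>The Riemannian distance at small scales\<close>

lemma tensor_norm_nonneg:
  fixes A :: "('a, 'e::euclidean_space) chart set"
  assumes "riemannian_manifold T A g" "c \<in> A" "p \<in> fst c"
  shows "0 \<le> tensor_norm g c (snd c p) v"
  using inner_form.nonneg[OF inner_form_tensor[OF assms(1,2)]] assms(3) by (simp add: tensor_norm_def)

lemma tensor_norm_zero:
  fixes A :: "('a, 'e::euclidean_space) chart set"
  assumes "riemannian_manifold T A g" "c \<in> A" "p \<in> fst c"
  shows "tensor_norm g c (snd c p) 0 = 0"
  using inner_form.sqrt_scale[OF inner_form_tensor[OF assms(1,2)], of "snd c p" 0 0] assms(3)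
  by (simp add: tensor_norm_def)

lemma riemannian_distance_le_chart:
  fixes A :: "('a, 'e::euclidean_space) chart set"
  assumes R: "riemannian_manifold T A g" and c: "c \<in> A" and p: "p \<in> fst c" and e: "0 < e"
  obtains U where "openin T U" "p \<in> U" "U \<subseteq> fst c"
    "\<forall>q\<in>U. riemannian_distance T A g p q
       \<le> ennreal ((1 + e) * tensor_norm g c (snd c p) (snd c q - snd c p))"
proof -
  let ?Z = "snd c ` fst c" and ?z0 = "snd c p"
  note chart = riemannian_chart(1)[OF R c]
  obtain r1 where r1: "0 < r1"
    "\<And>z v. z \<in> ?Z \<Longrightarrow> dist z ?z0 < r1 \<Longrightarrow> tensor_norm g c z v \<le> (1 + e) * tensor_norm g c ?z0 v"
    using tensor_norm_nearby[OF R c _ e] p by blast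
  obtain W where W: "open W" "?Z = half_space \<inter> W"
    using is_chart_range[OF chart] unfolding openin_open by blast
  obtain r2 where r2: "0 < r2" "ball ?z0 r2 \<subseteq> W" using W p openE by blast
  \<comment> \<open>\<open>r1\<close> keeps the tensor comparable with the one at p along the whole
    segment; \<open>r2\<close> keeps the segment in the open set that cuts the chart range out of
    the half-space.\<close>
  define r where "r = min r1 r2"
  define U where "U = {q \<in> fst c. snd c q \<in> ball ?z0 r}"
  have "riemannian_distance T A g p q \<le> ennreal ((1 + e) * tensor_norm g c ?z0 (snd c q - ?z0))"
    if q: "q \<in> U" for q
  proof -
    define w where "w = snd c q - ?z0"
    define z where "z t = ?z0 + t *\<^sub>R w" for t
    define \<kappa> where "\<kappa> t = inv_into (fst c) (snd c) (z t)" for t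
    have nw: "norm w < r" using q by (auto simp: U_def w_def dist_norm norm_minus_commute)
    have zr: "dist (z t) ?z0 < r" if "t \<in> {0..1}" for t
    proof -
      have "norm (t *\<^sub>R w) \<le> 1 * norm w" unfolding norm_scaleR using that by (intro mult_right_mono) auto
      then show ?thesis using nw by (simp add: z_def dist_norm)
    qed
    have zZ: "z t \<in> ?Z" if t: "t \<in> {0..1}" for t
    proof -
      have "snd c q \<in> half_space" "?z0 \<in> half_space" using q p W(2) unfolding U_def by blast+
      then have "0 \<le> (1 - t) * (?z0 \<bullet> inner_normal) + t * (snd c q \<bullet> inner_normal)"
        using t by (auto simp: half_space_def)
      then have "z t \<in> half_space"
        by (simp add: half_space_def z_def w_def inner_add_left inner_diff_left algebra_simps)
      moreover have "z t \<in> W" using r2(2) zr[OF t] by (auto simp: r_def dist_commute subset_iff)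
      ultimately show ?thesis using W(2) by blast
    qed
    have \<kappa>: "\<kappa> t \<in> fst c" "snd c (\<kappa> t) = z t" if "t \<in> {0..1}" for t
      using zZ[OF that] by (auto simp: \<kappa>_def inv_into_into f_inv_into_f)
    have zD: "(z has_vector_derivative w) (at t within S)" for t S
      unfolding z_def by (auto intro!: derivative_eq_intros)
    have "continuous_on {0..1} z" unfolding z_def by (intro continuous_intros)
    then have "continuous_map (top_of_set {0..1}) (top_of_set ?Z) z"
      using zZ by auto
    then have "continuous_map (top_of_set {0..1}) T (inv_into (fst c) (snd c) \<circ> z)"
      by (rule continuous_map_compose) (rule continuous_map_chart_inverse[OF chart])
    then have path: "pathin T \<kappa>" by (simp add: pathin_def \<kappa>_def[abs_def] comp_def)
    have smooth: "smooth_in_charts A A (topspace T) id"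
      using R unfolding riemannian_manifold_def smooth_manifold_def by blast
    \<comment> \<open>In the chart c the derivative is the constant w; all other charts are reached
      through the identity map.\<close>
    have "C1_curve_on A a b (id \<circ> \<kappa>)" if ab: "0 \<le> a" "a < b" "b \<le> 1" for a b
    proof (rule C1_curve_on_map[OF riemannian_chart(1)[OF R] riemannian_chart(1)[OF R] continuous_map_id
          smooth path ab])
      fix t assume t: "t \<in> {a..b}"
      have "((snd c \<circ> \<kappa>) has_vector_derivative w) (at s within {a..b})" if s: "s \<in> {a..b}" for s
        by (rule has_vector_derivative_transform[OF s _ zD]) (use \<kappa> ab in auto)
      then show "\<exists>c\<in>A. \<kappa> t \<in> fst c \<and> (\<exists>\<gamma>'.
        (\<forall>s\<in>{a..b}. \<kappa> s \<in> fst c \<longrightarrow> ((snd c \<circ> \<kappa>) has_vector_derivative \<gamma>' s) (at s within {a..b})) \<and>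
        continuous_on {s \<in> {a..b}. \<kappa> s \<in> fst c} \<gamma>')"
        using c \<kappa>(1)[of t] t ab by (intro bexI[of _ c] conjI exI[of _ "\<lambda>_. w"]) auto
    qed
    then have "piecewise_C1_curve T A \<kappa>"
      unfolding piecewise_C1_curve_def using path by (auto intro: exI[of _ "{}"])
    moreover have "\<kappa> 0 = p" "\<kappa> 1 = q"
      using q p inv_into_f_f[OF is_chart_inj[OF chart]] by (auto simp: \<kappa>_def z_def w_def U_def)
    ultimately have "riemannian_distance T A g p q \<le> ennreal (curve_length A g \<kappa>)"
      unfolding riemannian_distance_def by (intro INF_lower) auto
    also have "curve_length A g \<kappa> = integral {0..1} (\<lambda>t. tensor_norm g c (z t) w)"
      unfolding curve_length_def
    proof (rule integral_spike[of "{0, 1}"])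
      fix t :: real assume "t \<in> {0..1} - {0, 1}"
      then have t: "t \<in> {0<..<1}" "t \<in> {0..1}" by auto
      have "((snd c \<circ> \<kappa>) has_vector_derivative w) (at t)"
        by (rule has_vector_derivative_transform_within_open[OF zD open_greaterThanLessThan t(1)])
          (use \<kappa> in auto)
      then show "tensor_norm g c (z t) w = speed A g \<kappa> t"
        using speed_chart[OF R path t(1) c] \<kappa>[OF t(2)] by simp
    qed simp
    also have "\<dots> \<le> integral {0..1} (\<lambda>t::real. (1 + e) * tensor_norm g c ?z0 w)"
    proof (rule integral_le)
      show "(\<lambda>t. tensor_norm g c (z t) w) integrable_on {0..1}"
        unfolding tensor_norm_def
        by (intro integrable_continuous_real continuous_on_real_sqrt continuous_on_tensor[OF R c])
          (use zZ in \<open>auto simp: z_def intro!: continuous_intros\<close>)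
    qed (use zZ zr r1(2) in \<open>auto simp: r_def\<close>)
    finally show ?thesis by (simp add: w_def ennreal_leI)
  qed
  moreover have "openin T U" unfolding U_def by (rule openin_chart_preimage[OF chart]) simp
  moreover have "p \<in> U" using p r1(1) r2(1) by (auto simp: U_def r_def)
  ultimately show ?thesis by (intro that[of U]) (auto simp: U_def)
qed

text \<open>The derivative of j at p preserves lengths exactly, so with both norms frozen, at p and
  at \<open>j p\<close>, the deviation is only the first-order remainder.\<close>

lemma restricts_to_tensor_norm:
  fixes A1 :: "('a, 'e::euclidean_space) chart set" and A :: "('b, 'e) chart set"
  assumes R1: "riemannian_manifold T1 A1 g1" and R: "riemannian_manifold T A g"
    and j: "continuous_map T1 T j" "restricts_to A g j T1 A1 g1"
    and c1: "c1 \<in> A1" "p \<in> fst c1" and c: "c \<in> A" "j p \<in> fst c" and e: "0 < e"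
  obtains U where "openin T1 U" "p \<in> U" "U \<subseteq> fst c1"
    "\<forall>q\<in>U. \<bar>tensor_norm g c (snd c (j p)) (snd c (j q) - snd c (j p))
        - tensor_norm g1 c1 (snd c1 p) (snd c1 q - snd c1 p)\<bar>
      \<le> e * tensor_norm g1 c1 (snd c1 p) (snd c1 q - snd c1 p)"
proof -
  note chart1 = riemannian_chart(1)[OF R1 c1(1)] and chart = riemannian_chart(1)[OF R c(1)]
  let ?N1 = "tensor_norm g1 c1 (snd c1 p)" and ?N = "tensor_norm g c (snd c (j p))"
  interpret B1: inner_form "g1 c1 (snd c1 p)" by (rule inner_form_tensor[OF R1 c1(1)]) (use c1 in auto)
  interpret B: inner_form "g c (snd c (j p))" by (rule inner_form_tensor[OF R c(1)]) (use c in auto)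
  obtain m where m: "0 < m" "\<And>u. m * norm u \<le> ?N1 u" using B1.lower_bound unfolding tensor_norm_def by blast
  obtain M where M: "0 < M" "\<And>u. ?N u \<le> M * norm u" using B.upper_bound unfolding tensor_norm_def by blast
  have tri: "?N (u + v) \<le> ?N u + ?N v" "?N (- u) = ?N u" for u v
    using B.sqrt_triangle B.sqrt_uminus unfolding tensor_norm_def by auto
  let ?D = "local_dom c1 c (topspace T1) j" and ?f = "local_rep c1 c j" and ?x = "snd c1 p"
  obtain df where df: "(?f has_derivative df) (at ?x within ?D)" "\<And>v. ?N (df v) = ?N1 v"
    using restricts_to_derivative[OF j(2) c1(1) chart1 c(1) c1(2) c(2)] by blast
  \<comment> \<open>M turns the Euclidean remainder into a tensor norm, and 1/m turns the Euclidean
    length of the increment into \<open>?N1\<close>; this constant compensates for both.\<close>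
  have "0 < e * m / M" using e m M by simp
  then obtain r where r: "0 < r"
    "\<And>y. y \<in> ?D \<Longrightarrow> norm (y - ?x) < r \<Longrightarrow> norm (?f y - ?f ?x - df (y - ?x)) \<le> e * m / M * norm (y - ?x)"
    using df(1) unfolding has_derivative_within_alt by blast
  define U where "U = {q \<in> fst c1. snd c1 q \<in> ball ?x r} \<inter> {q \<in> topspace T1. j q \<in> fst c}"
  have "openin T1 U"
    unfolding U_def using openin_chart_preimage[OF chart1 open_ball]
      openin_continuous_map_preimage[OF j(1) is_chart_openin[OF chart]] by blast
  moreover have "p \<in> U"
    using c1(2) c(2) r(1) openin_subset[OF is_chart_openin[OF chart1]] by (auto simp: U_def)
  moreover have "\<bar>?N (snd c (j q) - snd c (j p)) - ?N1 (snd c1 q - ?x)\<bar> \<le> e * ?N1 (snd c1 q - ?x)"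
    if q: "q \<in> U" for q
  proof -
    let ?u = "snd c (j q) - snd c (j p)" and ?v = "snd c1 q - ?x"
    have q1: "q \<in> fst c1" using q by (auto simp: U_def)
    have "snd c1 q \<in> ?D" "norm ?v < r"
      using q by (auto simp: U_def local_dom_def dist_norm norm_minus_commute)
    then have "norm (?u - df ?v) \<le> e * m / M * norm ?v"
      using r(2)[of "snd c1 q"] local_rep_chart[OF chart1 q1, of c j] local_rep_chart[OF chart1 c1(2), of c j] by simp
    then have "M * norm (?u - df ?v) \<le> M * (e * m / M * norm ?v)"
      using M(1) by (intro mult_left_mono) auto
    then have "?N (?u - df ?v) \<le> e * (m * norm ?v)"
      using M by (intro order_trans[OF M(2)]) (auto simp: field_simps)
    also have "\<dots> \<le> e * ?N1 ?v" using m(2) e by (intro mult_left_mono) auto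
    finally have "?N (?u - df ?v) \<le> e * ?N1 ?v" .
    moreover have "?N ?u \<le> ?N (?u - df ?v) + ?N1 ?v"
      using tri(1)[of "?u - df ?v" "df ?v"] df(2) by simp
    moreover have "?N1 ?v \<le> ?N ?u + ?N (?u - df ?v)"
      using tri(1)[of ?u "- (?u - df ?v)"] tri(2)[of "?u - df ?v"] df(2)[of ?v] by simp
    ultimately show ?thesis by linarith
  qed
  ultimately show ?thesis by (intro that[of U]) (auto simp: U_def)
qed

text \<open>Two chords from \<open>\<gamma> t\<close>, measured by the inner product there, are
  compared with the arc between their other ends. Half of the error pays for the difference
  quotient, by which the chords may exceed the speed at t, and half for the oscillation of the
  speed, by which the arc may fall short of it.\<close>

lemma C1_curve_speed:
  fixes A :: "('a, 'e::euclidean_space) chart set"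
  assumes R: "riemannian_manifold T A g" and path: "pathin T \<gamma>"
    and ab: "0 \<le> a" "a < b" "b \<le> 1" and C1: "C1_curve_on A a b \<gamma>"
    and t: "t \<in> {a..b}" and c: "c \<in> A" "\<gamma> t \<in> fst c" and e: "0 < e"
  obtains r where "0 < r"
    "\<forall>\<alpha> \<beta>. a \<le> \<alpha> \<and> \<alpha> \<le> t \<and> t \<le> \<beta> \<and> \<beta> \<le> b \<and> \<beta> - \<alpha> < r \<longrightarrow>
      speed A g \<gamma> integrable_on {\<alpha>..\<beta>} \<and>
      tensor_norm g c (snd c (\<gamma> t)) (snd c (\<gamma> \<alpha>) - snd c (\<gamma> t)) +
      tensor_norm g c (snd c (\<gamma> t)) (snd c (\<gamma> \<beta>) - snd c (\<gamma> t))
        \<le> integral {\<alpha>..\<beta>} (speed A g \<gamma>) + e * (\<beta> - \<alpha>)"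
proof -
  note chart = riemannian_chart(1)[OF R c(1)]
  let ?N = "tensor_norm g c (snd c (\<gamma> t))"
  interpret B: inner_form "g c (snd c (\<gamma> t))" by (rule inner_form_tensor[OF R c(1)]) (use c in auto)
  obtain M where M: "0 < M" "\<And>u. ?N u \<le> M * norm u" using B.upper_bound unfolding tensor_norm_def by blast
  obtain \<gamma>' where der: "\<And>s. s \<in> {a..b} \<Longrightarrow> \<gamma> s \<in> fst c \<Longrightarrow> ((snd c \<circ> \<gamma>) has_vector_derivative \<gamma>' s) (at s within {a..b})"
    and cont: "continuous_on {s \<in> {a..b}. \<gamma> s \<in> fst c} \<gamma>'"
    using C1 c(1) unfolding C1_curve_on_def by blast
  define \<phi> where "\<phi> s = tensor_norm g c (snd c (\<gamma> s)) (\<gamma>' s)" for s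
  let ?D = "{s \<in> {a..b}. \<gamma> s \<in> fst c}"
  have "continuous_on ?D (snd c \<circ> \<gamma>)"
    unfolding continuous_on_eq_continuous_within
  proof
    fix s assume s: "s \<in> ?D"
    then have "continuous (at s within {a..b}) (snd c \<circ> \<gamma>)"
      using der has_vector_derivative_continuous by blast
    then show "continuous (at s within ?D) (snd c \<circ> \<gamma>)"
      by (rule continuous_within_subset) auto
  qed
  then have \<phi>: "continuous_on ?D \<phi>"
    unfolding \<phi>_def tensor_norm_def
    by (intro continuous_on_real_sqrt continuous_on_tensor[OF R c(1)] cont) (auto simp: comp_def)
  have tD: "t \<in> ?D" using t c(2) by auto
  obtain O' where O': "open O'" "\<forall>s\<in>{0..1}. s \<in> O' \<longleftrightarrow> \<gamma> s \<in> fst c"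
    by (rule pathin_open_preimage[OF path is_chart_openin[OF chart]]) (rule that)
  then have "t \<in> O'" using t ab c(2) by auto
  then obtain r1 where r1: "0 < r1" "ball t r1 \<subseteq> O'" using O'(1) openE by blast
  obtain r2 where r2: "0 < r2" "\<And>s. s \<in> ?D \<Longrightarrow> dist s t < r2 \<Longrightarrow> dist (\<phi> s) (\<phi> t) < e / 2"
    using \<phi> tD e unfolding continuous_on_iff by (meson half_gt_zero)
  \<comment> \<open>After multiplication by M, which bounds the tensor norm by the Euclidean one,
    e/2 is left.\<close>
  have "0 < e / (2 * M)" using e M by simp
  then obtain r3 where r3: "0 < r3"
    "\<And>s. s \<in> {a..b} \<Longrightarrow> \<bar>s - t\<bar> < r3 \<Longrightarrow>
      norm ((snd c \<circ> \<gamma>) s - (snd c \<circ> \<gamma>) t - (s - t) *\<^sub>R \<gamma>' t) \<le> e / (2 * M) * \<bar>s - t\<bar>"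
    using has_vector_derivative_norm_bound[OF der[OF t c(2)]] by blast
  define r where "r = min r1 (min r2 r3)"
  have N: "?N (snd c (\<gamma> s) - snd c (\<gamma> t)) \<le> (\<phi> t + e / 2) * \<bar>s - t\<bar>" if s: "s \<in> {a..b}" "\<bar>s - t\<bar> < r" for s
  proof -
    let ?u = "snd c (\<gamma> s) - snd c (\<gamma> t)" and ?v = "(s - t) *\<^sub>R \<gamma>' t"
    have "norm (?u - ?v) \<le> e / (2 * M) * \<bar>s - t\<bar>" using r3(2)[of s] s by (simp add: r_def)
    then have "M * norm (?u - ?v) \<le> M * (e / (2 * M) * \<bar>s - t\<bar>)" using M(1) by (intro mult_left_mono) auto
    then have "?N (?u - ?v) \<le> e / 2 * \<bar>s - t\<bar>" using M by (intro order_trans[OF M(2)]) (auto simp: field_simps)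
    moreover have "?N ((?u - ?v) + ?v) \<le> ?N (?u - ?v) + ?N ?v"
      unfolding tensor_norm_def by (rule B.sqrt_triangle)
    moreover have "?N ?v = \<bar>s - t\<bar> * \<phi> t"
      unfolding \<phi>_def tensor_norm_def by (rule B.sqrt_scale)
    ultimately show ?thesis by (simp add: algebra_simps)
  qed
  have "speed A g \<gamma> integrable_on {\<alpha>..\<beta>} \<and>
      ?N (snd c (\<gamma> \<alpha>) - snd c (\<gamma> t)) + ?N (snd c (\<gamma> \<beta>) - snd c (\<gamma> t))
        \<le> integral {\<alpha>..\<beta>} (speed A g \<gamma>) + e * (\<beta> - \<alpha>)"
    if I: "a \<le> \<alpha>" "\<alpha> \<le> t" "t \<le> \<beta>" "\<beta> \<le> b" "\<beta> - \<alpha> < r" for \<alpha> \<beta>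
  proof -
    have near: "s \<in> ?D" "\<bar>s - t\<bar> < r" if s: "s \<in> {\<alpha>..\<beta>}" for s
    proof -
      show st: "\<bar>s - t\<bar> < r" using s I by auto
      then have "s \<in> O'" using r1(2) by (auto simp: r_def dist_real_def abs_minus_commute subset_iff)
      then show "s \<in> ?D" using bspec[OF O'(2), of s] s I ab by auto
    qed
    \<comment> \<open>The end points are left out: \<open>\<gamma>'\<close> is a derivative within
      [a, b], whereas \<open>speed\<close> uses the two-sided one, which may fail to exist
      there.\<close>
    have eq: "speed A g \<gamma> s = \<phi> s" if s: "s \<in> {\<alpha>..\<beta>} - {\<alpha>, \<beta>}" for s
    proof -
      have "at s within {a..b} = at s" using s I by (intro at_within_interior) auto
      then have "((snd c \<circ> \<gamma>) has_vector_derivative \<gamma>' s) (at s)"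
        using der[of s] near(1)[of s] s by auto
      then show ?thesis
        unfolding \<phi>_def using s I ab near(1)[of s] by (intro speed_chart[OF R path _ c(1)]) auto
    qed
    have "continuous_on {\<alpha>..\<beta>} \<phi>" by (rule continuous_on_subset[OF \<phi>]) (use near in auto)
    then have int: "\<phi> integrable_on {\<alpha>..\<beta>}" by (rule integrable_continuous_real)
    have "speed A g \<gamma> integrable_on {\<alpha>..\<beta>}"
      by (rule integrable_spike_finite[of "{\<alpha>, \<beta>}", OF _ eq int]) auto
    moreover have "integral {\<alpha>..\<beta>} (speed A g \<gamma>) = integral {\<alpha>..\<beta>} \<phi>"
      by (rule integral_spike[of "{\<alpha>, \<beta>}"]) (use eq in auto)
    moreover have "(\<phi> t - e / 2) * (\<beta> - \<alpha>) \<le> integral {\<alpha>..\<beta>} \<phi>"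
    proof -
      have "integral {\<alpha>..\<beta>} (\<lambda>s. \<phi> t - e / 2) \<le> integral {\<alpha>..\<beta>} \<phi>"
      proof (rule integral_le[OF _ int])
        fix s assume s: "s \<in> {\<alpha>..\<beta>}"
        have "dist (\<phi> s) (\<phi> t) < e / 2"
          using r2(2)[OF near(1)[OF s]] near(2)[OF s] by (auto simp: r_def dist_real_def)
        then show "\<phi> t - e / 2 \<le> \<phi> s" unfolding dist_real_def by linarith
      qed auto
      then show ?thesis using I by (simp add: mult.commute)
    qed
    moreover have "?N (snd c (\<gamma> \<alpha>) - snd c (\<gamma> t)) + ?N (snd c (\<gamma> \<beta>) - snd c (\<gamma> t))
        \<le> (\<phi> t + e / 2) * (\<beta> - \<alpha>)"
    proof -
      have "?N (snd c (\<gamma> \<alpha>) - snd c (\<gamma> t)) \<le> (\<phi> t + e / 2) * (t - \<alpha>)"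
        "?N (snd c (\<gamma> \<beta>) - snd c (\<gamma> t)) \<le> (\<phi> t + e / 2) * (\<beta> - t)"
        using N[of \<alpha>] N[of \<beta>] I ab by auto
      moreover have "(\<phi> t + e / 2) * (t - \<alpha>) + (\<phi> t + e / 2) * (\<beta> - t) = (\<phi> t + e / 2) * (\<beta> - \<alpha>)"
        by (simp flip: distrib_left)
      ultimately show ?thesis by linarith
    qed
    moreover have "(\<phi> t + e / 2) * (\<beta> - \<alpha>) = (\<phi> t - e / 2) * (\<beta> - \<alpha>) + e * (\<beta> - \<alpha>)"
      by (simp add: field_simps)
    ultimately show ?thesis by linarith
  qed
  then show ?thesis using r1(1) r2(1) r3(1) by (intro that[of r]) (auto simp: r_def)
qed

text \<open>Since t may be a break point, the C1 estimate is applied on each side of t separately,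
  with t as an end point, where its own chord has norm 0; the two estimates are then added.\<close>

lemma piecewise_C1_curve_speed:
  fixes A :: "('a, 'e::euclidean_space) chart set"
  assumes R: "riemannian_manifold T A g" and \<gamma>: "piecewise_C1_curve T A \<gamma>"
    and t: "t \<in> {0..1}" and c: "c \<in> A" "\<gamma> t \<in> fst c" and e: "0 < e"
  obtains r where "0 < r"
    "\<forall>\<alpha> \<beta>. 0 \<le> \<alpha> \<and> \<alpha> \<le> t \<and> t \<le> \<beta> \<and> \<beta> \<le> 1 \<and> \<beta> - \<alpha> < r \<longrightarrow>
      speed A g \<gamma> integrable_on {\<alpha>..\<beta>} \<and>
      tensor_norm g c (snd c (\<gamma> t)) (snd c (\<gamma> \<alpha>) - snd c (\<gamma> t)) +
      tensor_norm g c (snd c (\<gamma> t)) (snd c (\<gamma> \<beta>) - snd c (\<gamma> t))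
        \<le> integral {\<alpha>..\<beta>} (speed A g \<gamma>) + e * (\<beta> - \<alpha>)"
proof -
  let ?N = "\<lambda>s. tensor_norm g c (snd c (\<gamma> t)) (snd c (\<gamma> s) - snd c (\<gamma> t))"
  have N: "?N t = 0" using tensor_norm_zero[OF R c] by simp
  obtain P where P: "finite P"
    "\<And>a b. 0 \<le> a \<Longrightarrow> a < b \<Longrightarrow> b \<le> 1 \<Longrightarrow> {a<..<b} \<inter> P = {} \<Longrightarrow> C1_curve_on A a b \<gamma>"
    and path: "pathin T \<gamma>"
    using \<gamma> unfolding piecewise_C1_curve_def by blast
  obtain d where d: "0 < d" "{t<..<t + d} \<inter> P = {}" "{t - d<..<t} \<inter> P = {}"
    by (rule finite_avoids_punctured_interval[OF P(1)]) (rule that)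
  have "\<exists>r>0. \<forall>\<beta>. t \<le> \<beta> \<and> \<beta> \<le> 1 \<and> \<beta> - t < r \<longrightarrow> speed A g \<gamma> integrable_on {t..\<beta>} \<and>
      ?N \<beta> \<le> integral {t..\<beta>} (speed A g \<gamma>) + e * (\<beta> - t)"
  proof (cases "t = 1")
    \<comment> \<open>Nothing lies to the right of 1: only \<beta> = t remains, and all terms
      vanish.\<close>
    case True
    show ?thesis
    proof (intro exI[of _ 1] conjI allI impI)
      fix \<beta> assume "t \<le> \<beta> \<and> \<beta> \<le> 1 \<and> \<beta> - t < 1"
      then have "\<beta> = t" using True by linarith
      then show "speed A g \<gamma> integrable_on {t..\<beta>}" "?N \<beta> \<le> integral {t..\<beta>} (speed A g \<gamma>) + e * (\<beta> - t)"
        using N integrable_on_refl[of "speed A g \<gamma>" t] by auto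
    qed simp
  next
    case False
    define b where "b = min 1 (t + d)"
    have b: "0 \<le> t" "t < b" "b \<le> 1" "{t<..<b} \<inter> P = {}" using False t d by (auto simp: b_def)
    obtain r where r: "0 < r" "\<forall>\<alpha> \<beta>. t \<le> \<alpha> \<and> \<alpha> \<le> t \<and> t \<le> \<beta> \<and> \<beta> \<le> b \<and> \<beta> - \<alpha> < r \<longrightarrow>
      speed A g \<gamma> integrable_on {\<alpha>..\<beta>} \<and> ?N \<alpha> + ?N \<beta> \<le> integral {\<alpha>..\<beta>} (speed A g \<gamma>) + e * (\<beta> - \<alpha>)"
      by (rule C1_curve_speed[OF R path b(1-3) P(2)[OF b] _ c e]) (use b(2) that in auto)
    show ?thesis
    proof (intro exI[of _ "min r (b - t)"] conjI allI impI)
      fix \<beta> assume "t \<le> \<beta> \<and> \<beta> \<le> 1 \<and> \<beta> - t < min r (b - t)"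
      then show "speed A g \<gamma> integrable_on {t..\<beta>}" "?N \<beta> \<le> integral {t..\<beta>} (speed A g \<gamma>) + e * (\<beta> - t)"
        using r(2)[THEN spec, THEN spec, of t \<beta>] N by auto
    qed (use r(1) b(2) in auto)
  qed
  then obtain r1 where r1: "0 < r1" "\<And>\<beta>. t \<le> \<beta> \<Longrightarrow> \<beta> \<le> 1 \<Longrightarrow> \<beta> - t < r1 \<Longrightarrow> speed A g \<gamma> integrable_on {t..\<beta>}"
    "\<And>\<beta>. t \<le> \<beta> \<Longrightarrow> \<beta> \<le> 1 \<Longrightarrow> \<beta> - t < r1 \<Longrightarrow> ?N \<beta> \<le> integral {t..\<beta>} (speed A g \<gamma>) + e * (\<beta> - t)"
    by blast
  have "\<exists>r>0. \<forall>\<alpha>. 0 \<le> \<alpha> \<and> \<alpha> \<le> t \<and> t - \<alpha> < r \<longrightarrow> speed A g \<gamma> integrable_on {\<alpha>..t} \<and>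
      ?N \<alpha> \<le> integral {\<alpha>..t} (speed A g \<gamma>) + e * (t - \<alpha>)"
  proof (cases "t = 0")
    case True
    show ?thesis
    proof (intro exI[of _ 1] conjI allI impI)
      fix \<alpha> assume "0 \<le> \<alpha> \<and> \<alpha> \<le> t \<and> t - \<alpha> < 1"
      then have "\<alpha> = t" using True by linarith
      then show "speed A g \<gamma> integrable_on {\<alpha>..t}" "?N \<alpha> \<le> integral {\<alpha>..t} (speed A g \<gamma>) + e * (t - \<alpha>)"
        using N integrable_on_refl[of "speed A g \<gamma>" t] by auto
    qed simp
  next
    case False
    define a where "a = max 0 (t - d)"
    have a: "0 \<le> a" "a < t" "t \<le> 1" "{a<..<t} \<inter> P = {}" using False t d by (auto simp: a_def)
    obtain r where r: "0 < r" "\<forall>\<alpha> \<beta>. a \<le> \<alpha> \<and> \<alpha> \<le> t \<and> t \<le> \<beta> \<and> \<beta> \<le> t \<and> \<beta> - \<alpha> < r \<longrightarrow>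
      speed A g \<gamma> integrable_on {\<alpha>..\<beta>} \<and> ?N \<alpha> + ?N \<beta> \<le> integral {\<alpha>..\<beta>} (speed A g \<gamma>) + e * (\<beta> - \<alpha>)"
      by (rule C1_curve_speed[OF R path a(1-3) P(2)[OF a] _ c e]) (use a(2) that in auto)
    show ?thesis
    proof (intro exI[of _ "min r (t - a)"] conjI allI impI)
      fix \<alpha> assume "0 \<le> \<alpha> \<and> \<alpha> \<le> t \<and> t - \<alpha> < min r (t - a)"
      then show "speed A g \<gamma> integrable_on {\<alpha>..t}" "?N \<alpha> \<le> integral {\<alpha>..t} (speed A g \<gamma>) + e * (t - \<alpha>)"
        using r(2)[THEN spec, THEN spec, of \<alpha> t] N by auto
    qed (use r(1) a(2) in auto)
  qed
  then obtain r2 where r2: "0 < r2" "\<And>\<alpha>. 0 \<le> \<alpha> \<Longrightarrow> \<alpha> \<le> t \<Longrightarrow> t - \<alpha> < r2 \<Longrightarrow> speed A g \<gamma> integrable_on {\<alpha>..t}"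
    "\<And>\<alpha>. 0 \<le> \<alpha> \<Longrightarrow> \<alpha> \<le> t \<Longrightarrow> t - \<alpha> < r2 \<Longrightarrow> ?N \<alpha> \<le> integral {\<alpha>..t} (speed A g \<gamma>) + e * (t - \<alpha>)"
    by blast
  have "speed A g \<gamma> integrable_on {\<alpha>..\<beta>} \<and> ?N \<alpha> + ?N \<beta> \<le> integral {\<alpha>..\<beta>} (speed A g \<gamma>) + e * (\<beta> - \<alpha>)"
    if I: "0 \<le> \<alpha>" "\<alpha> \<le> t" "t \<le> \<beta>" "\<beta> \<le> 1" "\<beta> - \<alpha> < min r1 r2" for \<alpha> \<beta>
  proof -
    have d: "t - \<alpha> < r2" "\<beta> - t < r1" using I by auto
    have int: "speed A g \<gamma> integrable_on {\<alpha>..\<beta>}"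
      by (rule Henstock_Kurzweil_Integration.integrable_combine[OF I(2,3) r2(2)[OF I(1,2) d(1)] r1(2)[OF I(3,4) d(2)]])
    show ?thesis
      using r2(3)[OF I(1,2) d(1)] r1(3)[OF I(3,4) d(2)] int
        Henstock_Kurzweil_Integration.integral_combine[OF I(2,3) int] by (simp add: algebra_simps)
  qed
  then show ?thesis using r1(1) r2(1) by (intro that[of "min r1 r2"]) auto
qed

text \<open>The factor \<open>1 + e\<close> is only required near each \<open>t\<close>, against the fixed norm at \<open>\<gamma> t\<close>; bisection
  (\<open>Bolzano\<close>) turns this into a bound on the whole curve.\<close>

lemma curve_length_bound:
  fixes A :: "('a, 'e::euclidean_space) chart set" and E :: "real \<Rightarrow> real \<Rightarrow> ennreal"
  assumes R: "riemannian_manifold T A g" and \<gamma>: "piecewise_C1_curve T A \<gamma>"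
    and sym: "\<And>s t. s \<in> {0..1} \<Longrightarrow> t \<in> {0..1} \<Longrightarrow> E s t = E t s"
    and tri: "\<And>r s t. r \<in> {0..1} \<Longrightarrow> s \<in> {0..1} \<Longrightarrow> t \<in> {0..1} \<Longrightarrow> E r t \<le> E r s + E s t"
    and loc: "\<And>t c e. t \<in> {0..1} \<Longrightarrow> c \<in> A \<Longrightarrow> \<gamma> t \<in> fst c \<Longrightarrow> 0 < e \<Longrightarrow>
      \<exists>r>0. \<forall>s\<in>{0..1}. \<bar>s - t\<bar> < r \<longrightarrow>
        E s t \<le> ennreal ((1 + e) * tensor_norm g c (snd c (\<gamma> t)) (snd c (\<gamma> s) - snd c (\<gamma> t)))"
  shows "E 0 1 \<le> ennreal (curve_length A g \<gamma>)"
proof -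
  have path: "pathin T \<gamma>" using \<gamma> unfolding piecewise_C1_curve_def by blast
  have nonneg: "0 \<le> integral {\<alpha>..\<beta>} (speed A g \<gamma>)" if "0 \<le> \<alpha>" "\<beta> \<le> 1" "speed A g \<gamma> integrable_on {\<alpha>..\<beta>}" for \<alpha> \<beta>
    using that speed_nonneg[OF R path] by (intro integral_nonneg) auto
  have bound: "speed A g \<gamma> integrable_on {0..1} \<and>
      E 0 1 \<le> ennreal ((1 + e) * (curve_length A g \<gamma> + e))" if e: "0 < e" for e
  proof -
    \<comment> \<open>\<open>Bolzano\<close> asks for all short intervals around t, even those
      leaving [0, 1]; the guard makes \<open>P\<close> trivial on these. Integrability is carried
      along so that integrals over adjacent intervals can be added; without it
      \<open>integral\<close> would only have its default value 0.\<close>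
    define P where "P \<alpha> \<beta> \<longleftrightarrow> (0 \<le> \<alpha> \<and> \<beta> \<le> 1 \<longrightarrow> speed A g \<gamma> integrable_on {\<alpha>..\<beta>} \<and>
      E \<alpha> \<beta> \<le> ennreal ((1 + e) * (integral {\<alpha>..\<beta>} (speed A g \<gamma>) + e * (\<beta> - \<alpha>))))" for \<alpha> \<beta>
    have "P 0 1"
    proof (rule Bolzano)
      fix \<alpha> t \<beta> assume P: "P \<alpha> t" "P t \<beta>" and le: "\<alpha> \<le> t" "t \<le> \<beta>"
      show "P \<alpha> \<beta>"
        unfolding P_def
      proof (intro impI, elim conjE)
        assume I: "0 \<le> \<alpha>" "\<beta> \<le> 1"
        then have int: "speed A g \<gamma> integrable_on {\<alpha>..t}" "speed A g \<gamma> integrable_on {t..\<beta>}"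
          and E: "E \<alpha> t \<le> ennreal ((1 + e) * (integral {\<alpha>..t} (speed A g \<gamma>) + e * (t - \<alpha>)))"
            "E t \<beta> \<le> ennreal ((1 + e) * (integral {t..\<beta>} (speed A g \<gamma>) + e * (\<beta> - t)))"
          using P le unfolding P_def by auto
        have int': "speed A g \<gamma> integrable_on {\<alpha>..\<beta>}" by (rule Henstock_Kurzweil_Integration.integrable_combine[OF le int])
        have "E \<alpha> \<beta> \<le> E \<alpha> t + E t \<beta>" using I le by (intro tri) auto
        also have "\<dots> \<le> ennreal ((1 + e) * (integral {\<alpha>..t} (speed A g \<gamma>) + e * (t - \<alpha>)))
            + ennreal ((1 + e) * (integral {t..\<beta>} (speed A g \<gamma>) + e * (\<beta> - t)))"
          by (intro add_mono E)
        also have "\<dots> = ennreal ((1 + e) * (integral {\<alpha>..t} (speed A g \<gamma>) + e * (t - \<alpha>))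
            + (1 + e) * (integral {t..\<beta>} (speed A g \<gamma>) + e * (\<beta> - t)))"
          using nonneg[OF _ _ int(1)] nonneg[OF _ _ int(2)] e I le by (intro ennreal_plus[symmetric]) auto
        also have "(1 + e) * (integral {\<alpha>..t} (speed A g \<gamma>) + e * (t - \<alpha>))
            + (1 + e) * (integral {t..\<beta>} (speed A g \<gamma>) + e * (\<beta> - t))
            = (1 + e) * (integral {\<alpha>..\<beta>} (speed A g \<gamma>) + e * (\<beta> - \<alpha>))"
          unfolding Henstock_Kurzweil_Integration.integral_combine[OF le int', symmetric]
          by (simp add: algebra_simps)
        finally show "speed A g \<gamma> integrable_on {\<alpha>..\<beta>} \<and>
          E \<alpha> \<beta> \<le> ennreal ((1 + e) * (integral {\<alpha>..\<beta>} (speed A g \<gamma>) + e * (\<beta> - \<alpha>)))"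
          using int' by blast
      qed
    next
      fix t :: real assume "0 \<le> t" "t \<le> 1"
      then have t: "t \<in> {0..1}" by auto
      obtain c where c: "c \<in> A" "\<gamma> t \<in> fst c"
        using riemannian_chart(2)[OF R pathin_imp_topspace[OF path t]] by blast
      let ?N = "\<lambda>s. tensor_norm g c (snd c (\<gamma> t)) (snd c (\<gamma> s) - snd c (\<gamma> t))"
      note N = tensor_norm_nonneg[OF R c]
      obtain r1 where r1: "0 < r1" "\<And>s. s \<in> {0..1} \<Longrightarrow> \<bar>s - t\<bar> < r1 \<Longrightarrow> E s t \<le> ennreal ((1 + e) * ?N s)"
        using loc[OF t c e] by blast
      obtain r2 where r2: "0 < r2" "\<forall>\<alpha> \<beta>. 0 \<le> \<alpha> \<and> \<alpha> \<le> t \<and> t \<le> \<beta> \<and> \<beta> \<le> 1 \<and> \<beta> - \<alpha> < r2 \<longrightarrow>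
        speed A g \<gamma> integrable_on {\<alpha>..\<beta>} \<and> ?N \<alpha> + ?N \<beta> \<le> integral {\<alpha>..\<beta>} (speed A g \<gamma>) + e * (\<beta> - \<alpha>)"
        by (rule piecewise_C1_curve_speed[OF R \<gamma> t c e]) (rule that)
      have "P \<alpha> \<beta>" if I: "\<alpha> \<le> t" "t \<le> \<beta>" "\<beta> - \<alpha> < min r1 r2" for \<alpha> \<beta>
        unfolding P_def
      proof (intro impI, elim conjE)
        assume J: "0 \<le> \<alpha>" "\<beta> \<le> 1"
        have *: "speed A g \<gamma> integrable_on {\<alpha>..\<beta>}" "?N \<alpha> + ?N \<beta> \<le> integral {\<alpha>..\<beta>} (speed A g \<gamma>) + e * (\<beta> - \<alpha>)"
          using r2(2) I J by auto
        have "E \<alpha> \<beta> \<le> E \<alpha> t + E \<beta> t"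
          using I J t tri[of \<alpha> t \<beta>] sym[of t \<beta>] by auto
        also have "\<dots> \<le> ennreal ((1 + e) * ?N \<alpha>) + ennreal ((1 + e) * ?N \<beta>)"
          using I J t by (intro add_mono r1(2)) auto
        also have "\<dots> = ennreal ((1 + e) * (?N \<alpha> + ?N \<beta>))"
          using N e by (simp add: distrib_left flip: ennreal_plus)
        also have "\<dots> \<le> ennreal ((1 + e) * (integral {\<alpha>..\<beta>} (speed A g \<gamma>) + e * (\<beta> - \<alpha>)))"
          using *(2) e by (intro ennreal_leI mult_left_mono) auto
        finally show "speed A g \<gamma> integrable_on {\<alpha>..\<beta>} \<and>
          E \<alpha> \<beta> \<le> ennreal ((1 + e) * (integral {\<alpha>..\<beta>} (speed A g \<gamma>) + e * (\<beta> - \<alpha>)))"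
          using *(1) by blast
      qed
      then show "\<exists>d>0. \<forall>\<alpha> \<beta>. \<alpha> \<le> t \<and> t \<le> \<beta> \<and> \<beta> - \<alpha> < d \<longrightarrow> P \<alpha> \<beta>"
        using r1(1) r2(1) by (intro exI[of _ "min r1 r2"]) auto
    qed simp
    then show ?thesis unfolding P_def curve_length_def by simp
  qed
  define L where "L = curve_length A g \<gamma>"
  have "0 \<le> L" unfolding L_def curve_length_def using bound[of 1] by (intro nonneg) auto
  show ?thesis
    unfolding L_def[symmetric]
  proof (rule ennreal_le_epsilon)
    fix e :: real assume e: "0 < e"
    \<comment> \<open>The cap 1 bounds L + 1 + e' by L + 2, whence the denominator.\<close>
    define e' where "e' = min 1 (e / (L + 2))"
    have e': "0 < e'" "e' \<le> 1" "e' \<le> e / (L + 2)"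
      using e \<open>0 \<le> L\<close> by (auto simp: e'_def)
    then have "e' * (L + 2) \<le> e" using \<open>0 \<le> L\<close> by (simp add: pos_le_divide_eq)
    have "(1 + e') * (L + e') = L + e' * (L + 1 + e')" by (simp add: algebra_simps)
    also have "\<dots> \<le> L + e' * (L + 2)" using e' by (intro add_left_mono mult_left_mono) auto
    finally have "(1 + e') * (L + e') \<le> L + e" using \<open>e' * (L + 2) \<le> e\<close> by linarith
    then have "E 0 1 \<le> ennreal (L + e)"
      using bound[OF e'(1)] unfolding L_def[symmetric] by (meson ennreal_leI order_trans)
    then show "E 0 1 \<le> ennreal L + ennreal e"
      using e \<open>0 \<le> L\<close> by (simp add: ennreal_plus)
  qed
qed

text \<open>The chart bound is evaluated at x itself, where the coordinate difference is 0 and the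
  segment degenerates to a constant curve.\<close>

lemma riemannian_distance_self:
  fixes A :: "('a, 'e::euclidean_space) chart set"
  assumes R: "riemannian_manifold T A g" and x: "x \<in> topspace T"
  shows "riemannian_distance T A g x x = 0"
proof -
  obtain c where c: "c \<in> A" "x \<in> fst c" using riemannian_chart(2)[OF R x] by blast
  obtain U where "x \<in> U" "\<forall>q\<in>U. riemannian_distance T A g x q
      \<le> ennreal ((1 + 1) * tensor_norm g c (snd c x) (snd c q - snd c x))"
    by (rule riemannian_distance_le_chart[OF R c zero_less_one]) (rule that)
  then show ?thesis using tensor_norm_zero[OF R c] by force
qed

text \<open>If \<open>\<gamma> t\<close> is outside the closed image of j, so are all nearby points,
  and nothing is to be shown. Otherwise closedness and injectivity force the preimages q of nearby
  points into any given neighbourhood of p, where the chart bound for the distance and the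
  first-order comparison of norms combine.\<close>

lemma closed_embedding_local_bound:
  fixes A1 :: "('a, 'e::euclidean_space) chart set" and A :: "('b, 'e) chart set"
  assumes R1: "riemannian_manifold T1 A1 g1" and R: "riemannian_manifold T A g"
    and j: "continuous_map T1 T j" "restricts_to A g j T1 A1 g1"
    and emb: "closed_map T1 T j" "inj_on j (topspace T1)"
    and \<gamma>: "pathin T \<gamma>" and t: "t \<in> {0..1}" and c: "c \<in> A" "\<gamma> t \<in> fst c" and e: "0 < e"
  obtains r where "0 < r"
    "\<And>s q. s \<in> {0..1} \<Longrightarrow> \<bar>s - t\<bar> < r \<Longrightarrow> q \<in> topspace T1 \<Longrightarrow> j q = \<gamma> s \<Longrightarrow>
      \<exists>p\<in>topspace T1. j p = \<gamma> t \<and> riemannian_distance T1 A1 g1 p q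
        \<le> ennreal ((1 + e) * tensor_norm g c (snd c (\<gamma> t)) (snd c (\<gamma> s) - snd c (\<gamma> t)))"
proof -
  have near: "\<exists>r>0. \<forall>s\<in>{0..1}. \<bar>s - t\<bar> < r \<longrightarrow> \<gamma> s \<notin> j ` (topspace T1 - U)"
    if U: "openin T1 U" "\<gamma> t \<notin> j ` (topspace T1 - U)" for U
  proof -
    have "closedin T (j ` (topspace T1 - U))"
      using emb(1) U(1) unfolding closed_map_def by (simp add: closedin_diff)
    then have "openin T (topspace T - j ` (topspace T1 - U))" by (simp add: closedin_def)
    then obtain O' where O': "open O'" "\<forall>s\<in>{0..1}. s \<in> O' \<longleftrightarrow> \<gamma> s \<in> topspace T - j ` (topspace T1 - U)"
      by (rule pathin_open_preimage[OF \<gamma>]) (rule that)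
    then have "t \<in> O'" using t U(2) pathin_imp_topspace[OF \<gamma>] by auto
    then obtain r where "0 < r" "ball t r \<subseteq> O'" using O'(1) openE by blast
    then show ?thesis
      using O'(2) by (intro exI[of _ r]) (auto simp: dist_real_def abs_minus_commute subset_iff)
  qed
  show ?thesis
  proof (cases "\<gamma> t \<in> j ` topspace T1")
    case False
    then obtain r where "0 < r" "\<forall>s\<in>{0..1}. \<bar>s - t\<bar> < r \<longrightarrow> \<gamma> s \<notin> j ` topspace T1"
      using near[of "{}"] by auto
    then show ?thesis by (intro that[of r]) force+
  next
    case True
    then obtain p where p: "p \<in> topspace T1" "j p = \<gamma> t" by auto
    obtain c1 where c1: "c1 \<in> A1" "p \<in> fst c1" using riemannian_chart(2)[OF R1 p(1)] by blast
    let ?N1 = "\<lambda>q. tensor_norm g1 c1 (snd c1 p) (snd c1 q - snd c1 p)"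
    let ?N = "\<lambda>q. tensor_norm g c (snd c (j p)) (snd c (j q) - snd c (j p))"
    \<comment> \<open>Solution of 1 + e' = (1 + e) (1 - e'): the chart bound costs the factor 1 +
      e', and passing from \<open>?N1\<close> to \<open>?N\<close> costs a division by 1 -
      e'.\<close>
    define e' where "e' = e / (2 + e)"
    have e': "0 < e'" "1 + e' = (1 + e) * (1 - e')" using e by (auto simp: e'_def field_simps)
    obtain U1 where U1: "openin T1 U1" "p \<in> U1" "U1 \<subseteq> fst c1"
      "\<forall>q\<in>U1. riemannian_distance T1 A1 g1 p q \<le> ennreal ((1 + e') * ?N1 q)"
      by (rule riemannian_distance_le_chart[OF R1 c1 e'(1)]) (rule that)
    have jp: "j p \<in> fst c" using c(2) p(2) by simp
    obtain U2 where U2: "openin T1 U2" "p \<in> U2" "U2 \<subseteq> fst c1" "\<forall>q\<in>U2. \<bar>?N q - ?N1 q\<bar> \<le> e' * ?N1 q"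
      by (rule restricts_to_tensor_norm[OF R1 R j c1 c(1) jp e'(1)]) (rule that)
    have "\<gamma> t \<notin> j ` (topspace T1 - U1 \<inter> U2)"
    proof
      assume "\<gamma> t \<in> j ` (topspace T1 - U1 \<inter> U2)"
      then obtain q where q: "\<gamma> t = j q" "q \<in> topspace T1 - U1 \<inter> U2" by (rule imageE) (rule that)
      then have "j q = j p" "q \<in> topspace T1" using p(2) by simp_all
      then have "q = p" using emb(2) p(1) by (simp add: inj_on_eq_iff)
      then show False using q(2) U1(2) U2(2) by blast
    qed
    then obtain r where r: "0 < r" "\<forall>s\<in>{0..1}. \<bar>s - t\<bar> < r \<longrightarrow> \<gamma> s \<notin> j ` (topspace T1 - U1 \<inter> U2)"
      using near[OF openin_Int[OF U1(1) U2(1)]] by blast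
    show ?thesis
    proof (rule that[OF r(1)])
      fix s q assume s: "s \<in> {0..1}" "\<bar>s - t\<bar> < r" and q: "q \<in> topspace T1" "j q = \<gamma> s"
      have "j q \<notin> j ` (topspace T1 - U1 \<inter> U2)" using r(2) s q(2) by simp
      then have qU: "q \<in> U1" "q \<in> U2" using q(1) by blast+
      have "(1 + e') * ?N1 q = (1 + e) * ((1 - e') * ?N1 q)" using e'(2) by simp
      also have "\<dots> \<le> (1 + e) * ?N q"
      proof (rule mult_left_mono)
        have "?N1 q - e' * ?N1 q \<le> ?N q" using bspec[OF U2(4) qU(2)] by linarith
        then show "(1 - e') * ?N1 q \<le> ?N q" by (simp add: algebra_simps)
      qed (use e in auto)
      finally have "riemannian_distance T1 A1 g1 p q \<le> ennreal ((1 + e) * ?N q)"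
        using bspec[OF U1(4) qU(1)] ennreal_leI order_trans by blast
      then show "\<exists>p\<in>topspace T1. j p = \<gamma> t \<and> riemannian_distance T1 A1 g1 p q
        \<le> ennreal ((1 + e) * tensor_norm g c (snd c (\<gamma> t)) (snd c (\<gamma> s) - snd c (\<gamma> t)))"
        using p q by auto
    qed
  qed
qed

text \<open>The equivalence is proved for \<open>has_integral\<close>, so that functions without an
  integral are covered too: both sides then have the default value.\<close>

lemma integral_reflect01:
  fixes f :: "real \<Rightarrow> real"
  shows "integral {0..1} (\<lambda>t. f (1 - t)) = integral {0..1} f"
proof -
  have *: "((\<lambda>t. f (1 - t)) has_integral i) {0..1}" if "(f has_integral i) {0..1}" for f :: "real \<Rightarrow> real" and i
  proof -
    have "((\<lambda>t. f ((- 1) *\<^sub>R t + 1)) has_integral (1 / (\<bar>- 1\<bar> ^ DIM(real))) *\<^sub>R i)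
      ((\<lambda>t. (1 / - 1) *\<^sub>R t + - ((1 / - 1) *\<^sub>R 1)) ` cbox 0 (1::real))"
      using that by (intro has_integral_affinity) auto
    moreover have "(\<lambda>t. (1 / - 1) *\<^sub>R t + - ((1 / - 1) *\<^sub>R 1)) ` cbox 0 (1::real) = {0..1}"
    proof -
      have "(\<lambda>t::real. 1 - t) ` {0..1} = {0..1}" by simp
      then show ?thesis by (simp add: add.commute)
    qed
    ultimately show ?thesis by (simp add: add.commute)
  qed
  have "((\<lambda>t. f (1 - t)) has_integral i) {0..1} \<longleftrightarrow> (f has_integral i) {0..1}" for i
    using *[of f i] *[of "\<lambda>t. f (1 - t)" i] by auto
  then show ?thesis by (simp add: integral_def integrable_on_def)
qed

text \<open>Reversal negates the velocity, which does not change its length.\<close>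

lemma piecewise_C1_curve_reverse:
  fixes A :: "('a, 'e::euclidean_space) chart set"
  assumes R: "riemannian_manifold T A g" and \<gamma>: "piecewise_C1_curve T A \<gamma>"
  shows "piecewise_C1_curve T A (\<gamma> \<circ> (\<lambda>t. 1 - t))"
    and "curve_length A g (\<gamma> \<circ> (\<lambda>t. 1 - t)) = curve_length A g \<gamma>"
proof -
  let ?rev = "\<lambda>t::real. 1 - t"
  obtain P where P: "finite P"
    "\<And>a b. 0 \<le> a \<Longrightarrow> a < b \<Longrightarrow> b \<le> 1 \<Longrightarrow> {a<..<b} \<inter> P = {} \<Longrightarrow> C1_curve_on A a b \<gamma>"
    and p: "pathin T \<gamma>"
    using \<gamma> unfolding piecewise_C1_curve_def by blast
  have "continuous_map (top_of_set {0..1}) (top_of_set {0..1::real}) ?rev"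
    by (auto intro!: continuous_intros)
  then have p': "pathin T (\<gamma> \<circ> ?rev)"
    using p unfolding pathin_def by (rule continuous_map_compose)
  have rev_D: "(?rev has_vector_derivative -1) (at t within S)" for t S
    by (auto intro!: derivative_eq_intros)
  have "C1_curve_on A a b (\<gamma> \<circ> ?rev)"
    if ab: "0 \<le> a" "a < b" "b \<le> 1" "{a<..<b} \<inter> ?rev ` P = {}" for a b
    unfolding C1_curve_on_def
  proof
    fix c assume c: "c \<in> A"
    have "x \<notin> P" if x: "x \<in> {1 - b<..<1 - a}" for x
    proof
      assume "x \<in> P"
      then have "?rev x \<in> {a<..<b} \<inter> ?rev ` P" using x by auto
      then show False using ab(4) by blast
    qed
    then have "{1 - b<..<1 - a} \<inter> P = {}" by blast
    then have "C1_curve_on A (1 - b) (1 - a) \<gamma>" using ab by (intro P(2)) auto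
    then obtain \<gamma>' where der: "\<And>t. t \<in> {1 - b..1 - a} \<Longrightarrow> \<gamma> t \<in> fst c \<Longrightarrow>
        ((snd c \<circ> \<gamma>) has_vector_derivative \<gamma>' t) (at t within {1 - b..1 - a})"
      and cont: "continuous_on {t \<in> {1 - b..1 - a}. \<gamma> t \<in> fst c} \<gamma>'"
      unfolding C1_curve_on_def using c by blast
    have im: "?rev ` {a..b} = {1 - b..1 - a}" by auto
    have "((snd c \<circ> \<gamma> \<circ> ?rev) has_vector_derivative (-1) *\<^sub>R \<gamma>' (1 - t)) (at t within {a..b})"
      if "t \<in> {a..b}" "\<gamma> (1 - t) \<in> fst c" for t
      by (rule vector_diff_chain_within[OF rev_D]) (use der[of "1 - t"] that im in auto)
    moreover have "continuous_on {t \<in> {a..b}. \<gamma> (1 - t) \<in> fst c} (\<lambda>t. (-1) *\<^sub>R \<gamma>' (1 - t))"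
      by (intro continuous_intros continuous_on_compose2[OF cont]) auto
    ultimately show "\<exists>\<gamma>'. (\<forall>t\<in>{a..b}. (\<gamma> \<circ> ?rev) t \<in> fst c \<longrightarrow>
        ((snd c \<circ> (\<gamma> \<circ> ?rev)) has_vector_derivative \<gamma>' t) (at t within {a..b})) \<and>
      continuous_on {t \<in> {a..b}. (\<gamma> \<circ> ?rev) t \<in> fst c} \<gamma>'"
      by (intro exI[of _ "\<lambda>t. (-1) *\<^sub>R \<gamma>' (1 - t)"]) (auto simp: comp_assoc)
  qed
  then show "piecewise_C1_curve T A (\<gamma> \<circ> ?rev)"
    unfolding piecewise_C1_curve_def using p' finite_imageI[OF P(1)]
    by (intro conjI exI[of _ "?rev ` P"]) auto
  obtain Q where Q: "finite Q" "\<forall>t\<in>{0..1} - Q. t \<in> {0<..<1} \<and>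
      (\<exists>c\<in>A. \<gamma> t \<in> fst c \<and> (\<exists>v. ((snd c \<circ> \<gamma>) has_vector_derivative v) (at t)))"
    by (rule piecewise_C1_curve_differentiable[OF R \<gamma>]) (rule that)
  have "speed A g (\<gamma> \<circ> ?rev) t = speed A g \<gamma> (1 - t)" if t: "t \<in> {0..1} - ?rev ` Q" for t
  proof -
    have tQ: "1 - t \<in> {0..1} - Q" using t by force
    obtain c v where t: "1 - t \<in> {0<..<1}" and c: "c \<in> A" "\<gamma> (1 - t) \<in> fst c"
      and v: "((snd c \<circ> \<gamma>) has_vector_derivative v) (at (1 - t))"
      using bspec[OF Q(2) tQ] by blast
    have "((snd c \<circ> \<gamma> \<circ> ?rev) has_vector_derivative (-1) *\<^sub>R v) (at t)"
      by (rule vector_diff_chain_at[OF rev_D v])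
    then have "speed A g (\<gamma> \<circ> ?rev) t = tensor_norm g c (snd c (\<gamma> (1 - t))) (- v)"
      using t c by (subst speed_chart[OF R p' _ c(1)]) (auto simp: comp_assoc)
    then show ?thesis
      using t c speed_chart[OF R p _ c v]
        inner_form.sqrt_uminus[OF inner_form_tensor[OF R c(1)], of "snd c (\<gamma> (1 - t))" v]
      by (simp add: tensor_norm_def)
  qed
  then show "curve_length A g (\<gamma> \<circ> ?rev) = curve_length A g \<gamma>"
    unfolding curve_length_def integral_reflect01[of "speed A g \<gamma>", symmetric]
    by (intro integral_spike[of "?rev ` Q", symmetric] negligible_finite finite_imageI Q(1)) auto
qed

lemma riemannian_distance_commute:
  fixes A :: "('a, 'e::euclidean_space) chart set"
  assumes R: "riemannian_manifold T A g"
  shows "riemannian_distance T A g x y = riemannian_distance T A g y x"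
proof -
  have le: "riemannian_distance T A g x y \<le> riemannian_distance T A g y x" for x y
    unfolding riemannian_distance_def
  proof (rule INF_greatest)
    fix \<gamma> assume "\<gamma> \<in> {\<gamma>. piecewise_C1_curve T A \<gamma> \<and> \<gamma> 0 = y \<and> \<gamma> 1 = x}"
    then show "(INF \<gamma> \<in> {\<gamma>. piecewise_C1_curve T A \<gamma> \<and> \<gamma> 0 = x \<and> \<gamma> 1 = y}. ennreal (curve_length A g \<gamma>))
        \<le> ennreal (curve_length A g \<gamma>)"
      using piecewise_C1_curve_reverse[OF R, of \<gamma>]
      by (intro INF_lower2[of "\<gamma> \<circ> (\<lambda>t. 1 - t)"]) auto
  qed
  show ?thesis by (rule antisym[OF le le])
qed

section \<open>Leaves and gluing\<close>

lemma same_plaque_subset: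
  assumes "foliation T A F"
  shows "same_plaque F \<subseteq> topspace T \<times> topspace T"
proof -
  have "fst c \<subseteq> topspace T" if "(c, V) \<in> F" for c V
    using assms that is_chart_openin openin_subset unfolding foliation_def by blast
  then show ?thesis unfolding same_plaque_def by blast
qed

lemma foliation_subspace:
  assumes "foliation T A F" "(c, V) \<in> F"
  shows "subspace V"
  using assms unfolding foliation_def by fast

lemma refl_on_same_plaque:
  assumes F: "foliation T A F"
  shows "refl_on (topspace T) (same_plaque F)"
proof (rule refl_onI)
  fix x assume "x \<in> topspace T"
  then obtain c V where c: "(c, V) \<in> F" "x \<in> fst c" using F unfolding foliation_def by blast
  then have "connected_component (snd c ` fst c \<inter> {z. z - snd c x \<in> V}) (snd c x) (snd c x)"
    using subspace_0[OF foliation_subspace[OF F c(1)]] by (intro connected_component_refl) auto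
  then show "(x, x) \<in> same_plaque F" using c unfolding same_plaque_def by blast
qed

text \<open>If y lies on the slice through x, the difference of their coordinates belongs to the
  subspace V, so both points define the same slice.\<close>

lemma sym_same_plaque:
  assumes F: "foliation T A F"
  shows "sym (same_plaque F)"
proof (rule symI)
  fix x y assume "(x, y) \<in> same_plaque F"
  then obtain c V where c: "(c, V) \<in> F" "x \<in> fst c" "y \<in> fst c"
    and con: "connected_component (snd c ` fst c \<inter> {z. z - snd c x \<in> V}) (snd c x) (snd c y)"
    unfolding same_plaque_def by blast
  note V = foliation_subspace[OF F c(1)]
  have xy: "snd c y - snd c x \<in> V" using connected_component_in[OF con] by simp
  have "z - snd c x \<in> V \<longleftrightarrow> z - snd c y \<in> V" for z
    using subspace_diff[OF V _ xy, of "z - snd c x"] subspace_add[OF V _ xy, of "z - snd c y"]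
    by (auto simp: algebra_simps)
  then have "{z. z - snd c x \<in> V} = {z. z - snd c y \<in> V}" by simp
  then show "(y, x) \<in> same_plaque F"
    using connected_component_sym[OF con] c unfolding same_plaque_def by auto
qed

lemma equiv_same_leaf:
  assumes F: "foliation T A F"
  shows "equiv (topspace T) ((same_plaque F)\<^sup>+)"
proof (rule equivI)
  show "(same_plaque F)\<^sup>+ \<subseteq> topspace T \<times> topspace T"
    by (rule trancl_subset_Sigma[OF same_plaque_subset[OF F]])
  show "refl_on (topspace T) ((same_plaque F)\<^sup>+)"
    using refl_on_same_plaque[OF F] unfolding refl_on_def by blast
qed (auto intro: sym_trancl sym_same_plaque[OF F] trans_trancl)

lemma leaves_partition:
  assumes "foliation T A F"
  shows "x \<in> topspace T \<Longrightarrow> \<exists>!L. L \<in> leaves T F \<and> x \<in> L"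
    and "L \<in> leaves T F \<Longrightarrow> L \<subseteq> topspace T"
    and "L \<in> leaves T F \<Longrightarrow> L \<noteq> {}"
proof -
  note eq = equiv_same_leaf[OF assms]
  show "\<exists>!L. L \<in> leaves T F \<and> x \<in> L" if "x \<in> topspace T"
    unfolding leaves_def
  proof (rule ex1I)
    show "(same_plaque F)\<^sup>+ `` {x} \<in> topspace T // (same_plaque F)\<^sup>+ \<and> x \<in> (same_plaque F)\<^sup>+ `` {x}"
      using that equiv_class_self[OF eq] by (simp add: quotientI)
    fix L assume L: "L \<in> topspace T // (same_plaque F)\<^sup>+ \<and> x \<in> L"
    then obtain y where "y \<in> topspace T" "L = (same_plaque F)\<^sup>+ `` {y}" by (auto elim: quotientE)
    then show "L = (same_plaque F)\<^sup>+ `` {x}"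
      using L equiv_class_eq[OF eq] by auto
  qed
  show "L \<subseteq> topspace T" if "L \<in> leaves T F"
    using that in_quotient_imp_subset[OF eq] unfolding leaves_def by blast
  show "L \<noteq> {}" if "L \<in> leaves T F"
    using that in_quotient_imp_non_empty[OF eq] unfolding leaves_def by blast
qed

lemma HLS_proj_eq:
  assumes "foliation T A F" "L \<in> leaves T F" "x \<in> L"
  shows "HLS_proj d (leaves T F) x = zero_class (leaves T F) (leaf_rho d (leaves T F)) L"
proof -
  have "x \<in> topspace T" using leaves_partition(2)[OF assms(1,2)] assms(3) by blast
  then have "(THE L. L \<in> leaves T F \<and> x \<in> L) = L"
    using leaves_partition(1)[OF assms(1)] assms(2,3) by (intro the1_equality) auto
  then show ?thesis by (simp add: HLS_proj_def)
qed

text \<open>Since h is injective on \<open>S\<close>, the identity together with the generating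
  pairs and their converses is already transitive, so nothing else is generated.\<close>

lemma glue_rel_cases:
  assumes S: "S \<subseteq> topspace T1" and h: "h ` S \<subseteq> topspace T2" "inj_on h S"
    and uv: "(u, v) \<in> glue_rel T1 T2 S h"
  shows "u = v \<or> (\<exists>x\<in>S. u = Inl x \<and> v = Inr (h x)) \<or> (\<exists>x\<in>S. u = Inr (h x) \<and> v = Inl x)"
proof -
  let ?Y = "topspace T1 <+> topspace T2" and ?G = "(\<lambda>x. (Inl x, Inr (h x))) ` S"
  have "equiv ?Y (Id_on ?Y \<union> ?G \<union> ?G\<inverse>)"
  proof (rule equivI)
    show "Id_on ?Y \<union> ?G \<union> ?G\<inverse> \<subseteq> ?Y \<times> ?Y" using S h(1) by auto
    show "refl_on ?Y (Id_on ?Y \<union> ?G \<union> ?G\<inverse>)" by (auto intro!: refl_onI)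
    show "sym (Id_on ?Y \<union> ?G \<union> ?G\<inverse>)" by (auto intro!: symI)
    show "trans (Id_on ?Y \<union> ?G \<union> ?G\<inverse>)"
      using S h by (auto intro!: transI dest: inj_onD)
  qed
  then have "glue_rel T1 T2 S h \<subseteq> Id_on ?Y \<union> ?G \<union> ?G\<inverse>"
    unfolding glue_rel_def by (intro generated_equiv_subset) auto
  then show ?thesis using uv by auto
qed

lemma equiv_glue_rel:
  assumes "S \<subseteq> topspace T1" "h ` S \<subseteq> topspace T2"
  shows "equiv (topspace T1 <+> topspace T2) (glue_rel T1 T2 S h)"
  unfolding glue_rel_def using assms by (intro equiv_generated_equiv) auto

lemma topspace_glue_topology:
  assumes "S \<subseteq> topspace T1" "h ` S \<subseteq> topspace T2"
  shows "topspace (glue_topology T1 T2 S h) = (topspace T1 <+> topspace T2) // glue_rel T1 T2 S h"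
proof (rule antisym)
  show "topspace (glue_topology T1 T2 S h) \<subseteq> (topspace T1 <+> topspace T2) // glue_rel T1 T2 S h"
    unfolding topspace_def openin_glue_topology by blast
  have "{x \<in> topspace T1. glue_inl T1 T2 S h x \<in> (topspace T1 <+> topspace T2) // glue_rel T1 T2 S h} = topspace T1"
    "{y \<in> topspace T2. glue_inr T1 T2 S h y \<in> (topspace T1 <+> topspace T2) // glue_rel T1 T2 S h} = topspace T2"
    by (auto simp: glue_inl_def glue_inr_def intro!: quotientI)
  then have "openin (glue_topology T1 T2 S h) ((topspace T1 <+> topspace T2) // glue_rel T1 T2 S h)"
    unfolding openin_glue_topology by simp
  then show "(topspace T1 <+> topspace T2) // glue_rel T1 T2 S h \<subseteq> topspace (glue_topology T1 T2 S h)"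
    by (rule openin_subset)
qed

lemma glue_inclusions:
  assumes S: "S \<subseteq> topspace T1" and h: "h ` S \<subseteq> topspace T2" "inj_on h S"
  shows "continuous_map T1 (glue_topology T1 T2 S h) (glue_inl T1 T2 S h)"
    and "continuous_map T2 (glue_topology T1 T2 S h) (glue_inr T1 T2 S h)"
    and "inj_on (glue_inl T1 T2 S h) (topspace T1)"
    and "inj_on (glue_inr T1 T2 S h) (topspace T2)"
    and "m \<in> topspace (glue_topology T1 T2 S h) \<Longrightarrow>
      m \<in> glue_inl T1 T2 S h ` topspace T1 \<or> m \<in> glue_inr T1 T2 S h ` topspace T2"
proof -
  note eq = equiv_glue_rel[OF S h(1)] and top = topspace_glue_topology[OF S h(1)]
  show "continuous_map T1 (glue_topology T1 T2 S h) (glue_inl T1 T2 S h)"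
    "continuous_map T2 (glue_topology T1 T2 S h) (glue_inr T1 T2 S h)"
    unfolding continuous_map_def top openin_glue_topology
    by (auto simp: glue_inl_def glue_inr_def intro!: quotientI)
  show "inj_on (glue_inl T1 T2 S h) (topspace T1)"
  proof (rule inj_onI)
    fix x y assume "x \<in> topspace T1" "y \<in> topspace T1" "glue_inl T1 T2 S h x = glue_inl T1 T2 S h y"
    then have "(Inl x, Inl y) \<in> glue_rel T1 T2 S h"
      unfolding glue_inl_def by (intro eq_equiv_class[OF _ eq]) auto
    from glue_rel_cases[OF S h this] show "x = y" by auto
  qed
  show "inj_on (glue_inr T1 T2 S h) (topspace T2)"
  proof (rule inj_onI)
    fix x y assume "x \<in> topspace T2" "y \<in> topspace T2" "glue_inr T1 T2 S h x = glue_inr T1 T2 S h y"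
    then have "(Inr x, Inr y) \<in> glue_rel T1 T2 S h"
      unfolding glue_inr_def by (intro eq_equiv_class[OF _ eq]) auto
    from glue_rel_cases[OF S h this] show "x = y" by auto
  qed
  show "m \<in> glue_inl T1 T2 S h ` topspace T1 \<or> m \<in> glue_inr T1 T2 S h ` topspace T2"
    if m: "m \<in> topspace (glue_topology T1 T2 S h)"
  proof -
    obtain u where "u \<in> topspace T1 <+> topspace T2" "m = glue_rel T1 T2 S h `` {u}"
      using m unfolding top by (rule quotientE)
    then show ?thesis by (auto simp: glue_inl_def glue_inr_def)
  qed
qed

text \<open>\<open>E\<close> lives on the disjoint union, where a point of the gluing locus has two
  representatives at \<open>E\<close>-distance 0. Hence it can be evaluated along a curve of M
  through arbitrary representatives, and near each t it is compared with the distance of whichever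
  side contains \<open>\<gamma> s\<close>.\<close>

lemma pseudometric_le_glued_distance:
  fixes A1 :: "('a, 'e::euclidean_space) chart set" and A2 :: "('b, 'e) chart set"
    and A :: "(('a + 'b) set, 'e) chart set" and T1 :: "'a topology" and T2 :: "'b topology"
  defines "Y \<equiv> topspace T1 <+> topspace T2"
  assumes S: "S \<subseteq> topspace T1" and h: "h ` S \<subseteq> topspace T2" "inj_on h S"
    and R1: "riemannian_manifold T1 A1 g1" and R2: "riemannian_manifold T2 A2 g2"
    and R: "riemannian_manifold (glue_topology T1 T2 S h) A g"
    and K: "compact_space T1" "compact_space T2"
    and j1: "restricts_to A g (glue_inl T1 T2 S h) T1 A1 g1"
    and j2: "restricts_to A g (glue_inr T1 T2 S h) T2 A2 g2"
    and E: "pseudometric_on Y E"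
    and le1: "\<And>x y. x \<in> topspace T1 \<Longrightarrow> y \<in> topspace T1 \<Longrightarrow> E (Inl x) (Inl y) \<le> riemannian_distance T1 A1 g1 x y"
    and le2: "\<And>x y. x \<in> topspace T2 \<Longrightarrow> y \<in> topspace T2 \<Longrightarrow> E (Inr x) (Inr y) \<le> riemannian_distance T2 A2 g2 x y"
    and zero: "\<And>u v. (u, v) \<in> glue_rel T1 T2 S h \<Longrightarrow> E u v = 0"
    and uv: "u \<in> Y" "v \<in> Y"
  shows "E u v \<le> riemannian_distance (glue_topology T1 T2 S h) A g
    (glue_rel T1 T2 S h `` {u}) (glue_rel T1 T2 S h `` {v})"
  unfolding riemannian_distance_def
proof (rule INF_greatest)
  let ?T = "glue_topology T1 T2 S h" and ?R = "glue_rel T1 T2 S h"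
  fix \<gamma> assume "\<gamma> \<in> {\<gamma>. piecewise_C1_curve ?T A \<gamma> \<and> \<gamma> 0 = ?R `` {u} \<and> \<gamma> 1 = ?R `` {v}}"
  then have \<gamma>: "piecewise_C1_curve ?T A \<gamma>" "\<gamma> 0 = ?R `` {u}" "\<gamma> 1 = ?R `` {v}" by auto
  then have path: "pathin ?T \<gamma>" unfolding piecewise_C1_curve_def by blast
  note incl = glue_inclusions[OF S h]
  note eq = equiv_glue_rel[OF S h(1), folded Y_def] and top = topspace_glue_topology[OF S h(1), folded Y_def]
  have "Hausdorff_space ?T" using R unfolding riemannian_manifold_def smooth_manifold_def by blast
  then have closed: "closed_map T1 ?T (glue_inl T1 T2 S h)" "closed_map T2 ?T (glue_inr T1 T2 S h)"
    using continuous_imp_closed_map_gen K incl(1,2) Hausdorff_imp_kc_space by blast+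
  define s where "s m = (SOME w. w \<in> m)" for m :: "('a + 'b) set"
  have s: "E w (s (?R `` {w})) = 0" "s (?R `` {w}) \<in> Y" if "w \<in> Y" for w
  proof -
    have "s (?R `` {w}) \<in> ?R `` {w}"
      unfolding s_def by (rule someI[of _ w]) (rule equiv_class_self[OF eq that])
    then have "(w, s (?R `` {w})) \<in> ?R" by simp
    then show "E w (s (?R `` {w})) = 0" "s (?R `` {w}) \<in> Y"
      using zero equivE[OF eq] by blast+
  qed
  define \<sigma> where "\<sigma> t = s (\<gamma> t)" for t
  have \<sigma>: "\<sigma> t \<in> Y" "w \<in> Y \<Longrightarrow> \<gamma> t = ?R `` {w} \<Longrightarrow> E w (\<sigma> t) = 0" if t: "t \<in> {0..1}" for t w
  proof -
    have "\<gamma> t \<in> Y // ?R" using pathin_imp_topspace[OF path t] top by simp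
    then obtain w0 where "w0 \<in> Y" "\<gamma> t = ?R `` {w0}" by (rule quotientE)
    then show "\<sigma> t \<in> Y" using s by (simp add: \<sigma>_def)
    show "E w (\<sigma> t) = 0" if "w \<in> Y" "\<gamma> t = ?R `` {w}"
      using s(1)[OF that(1)] that(2) by (simp add: \<sigma>_def)
  qed
  have "E (\<sigma> 0) (\<sigma> 1) \<le> ennreal (curve_length A g \<gamma>)"
  proof (rule curve_length_bound[OF R \<gamma>(1), of "\<lambda>s t. E (\<sigma> s) (\<sigma> t)"])
    fix t c and e :: real assume t: "t \<in> {0..1}" and c: "c \<in> A" "\<gamma> t \<in> fst c" and e: "0 < e"
    let ?B = "\<lambda>s. ennreal ((1 + e) * tensor_norm g c (snd c (\<gamma> t)) (snd c (\<gamma> s) - snd c (\<gamma> t)))"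
    obtain r1 where r1: "0 < r1"
      "\<And>s q. s \<in> {0..1} \<Longrightarrow> \<bar>s - t\<bar> < r1 \<Longrightarrow> q \<in> topspace T1 \<Longrightarrow> glue_inl T1 T2 S h q = \<gamma> s \<Longrightarrow>
        \<exists>p\<in>topspace T1. glue_inl T1 T2 S h p = \<gamma> t \<and> riemannian_distance T1 A1 g1 p q \<le> ?B s"
      using closed_embedding_local_bound[OF R1 R incl(1) j1 closed(1) incl(3) path t c e] by metis
    obtain r2 where r2: "0 < r2"
      "\<And>s q. s \<in> {0..1} \<Longrightarrow> \<bar>s - t\<bar> < r2 \<Longrightarrow> q \<in> topspace T2 \<Longrightarrow> glue_inr T1 T2 S h q = \<gamma> s \<Longrightarrow>
        \<exists>p\<in>topspace T2. glue_inr T1 T2 S h p = \<gamma> t \<and> riemannian_distance T2 A2 g2 p q \<le> ?B s"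
      using closed_embedding_local_bound[OF R2 R incl(2) j2 closed(2) incl(4) path t c e] by metis
    \<comment> \<open>The chosen representatives at s and t may lie on different sides; they may be
      replaced by any others, in particular by two on the same side.\<close>
    have bound: "E (\<sigma> s) (\<sigma> t) \<le> ?B s"
      if st: "s \<in> {0..1}" and w: "w \<in> Y" "\<gamma> s = ?R `` {w}" "w' \<in> Y" "\<gamma> t = ?R `` {w'}" "E w' w \<le> ?B s" for s w w'
    proof -
      have "E (\<sigma> s) (\<sigma> t) = E w w'"
        using pseudometric_zero_cong[OF E w(1) \<sigma>(1)[OF st] w(3) \<sigma>(1)[OF t]] \<sigma>(2)[OF st w(1,2)] \<sigma>(2)[OF t w(3,4)]
        by simp
      then show ?thesis using w pseudometric_onD(2)[OF E w(1,3)] by simp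
    qed
    have "E (\<sigma> s) (\<sigma> t) \<le> ?B s" if st: "s \<in> {0..1}" "\<bar>s - t\<bar> < min r1 r2" for s
    proof -
      \<comment> \<open>The side is dictated by \<open>\<gamma> s\<close> and may vary with s, so
        the radius has to serve both inclusions. The local bound provides a preimage of
        \<open>\<gamma> t\<close> on the same side.\<close>
      consider q where "q \<in> topspace T1" "glue_inl T1 T2 S h q = \<gamma> s"
        | q where "q \<in> topspace T2" "glue_inr T1 T2 S h q = \<gamma> s"
        using incl(5)[OF pathin_imp_topspace[OF path st(1)]] by force
      then show ?thesis
      proof cases
        case 1
        then obtain p where p: "p \<in> topspace T1" "glue_inl T1 T2 S h p = \<gamma> t" "riemannian_distance T1 A1 g1 p q \<le> ?B s"
          using r1(2)[OF st(1) _ 1] st(2) by (meson min_less_iff_conj)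
        then have "E (Inl p) (Inl q) \<le> ?B s" using le1[OF p(1) 1(1)] by simp
        then show ?thesis
          using 1 p by (intro bound[OF st(1), of "Inl q" "Inl p"]) (auto simp: Y_def glue_inl_def)
      next
        case 2
        then obtain p where p: "p \<in> topspace T2" "glue_inr T1 T2 S h p = \<gamma> t" "riemannian_distance T2 A2 g2 p q \<le> ?B s"
          using r2(2)[OF st(1) _ 2] st(2) by (meson min_less_iff_conj)
        then have "E (Inr p) (Inr q) \<le> ?B s" using le2[OF p(1) 2(1)] by simp
        then show ?thesis
          using 2 p by (intro bound[OF st(1), of "Inr q" "Inr p"]) (auto simp: Y_def glue_inr_def)
      qed
    qed
    then show "\<exists>r>0. \<forall>s\<in>{0..1}. \<bar>s - t\<bar> < r \<longrightarrow> E (\<sigma> s) (\<sigma> t) \<le> ?B s"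
      using r1(1) r2(1) by (intro exI[of _ "min r1 r2"]) simp
  qed (use \<sigma>(1) pseudometric_onD(2,3)[OF E] in blast)+
  moreover have "E u v = E (\<sigma> 0) (\<sigma> 1)"
    using pseudometric_zero_cong[OF E uv(1) _ uv(2)] \<sigma>(1)[of 0] \<sigma>(1)[of 1] \<sigma>(2)[OF _ uv(1) \<gamma>(2)] \<sigma>(2)[OF _ uv(2) \<gamma>(3)]
    by simp
  ultimately show "E u v \<le> ennreal (curve_length A g \<gamma>)" by simp
qed

lemma pseudometric_on_pullback:
  assumes "pseudometric_on X D" "q ` Y \<subseteq> X"
  shows "pseudometric_on Y (\<lambda>x y. D (q x) (q y))"
proof -
  have "q y \<in> X" if "y \<in> Y" for y using assms(2) that by blast
  then show ?thesis unfolding pseudometric_on_def using pseudometric_onD[OF assms(1)] by blast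
qed

text \<open>\<open>E'\<close> is evaluated at chosen preimages; the choice is immaterial because any
  two points of a fibre have distance 0.\<close>

lemma pseudometric_factor:
  assumes E: "pseudometric_on Z E" and q: "q ` Z = Y"
    and zero: "\<And>a b. a \<in> Z \<Longrightarrow> b \<in> Z \<Longrightarrow> q a = q b \<Longrightarrow> E a b = 0"
  obtains E' where "pseudometric_on Y E'" "\<And>a b. a \<in> Z \<Longrightarrow> b \<in> Z \<Longrightarrow> E' (q a) (q b) = E a b"
proof
  have s: "inv_into Z q y \<in> Z" "q (inv_into Z q y) = y" if "y \<in> Y" for y
    using that q by (auto simp: inv_into_into f_inv_into_f)
  show "pseudometric_on Y (\<lambda>x y. E (inv_into Z q x) (inv_into Z q y))"
    by (rule pseudometric_on_pullback[OF E]) (use s in auto)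
  show "E (inv_into Z q (q a)) (inv_into Z q (q b)) = E a b" if "a \<in> Z" "b \<in> Z" for a b
  proof (rule pseudometric_zero_cong[OF E])
    have "q a \<in> Y" "q b \<in> Y" using that q by auto
    then show "inv_into Z q (q a) \<in> Z" "inv_into Z q (q b) \<in> Z"
      "E (inv_into Z q (q a)) a = 0" "E (inv_into Z q (q b)) b = 0"
      using s zero that by simp_all
  qed (use that in auto)
qed

theorem theorem4p1:
  fixes T1 :: "'a topology" and A1 :: "('a, 'e::euclidean_space) chart set"
    and g1 :: "('a, 'e) metric_tensor" and F1 :: "('a, 'e) foliated_chart set"
    and T2 :: "'b topology" and A2 :: "('b, 'e) chart set"
    and g2 :: "('b, 'e) metric_tensor" and F2 :: "('b, 'e) foliated_chart set"
    and S1 :: "'a set" and S2 :: "'b set" and h :: "'a \<Rightarrow> 'b"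
    and A :: "(('a + 'b) set, 'e) chart set" and g :: "(('a + 'b) set, 'e) metric_tensor"
  defines "T \<equiv> glue_topology T1 T2 S1 h"
    and "\<L>1 \<equiv> leaves T1 F1" and "\<L>2 \<equiv> leaves T2 F2"
    and "\<L> \<equiv> glue_leaves T1 T2 S1 h (leaves T1 F1) (leaves T2 F2)"
    and "d1 \<equiv> riemannian_distance T1 A1 g1" and "d2 \<equiv> riemannian_distance T2 A2 g2"
    and "d \<equiv> riemannian_distance (glue_topology T1 T2 S1 h) A g"
  assumes "compact_connected_foliated_riemannian_manifold T1 A1 g1 F1"
    and "compact_connected_foliated_riemannian_manifold T2 A2 g2 F2"
    and "tangent_to_boundary T1 A1 F1" and "tangent_to_boundary T2 A2 F2"
    and "S1 \<noteq> {}" and "union_of_boundary_components T1 A1 S1"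
    and "S2 \<noteq> {}" and "union_of_boundary_components T2 A2 S2"
    and "boundary_isometry T1 A1 g1 S1 T2 A2 g2 S2 h"
    and "\<And>L. L \<in> \<L>1 \<Longrightarrow> L \<subseteq> S1 \<Longrightarrow> h ` L \<in> \<L>2"
    and "riemannian_manifold T A g"
    and "restricts_to A g (glue_inl T1 T2 S1 h) T1 A1 g1"
    and "restricts_to A g (glue_inr T1 T2 S1 h) T2 A2 g2"
  shows "isometric_spaces (HLS d \<L>) (HLS_dist d \<L>)
     (identification (HLS d1 \<L>1 <+> HLS d2 \<L>2) (HLS_glue_pseudodist d1 \<L>1 d2 \<L>2 S1 h))
     (identification_dist (HLS_glue_pseudodist d1 \<L>1 d2 \<L>2 S1 h))"
proof -
  have K: "compact_space T1" "compact_space T2"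
    and R1: "riemannian_manifold T1 A1 g1" and R2: "riemannian_manifold T2 A2 g2"
    and F1: "foliation T1 A1 F1" and F2: "foliation T2 A2 F2"
    using assms(8,9) unfolding compact_connected_foliated_riemannian_manifold_def by blast+
  note R = assms(18) and j1 = assms(19) and j2 = assms(20)
  have S: "S1 \<subseteq> topspace T1" "S2 \<subseteq> topspace T2"
    using assms(13,15) connected_components_of_subset unfolding union_of_boundary_components_def
    by fastforce+
  have hom: "homeomorphic_map (subtopology T1 S1) (subtopology T2 S2) h"
    using assms(16) unfolding boundary_isometry_def by blast
  have h: "h ` S1 \<subseteq> topspace T2" "inj_on h S1"
    using homeomorphic_imp_surjective_map[OF hom] homeomorphic_imp_injective_map[OF hom] S
    by (auto simp: Int_absorb1)
  let ?R = "glue_rel T1 T2 S1 h" and ?j1 = "glue_inl T1 T2 S1 h" and ?j2 = "glue_inr T1 T2 S1 h"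
  let ?\<rho>1 = "leaf_rho d1 \<L>1" and ?\<rho>2 = "leaf_rho d2 \<L>2" and ?\<rho> = "leaf_rho d \<L>"
  let ?\<delta> = "HLS_glue_pseudodist d1 \<L>1 d2 \<L>2 S1 h"
  let ?c1 = "zero_class \<L>1 ?\<rho>1" and ?c2 = "zero_class \<L>2 ?\<rho>2"
  let ?H = "HLS d1 \<L>1 <+> HLS d2 \<L>2" and ?dH = "disjoint_union_dist (HLS_dist d1 \<L>1) (HLS_dist d2 \<L>2)"
  let ?Q = "HLS_glue_rel d1 \<L>1 d2 \<L>2 S1 h"
  let ?G = "(\<lambda>x. (Inl (HLS_proj d1 \<L>1 x), Inr (HLS_proj d2 \<L>2 (h x)))) ` S1 :: (('a set set + 'b set set) \<times> ('a set set + 'b set set)) set"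
  note incl = glue_inclusions[OF S(1) h]
  note part1 = leaves_partition[OF F1, folded \<L>1_def] and part2 = leaves_partition[OF F2, folded \<L>2_def]
  have proj1: "HLS_proj d1 \<L>1 x = ?c1 L" if "L \<in> \<L>1" "x \<in> L" for L x
    using HLS_proj_eq[OF F1] that unfolding \<L>1_def by blast
  have proj2: "HLS_proj d2 \<L>2 x = ?c2 L" if "L \<in> \<L>2" "x \<in> L" for L x
    using HLS_proj_eq[OF F2] that unfolding \<L>2_def by blast
  have \<rho>: "pseudometric_on \<L>1 ?\<rho>1" "pseudometric_on \<L>2 ?\<rho>2" "pseudometric_on \<L> ?\<rho>"
    unfolding d1_def d2_def d_def
    by (intro pseudometric_on_leaf_rho riemannian_distance_commute[OF R1] riemannian_distance_commute[OF R2]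
        riemannian_distance_commute[OF R[unfolded T_def]])+
  have HLS1: "HLS d1 \<L>1 = ?c1 ` \<L>1" "HLS d2 \<L>2 = ?c2 ` \<L>2"
    by (simp_all add: HLS_def identification_def)
  have dist1: "HLS_dist d1 \<L>1 (?c1 L) (?c1 L') = ?\<rho>1 L L'" if "L \<in> \<L>1" "L' \<in> \<L>1" for L L'
    unfolding HLS_dist_def by (rule identification_dist_zero_class[OF \<rho>(1) that])
  have dist2: "HLS_dist d2 \<L>2 (?c2 L) (?c2 L') = ?\<rho>2 L L'" if "L \<in> \<L>2" "L' \<in> \<L>2" for L L'
    unfolding HLS_dist_def by (rule identification_dist_zero_class[OF \<rho>(2) that])
  have dH: "pseudometric_on ?H ?dH"
    unfolding HLS_def HLS_dist_def
    by (intro pseudometric_on_disjoint_union pseudometric_on_identification_dist \<rho>)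
  have proj_mem: "HLS_proj d1 \<L>1 x \<in> HLS d1 \<L>1" if "x \<in> topspace T1" for x
    using part1(1)[OF that] proj1 HLS1 by force
  have proj_mem': "HLS_proj d2 \<L>2 x \<in> HLS d2 \<L>2" if "x \<in> topspace T2" for x
    using part2(1)[OF that] proj2 HLS1 by force
  have glue_sub: "?G \<subseteq> ?H \<times> ?H"
    using proj_mem proj_mem' S(1) h(1) by blast
  have Q: "equiv ?H ?Q"
    unfolding HLS_glue_rel_def by (rule equiv_generated_equiv[OF glue_sub])
  have \<delta>: "pseudometric_on ?H ?\<delta>"
    unfolding HLS_glue_pseudodist_def by (rule pseudometric_on_quotient_pseudodist[OF dH Q])

  \<comment> \<open>Leaves before any identification. \<open>\<Phi>\<close> and
    \<open>\<Psi>\<close> present the leaves of M and the points of the two leaf spaces as images of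
    this one set; \<open>\<Phi>\<close> merges a leaf in S1 with its image under h.\<close>
  define Z where "Z = \<L>1 <+> \<L>2"
  define \<Phi> where "\<Phi> = case_sum (image ?j1) (image ?j2)"
  define \<Psi> where "\<Psi> = map_sum ?c1 ?c2"
  have \<Phi>: "\<Phi> ` Z = \<L>"
    unfolding Z_def \<Phi>_def \<L>_def glue_leaves_def \<L>1_def \<L>2_def Plus_def image_Un image_image by simp
  have \<Psi>: "\<Psi> ` Z = ?H"
    unfolding Z_def \<Psi>_def HLS1 Plus_def image_Un image_image by simp

  have glued: "?j1 x = ?j2 (h x)" if "x \<in> S1" for x
    unfolding glue_inl_def glue_inr_def
    by (rule equiv_class_eq[OF equiv_glue_rel[OF S(1) h(1)]])
      (use that in \<open>auto simp: glue_rel_def intro!: subsetD[OF generated_equiv_superset]\<close>)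
  have self: "d m m = 0" if "m \<in> topspace T" for m
    using riemannian_distance_self[OF R that] unfolding d_def T_def .
  have top1: "?j1 x \<in> topspace T" if "x \<in> topspace T1" for x
    using incl(1) that unfolding T_def continuous_map_def by blast
  have mem: "?j1 ` L \<in> \<L>" if "L \<in> \<L>1" for L
    using that unfolding \<L>_def glue_leaves_def \<L>1_def by blast
  have mem': "?j2 ` L \<in> \<L>" if "L \<in> \<L>2" for L
    using that unfolding \<L>_def glue_leaves_def \<L>2_def by blast

  \<comment> \<open>Inclusion maps leaves to leaves and does not increase distances, so the pulled
    back \<open>?\<rho>\<close> is one of the pseudometrics below \<open>d1\<close>, and
    \<open>?\<rho>1\<close> is the largest of them.\<close>
  have le1: "?\<rho> (?j1 ` L) (?j1 ` L') \<le> ?\<rho>1 L L'" for L L'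
  proof (rule leaf_rho_greatest)
    show "pseudometric_on \<L>1 (\<lambda>L L'. ?\<rho> (?j1 ` L) (?j1 ` L'))"
      by (rule pseudometric_on_pullback[OF \<rho>(3)]) (use mem in auto)
    fix L L' x y assume L: "L \<in> \<L>1" "L' \<in> \<L>1" "x \<in> L" "y \<in> L'"
    then have "?\<rho> (?j1 ` L) (?j1 ` L') \<le> d (?j1 x) (?j1 y)" by (intro leaf_rho_le mem imageI)
    also have "\<dots> \<le> d1 x y"
      unfolding d_def d1_def
      by (rule riemannian_distance_map[OF R1 R[unfolded T_def] incl(1) j1])
    finally show "?\<rho> (?j1 ` L) (?j1 ` L') \<le> d1 x y" .
  qed
  have le2: "?\<rho> (?j2 ` L) (?j2 ` L') \<le> ?\<rho>2 L L'" for L L'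
  proof (rule leaf_rho_greatest)
    show "pseudometric_on \<L>2 (\<lambda>L L'. ?\<rho> (?j2 ` L) (?j2 ` L'))"
      by (rule pseudometric_on_pullback[OF \<rho>(3)]) (use mem' in auto)
    fix L L' x y assume L: "L \<in> \<L>2" "L' \<in> \<L>2" "x \<in> L" "y \<in> L'"
    then have "?\<rho> (?j2 ` L) (?j2 ` L') \<le> d (?j2 x) (?j2 y)" by (intro leaf_rho_le mem' imageI)
    also have "\<dots> \<le> d2 x y"
      unfolding d_def d2_def
      by (rule riemannian_distance_map[OF R2 R[unfolded T_def] incl(2) j2])
    finally show "?\<rho> (?j2 ` L) (?j2 ` L') \<le> d2 x y" .
  qed

  let ?E = "\<lambda>a b. ?\<rho> (\<Phi> a) (\<Phi> b)"
  have E: "pseudometric_on Z ?E" by (rule pseudometric_on_pullback[OF \<rho>(3)]) (simp add: \<Phi>)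
  \<comment> \<open>Descent of \<open>?E\<close> along \<open>\<Psi>\<close>: leaves not separated
    in their own leaf space are not separated in M either.\<close>
  have E_zero: "?E a b = 0" if ab: "a \<in> Z" "b \<in> Z" "\<Psi> a = \<Psi> b" for a b
  proof -
    consider L L' where "a = Inl L" "b = Inl L'" "L \<in> \<L>1" "L' \<in> \<L>1" "?c1 L = ?c1 L'"
      | L L' where "a = Inr L" "b = Inr L'" "L \<in> \<L>2" "L' \<in> \<L>2" "?c2 L = ?c2 L'"
      using ab unfolding Z_def \<Psi>_def by (auto elim!: PlusE)
    then show ?thesis
    proof cases
      case 1
      then have "?\<rho>1 L L' = 0" using zero_class_eq_iff[OF \<rho>(1)] by blast
      then show ?thesis using le1[of L L'] 1 by (simp add: \<Phi>_def)
    next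
      case 2
      then have "?\<rho>2 L L' = 0" using zero_class_eq_iff[OF \<rho>(2)] by blast
      then show ?thesis using le2[of L L'] 2 by (simp add: \<Phi>_def)
    qed
  qed
  obtain E' where E': "pseudometric_on ?H E'" "\<And>a b. a \<in> Z \<Longrightarrow> b \<in> Z \<Longrightarrow> E' (\<Psi> a) (\<Psi> b) = ?E a b"
    using pseudometric_factor[OF E \<Psi> E_zero] by metis
  have E'_le: "E' y y' \<le> ?dH y y'" if y: "y \<in> ?H" "y' \<in> ?H" for y y'
  proof -
    obtain a b where ab: "a \<in> Z" "b \<in> Z" "y = \<Psi> a" "y' = \<Psi> b" using y unfolding \<Psi>[symmetric] by blast
    \<comment> \<open>For points of different summands the bound is trivial, the distance being
      infinite.\<close>
    consider L L' where "a = Inl L" "b = Inl L'" "L \<in> \<L>1" "L' \<in> \<L>1"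
      | L L' where "a = Inr L" "b = Inr L'" "L \<in> \<L>2" "L' \<in> \<L>2"
      | "?dH y y' = \<infinity>"
      using ab unfolding Z_def \<Psi>_def by (auto elim!: PlusE)
    then show ?thesis
    proof cases
      case 1
      then show ?thesis using ab E'(2)[OF ab(1,2)] le1[of L L'] dist1 by (simp add: \<Phi>_def \<Psi>_def)
    next
      case 2
      then show ?thesis using ab E'(2)[OF ab(1,2)] le2[of L L'] dist2 by (simp add: \<Phi>_def \<Psi>_def)
    qed simp
  qed
  have "?Q \<subseteq> {(y, y'). y \<in> ?H \<and> y' \<in> ?H \<and> E' y y' = 0}"
    unfolding HLS_glue_rel_def
  proof (rule generated_equiv_subset)
    show "equiv ?H {(y, y'). y \<in> ?H \<and> y' \<in> ?H \<and> E' y y' = 0}"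
      using equiv_zero_dist[OF E'(1), of id] by simp
    show "?G
        \<subseteq> {(y, y'). y \<in> ?H \<and> y' \<in> ?H \<and> E' y y' = 0}"
    proof
      fix z assume z: "z \<in> ?G"
      then obtain x where x: "x \<in> S1" "z = (Inl (HLS_proj d1 \<L>1 x), Inr (HLS_proj d2 \<L>2 (h x)))" by blast
      then have xT: "x \<in> topspace T1" "h x \<in> topspace T2" using S(1) h(1) by auto
      obtain L L' where L: "L \<in> \<L>1" "x \<in> L" "L' \<in> \<L>2" "h x \<in> L'"
        using part1(1)[OF xT(1)] part2(1)[OF xT(2)] by blast
      \<comment> \<open>The leaves through x and h x meet in M at the glued point, so they are no
        further apart than this point is from itself.\<close>
      have "?\<rho> (?j1 ` L) (?j2 ` L') \<le> d (?j1 x) (?j2 (h x))"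
        using L by (intro leaf_rho_le mem mem' imageI)
      also have "\<dots> = 0" using glued[OF x(1)] self top1[OF xT(1)] by simp
      finally have "?E (Inl L) (Inr L') = 0" by (simp add: \<Phi>_def)
      moreover have "Inl L \<in> Z" "Inr L' \<in> Z" using L by (auto simp: Z_def)
      moreover have "z = (\<Psi> (Inl L), \<Psi> (Inr L'))"
        using x(2) proj1[OF L(1,2)] proj2[OF L(3,4)] by (simp add: \<Psi>_def)
      ultimately show "z \<in> {(y, y'). y \<in> ?H \<and> y' \<in> ?H \<and> E' y y' = 0}"
        using E'(2) glue_sub z by auto
    qed
  qed
  then have upper: "?E a b \<le> ?\<delta> (\<Psi> a) (\<Psi> b)" if "a \<in> Z" "b \<in> Z" for a b
    unfolding HLS_glue_pseudodist_def E'(2)[OF that, symmetric]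
    by (intro quotient_pseudodist_greatest E'(1) E'_le) auto

  define \<pi> where "\<pi> = map_sum (HLS_proj d1 \<L>1) (HLS_proj d2 \<L>2)"
  let ?Y = "topspace T1 <+> topspace T2"
  have \<pi>_mem: "\<pi> ` ?Y \<subseteq> ?H" using proj_mem proj_mem' by (auto simp: \<pi>_def)
  have \<delta>_le: "?\<delta> y y' \<le> ?dH y y'" if "y \<in> ?H" "y' \<in> ?H" for y y'
    unfolding HLS_glue_pseudodist_def by (rule quotient_pseudodist_le[OF that])
  \<comment> \<open>\<open>\<pi>\<close> is the counterpart of \<open>\<Psi>\<close> for points.
    Pulled back along it, \<open>?\<delta>\<close> lies below the Riemannian distance on each side
    and vanishes on glued pairs, which is what the comparison along curves asks for.\<close>
  have points: "?\<delta> (\<pi> u) (\<pi> v) \<le> d (?R `` {u}) (?R `` {v})" if uv: "u \<in> ?Y" "v \<in> ?Y" for u v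
    unfolding d_def
  proof (rule pseudometric_le_glued_distance[OF S(1) h R1 R2 R[unfolded T_def] K j1 j2 _ _ _ _ uv])
    show "pseudometric_on ?Y (\<lambda>u v. ?\<delta> (\<pi> u) (\<pi> v))"
      by (rule pseudometric_on_pullback[OF \<delta> \<pi>_mem])
  next
    fix x y assume xy: "x \<in> topspace T1" "y \<in> topspace T1"
    obtain L L' where L: "L \<in> \<L>1" "x \<in> L" "L' \<in> \<L>1" "y \<in> L'"
      using part1(1)[OF xy(1)] part1(1)[OF xy(2)] by blast
    have "?\<delta> (\<pi> (Inl x)) (\<pi> (Inl y)) \<le> ?dH (\<pi> (Inl x)) (\<pi> (Inl y))"
      by (rule \<delta>_le) (use xy proj_mem in \<open>auto simp: \<pi>_def\<close>)
    also have "\<dots> = ?\<rho>1 L L'"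
      by (simp add: \<pi>_def proj1[OF L(1,2)] proj1[OF L(3,4)] dist1[OF L(1,3)])
    also have "\<dots> \<le> d1 x y" by (rule leaf_rho_le[OF L(1,3,2,4)])
    finally show "?\<delta> (\<pi> (Inl x)) (\<pi> (Inl y)) \<le> riemannian_distance T1 A1 g1 x y"
      unfolding d1_def .
  next
    fix x y assume xy: "x \<in> topspace T2" "y \<in> topspace T2"
    obtain L L' where L: "L \<in> \<L>2" "x \<in> L" "L' \<in> \<L>2" "y \<in> L'"
      using part2(1)[OF xy(1)] part2(1)[OF xy(2)] by blast
    have "?\<delta> (\<pi> (Inr x)) (\<pi> (Inr y)) \<le> ?dH (\<pi> (Inr x)) (\<pi> (Inr y))"
      by (rule \<delta>_le) (use xy proj_mem' in \<open>auto simp: \<pi>_def\<close>)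
    also have "\<dots> = ?\<rho>2 L L'"
      by (simp add: \<pi>_def proj2[OF L(1,2)] proj2[OF L(3,4)] dist2[OF L(1,3)])
    also have "\<dots> \<le> d2 x y" by (rule leaf_rho_le[OF L(1,3,2,4)])
    finally show "?\<delta> (\<pi> (Inr x)) (\<pi> (Inr y)) \<le> riemannian_distance T2 A2 g2 x y"
      unfolding d2_def .
  next
    fix u v assume "(u, v) \<in> ?R"
    have eq: "equiv ?Y {(u, v). u \<in> ?Y \<and> v \<in> ?Y \<and> ?\<delta> (\<pi> u) (\<pi> v) = 0}"
      by (rule equiv_zero_dist[OF \<delta> \<pi>_mem])
    have "?R \<subseteq> {(u, v). u \<in> ?Y \<and> v \<in> ?Y \<and> ?\<delta> (\<pi> u) (\<pi> v) = 0}"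
      unfolding glue_rel_def
    proof (rule generated_equiv_subset[OF eq])
      have "?\<delta> (\<pi> (Inl x)) (\<pi> (Inr (h x))) = 0" if "x \<in> S1" for x
        unfolding HLS_glue_pseudodist_def
        by (rule quotient_pseudodist_eq_0[OF dH Q])
          (use that in \<open>auto simp: HLS_glue_rel_def \<pi>_def intro!: subsetD[OF generated_equiv_superset]\<close>)
      then show "(\<lambda>x. (Inl x, Inr (h x))) ` S1 \<subseteq> {(u, v). u \<in> ?Y \<and> v \<in> ?Y \<and> ?\<delta> (\<pi> u) (\<pi> v) = 0}"
        using S(1) h(1) by auto
    qed
    then show "?\<delta> (\<pi> u) (\<pi> v) = 0" using \<open>(u, v) \<in> ?R\<close> by auto
  qed
  \<comment> \<open>A point of the gluing locus has representatives on both sides; the one in the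
    summand of a is taken, since there \<open>\<pi>\<close> gives the class of the leaf a.\<close>
  have lift: "\<exists>u\<in>?Y. m = ?R `` {u} \<and> \<pi> u = \<Psi> a" if am: "a \<in> Z" "m \<in> \<Phi> a" for a m
  proof -
    consider L x where "a = Inl L" "L \<in> \<L>1" "x \<in> L" "m = ?j1 x"
      | L x where "a = Inr L" "L \<in> \<L>2" "x \<in> L" "m = ?j2 x"
      using am unfolding Z_def \<Phi>_def by (auto elim!: PlusE)
    then show ?thesis
    proof cases
      case 1
      then show ?thesis
        using part1(2)[of L] proj1[of L x]
        by (intro bexI[of _ "Inl x"]) (auto simp: \<pi>_def \<Psi>_def glue_inl_def)
    next
      case 2
      then show ?thesis
        using part2(2)[of L] proj2[of L x]
        by (intro bexI[of _ "Inr x"]) (auto simp: \<pi>_def \<Psi>_def glue_inr_def)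
    qed
  qed
  let ?D = "\<lambda>a b. ?\<delta> (\<Psi> a) (\<Psi> b)"
  have D: "pseudometric_on Z ?D" by (rule pseudometric_on_pullback[OF \<delta>]) (simp add: \<Psi>)
  have D_le: "?D a b \<le> d m m'" if ab: "a \<in> Z" "b \<in> Z" "m \<in> \<Phi> a" "m' \<in> \<Phi> b" for a b m m'
  proof -
    obtain u v where "u \<in> ?Y" "m = ?R `` {u}" "\<pi> u = \<Psi> a" "v \<in> ?Y" "m' = ?R `` {v}" "\<pi> v = \<Psi> b"
      using lift[OF ab(1,3)] lift[OF ab(2,4)] by blast
    then show ?thesis using points[of u v] by simp
  qed
  \<comment> \<open>Descent of \<open>?D\<close> along \<open>\<Phi>\<close>: if two leaves become
    the same leaf of M, any point m of it belongs to both, and the bound \<open>d m m\<close> is 0.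
    Leaves are nonempty, so such a point exists.\<close>
  have D_zero: "?D a b = 0" if ab: "a \<in> Z" "b \<in> Z" "\<Phi> a = \<Phi> b" for a b
  proof -
    have "\<Phi> a \<noteq> {}" using ab(1) part1(3) part2(3) by (cases a) (auto simp: Z_def \<Phi>_def)
    then obtain m where m: "m \<in> \<Phi> a" by blast
    have "m \<in> topspace T"
      using lift[OF ab(1) m] topspace_glue_topology[OF S(1) h(1)] unfolding T_def
      by (auto intro: quotientI)
    then show ?thesis using D_le[OF ab(1,2), of m m] self m ab(3) by simp
  qed
  obtain D' where D': "pseudometric_on \<L> D'" "\<And>a b. a \<in> Z \<Longrightarrow> b \<in> Z \<Longrightarrow> D' (\<Phi> a) (\<Phi> b) = ?D a b"
    using pseudometric_factor[OF D \<Phi> D_zero] by metis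
  have lower: "?D a b \<le> ?E a b" if "a \<in> Z" "b \<in> Z" for a b
    unfolding D'(2)[OF that, symmetric]
  proof (rule leaf_rho_greatest[OF D'(1)])
    fix K K' m m' assume K: "K \<in> \<L>" "K' \<in> \<L>" "m \<in> K" "m' \<in> K'"
    then obtain a b where "a \<in> Z" "b \<in> Z" "K = \<Phi> a" "K' = \<Phi> b" unfolding \<Phi>[symmetric] by blast
    then show "D' K K' \<le> d m m'" using D'(2) D_le K by simp
  qed
  have "?E a b = ?D a b" if "a \<in> Z" "b \<in> Z" for a b
    using upper[OF that] lower[OF that] by (rule antisym)
  then show ?thesis
    unfolding HLS_def[of d] HLS_dist_def[of d]
    by (rule isometric_identifications[OF \<rho>(3) \<delta> \<Phi> \<Psi>])
qed

end
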